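(* Let $\theta\in\mathbb{R}$, $\omega^0=z_1^\ast\,\mathrm{d}z_1+z_2^\ast\,\mathrm{d}z_2\in\Omega^1(A)$ and $\omega^0_\theta=z_1^\ast\,\mathrm{d}_\theta z_1+z_2^\ast\,\mathrm{d}_\theta z_2\in\Omega^1(A_\theta)$. With respect to the descriptions $\mathrm{Con}(A,\delta)\cong\{\omega^0+\alpha:\alpha\in\Omega^1(B)\}$ and $\mathrm{Con}(A_\theta,\delta)\cong\{\omega^0_\theta+\alpha:\alpha\in\Omega^1(B)\}$, the bijection $\overline{\varphi}_\theta\colon\mathrm{Con}(A_\theta,\delta)\to\mathrm{Con}(A,\delta)$ obtained by restricting $\overline{\varphi}_\theta\colon\Omega^1(A_\theta)\to\Omega^1(A)_\theta$, $a\,\mathrm{d}_\theta a'\mapsto a\star_\theta\mathrm{d}a'$, reads explicitly as $$\overline{\varphi}_\theta\colon\ \omega^0_\theta+\alpha\longmapsto\omega^0+\alpha .$$ In other words, the affine map $\overline{\varphi}_\theta$ sends the point $\omega^0_\theta$ to $\omega^0$ and its linear part is the identity map $\mathrm{id}\colon\Omega^1(B)\to\Omega^1(B)$.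
   Context: Algebras are associative and unital over $\mathbb{C}$, $\otimes=\otimes_{\mathbb{C}}$. Sweedler notation: $\delta(a)=a_{\underline{0}}\otimes a_{\underline{1}}$ for right coactions, $\rho(a)=a_{\underline{-1}}\otimes a_{\underline{0}}$ for left coactions. $A=\mathcal{O}(\mathbb{S}^3)$ is the commutative $\ast$-algebra generated by $z_1,z_2$ modulo the $\ast$-ideal generated by the relation $z_1^\ast z_1+z_2^\ast z_2=\mathbf{1}$. $H=\mathcal{O}(U(1))$ is the commutative $\ast$-Hopf algebra generated by $t$ with $t^\ast t=\mathbf{1}$, $\Delta(t)=t\otimes t$, $\epsilon(t)=1$, $S(t)=t^\ast$. $\delta\colon A\to A\otimes H$ is the right $H$-coaction ($\ast$-algebra map) with $\delta(z_i)=z_i\otimes t$, $\delta(z_i^\ast)=z_i^\ast\otimes t^\ast$. $K=\mathcal{O}(\mathbb{T}^2)$ is the Hopf algebra with basis $\{t_{\mathbf m}:\mathbf m\in\mathbb{Z}^2\}$, $t_{\mathbf m}t_{\mathbf m'}=t_{\mathbf m+\mathbf m'}$, $\Delta(t_{\mathbf m})=t_{\mathbf m}\otimes t_{\mathbf m}$, $\epsilon(t_{\mathbf m})=1$, $S(t_{\mathbf m})=t_{\mathbf m}^\ast=t_{-\mathbf m}$. $\rho\colon A\to K\otimes A$ is the left $K$-coaction ($\ast$-algebra map) with $\rho(z_1)=t_{(1,0)}\otimes z_1$, $\rho(z_2)=t_{(0,1)}\otimes z_2$, $\rho(z_1^\ast)=t_{(-1,0)}\otimes z_1^\ast$, $\rho(z_2^\ast)=t_{(0,-1)}\otimes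 z_2^\ast$. For $\theta\in\mathbb{R}$ let $\sigma_\theta(t_{\mathbf m}\otimes t_{\mathbf m'})=\exp(\pi i\theta(m_1m_2'-m_2m_1'))$ and $R_\theta=\sigma_\theta^{-2}$, i.e. $R_\theta(t_{\mathbf m}\otimes t_{\mathbf m'})=\exp(-2\pi i\theta(m_1m_2'-m_2m_1'))$. $A_\theta$ is the same vector space with the same unit, involution and coactions, and product $a\star_\theta a'=\sigma_\theta(a_{\underline{-1}}\otimes a'_{\underline{-1}})\,a_{\underline 0}a'_{\underline 0}$. $B:=A^{\mathrm{co}H}=\{a\in A:\delta(a)=a\otimes\mathbf 1\}$ coincides with $A_\theta^{\mathrm{co}H}$ as an algebra. Kähler forms: $\Omega^1(A)=\ker\mu_A/(\ker\mu_A)^2$, where $\mu_A\colon A\otimes A\to A$ is the product and the square is formed in the tensor product algebra $A\otimes A$; $\mathrm{d}a$ is the class of $\mathbf 1\otimes a-a\otimes\mathbf 1$. Similarly $\Omega^1(A_\theta)=\ker\mu_{A_\theta}/(\ker\mu_{A_\theta})^2$, where the square is formed in $A_\theta\otimes A_\theta$ with the braided tensor algebra product $(a\otimes a')(\tilde a\otimes\tilde a')=R_\theta(\tilde a_{\underline{-1}}\otimes a'_{\underline{-1}})(a\star_\theta\tilde a_{\underline 0})\otimes(a'_{\underline 0}\star_\theta\tilde a')$; $\mathrm{d}_\theta a$ is the class of $\mathbf 1\otimes a-a\otimes\mathbf 1$. Both carry left $K$- and right $H$-coactions induced by the tensor product coactions. $\Omega^1(A)_\theta$ is the $(K,H)$-bicomodule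 $\Omega^1(A)$ (same vector space) with left $A_\theta$-action $a\star_\theta\lambda=\sigma_\theta(a_{\underline{-1}}\otimes\lambda_{\underline{-1}})\,a_{\underline 0}\lambda_{\underline 0}$. $\Omega^1(B)=\ker\mu_B/(\ker\mu_B)^2$ is the module of Kähler $1$-forms on $B$, identified with $B\,\mathrm{d}(B)\subseteq\Omega^1(A)$ via $b\,\mathrm{d}b'\mapsto b\,\mathrm{d}b'$ and with $B\,\mathrm{d}_\theta(B)\subseteq\Omega^1(A_\theta)$ via $b\,\mathrm{d}b'\mapsto b\,\mathrm{d}_\theta b'$. Connections: let $X\colon H\to\mathbb{C}$, $X(t^n)=n$. Define $\overline{\mathrm{ver}}^X(a\,\mathrm{d}a')=a\,a'_{\underline 0}X(a'_{\underline 1})$ on $\Omega^1(A)$ and $\overline{\mathrm{ver}}^X_\theta(a\,\mathrm{d}_\theta a')=a\star_\theta a'_{\underline 0}X(a'_{\underline 1})$ on $\Omega^1(A_\theta)$. Then $\mathrm{Con}(A,\delta)=\{\omega\in\Omega^1(A)^{\mathrm{co}H}:\overline{\mathrm{ver}}^X(\omega)=\mathbf 1\}$ and $\mathrm{Con}(A_\theta,\delta)=\{\omega_\theta\in\Omega^1(A_\theta)^{\mathrm{co}H}:\overline{\mathrm{ver}}^X_\theta(\omega_\theta)=\mathbf 1\}$. *)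

theory Defs
  imports
    Complex_Main
    "HOL-Library.Poly_Mapping"
    "HOL-Library.Product_Plus"
    "HOL-Library.Set_Algebras"
    "HOL-Library.FuncSet"
begin

section \<open>Complex vector spaces and commutative complex algebras\<close>

class complex_space = ab_group_add +
  fixes scaleC :: "complex \<Rightarrow> 'a \<Rightarrow> 'a"  (infixr \<open>*\<^sub>C\<close> 75)
  assumes scaleC_add_right: "c *\<^sub>C (x + y) = c *\<^sub>C x + c *\<^sub>C y"
    and scaleC_add_left: "(c + d) *\<^sub>C x = c *\<^sub>C x + d *\<^sub>C x"
    and scaleC_scaleC: "c *\<^sub>C d *\<^sub>C x = (c * d) *\<^sub>C x"
    and scaleC_one: "1 *\<^sub>C x = x"

text \<open>The zero algebra is allowed, so that quotients and tensor products are always instances.\<close>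

class complex_calgebra = complex_space + comm_ring + comm_monoid_mult +
  assumes scaleC_mult_left: "(c *\<^sub>C x) * y = c *\<^sub>C (x * y)"

global_interpretation cvs: vector_space "scaleC :: complex \<Rightarrow> 'a \<Rightarrow> 'a::complex_space"
  defines cspan = cvs.span
  by unfold_locales (rule scaleC_add_right scaleC_add_left scaleC_scaleC scaleC_one)+

abbreviation clinear :: "('a::complex_space \<Rightarrow> 'b::complex_space) \<Rightarrow> bool"
  where "clinear \<equiv> Vector_Spaces.linear scaleC scaleC"

definition cbilinear :: "('a::complex_space \<Rightarrow> 'b::complex_space \<Rightarrow> 'c::complex_space) \<Rightarrow> bool"
  where "cbilinear f \<longleftrightarrow> (\<forall>y. clinear (\<lambda>x. f x y)) \<and> (\<forall>x. clinear (f x))"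

lemma scaleC_mult_right: "x * (c *\<^sub>C y) = c *\<^sub>C (x * y)"
  for x y :: "'a::complex_calgebra"
  by (metis mult.commute scaleC_mult_left)

lemma clinearI:
  assumes "\<And>x y. f (x + y) = f x + f y" "\<And>c x. f (c *\<^sub>C x) = c *\<^sub>C f x"
  shows "clinear f"
  using assms by unfold_locales auto

lemma clinear_add: "clinear f \<Longrightarrow> f (x + y) = f x + f y"
  by (rule module_hom.add[of scaleC scaleC]) (simp add: module_hom_iff_linear)

lemma clinear_scale: "clinear f \<Longrightarrow> f (c *\<^sub>C x) = c *\<^sub>C f x"
  by (rule module_hom.scale[of scaleC scaleC]) (simp add: module_hom_iff_linear)

lemma clinear_0: "clinear f \<Longrightarrow> f 0 = 0"
  by (rule module_hom.zero[of scaleC scaleC]) (simp add: module_hom_iff_linear)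

lemma clinear_diff: "clinear f \<Longrightarrow> f (x - y) = f x - f y"
  by (rule module_hom.diff[of scaleC scaleC]) (simp add: module_hom_iff_linear)

lemma clinear_sum: "clinear f \<Longrightarrow> f (sum g I) = (\<Sum>i\<in>I. f (g i))"
  by (rule module_hom.sum[of scaleC scaleC]) (simp add: module_hom_iff_linear)

lemma cbilinearI:
  assumes "\<And>x x' y. f (x + x') y = f x y + f x' y" "\<And>c x y. f (c *\<^sub>C x) y = c *\<^sub>C f x y"
    "\<And>x y y'. f x (y + y') = f x y + f x y'" "\<And>c x y. f x (c *\<^sub>C y) = c *\<^sub>C f x y"
  shows "cbilinear f"
  unfolding cbilinear_def by (intro conjI allI clinearI assms)

lemma cspan_eq_zero:
  assumes "x \<in> cspan S" "clinear f" "\<And>s. s \<in> S \<Longrightarrow> f s = 0"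
  shows "f x = 0"
  using assms(1)
proof (induction rule: cvs.span_induct_alt[consumes 1])
  case base then show ?case by (rule clinear_0[OF assms(2)])
next
  case (step c x y)
  then show ?case by (simp add: clinear_add[OF assms(2)] clinear_scale[OF assms(2)] assms(3))
qed

instantiation complex :: complex_calgebra
begin
definition scaleC_complex :: "complex \<Rightarrow> complex \<Rightarrow> complex" where "scaleC_complex = (*)"
instance by standard (simp_all add: scaleC_complex_def algebra_simps)
end

instantiation poly_mapping :: (type, complex_space) complex_space
begin
definition scaleC_poly_mapping :: "complex \<Rightarrow> ('a \<Rightarrow>\<^sub>0 'b) \<Rightarrow> ('a \<Rightarrow>\<^sub>0 'b)"
  where "scaleC_poly_mapping c p = Poly_Mapping.map (scaleC c) p"
lemma lookup_scaleC: "Poly_Mapping.lookup (c *\<^sub>C p) k = c *\<^sub>C Poly_Mapping.lookup p k" for p :: "'a \<Rightarrow>\<^sub>0 'b"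
  by (auto simp: scaleC_poly_mapping_def Poly_Mapping.map.rep_eq when_def cvs.scale_zero_right)
instance
  by standard (simp_all add: poly_mapping_eq_iff fun_eq_iff lookup_scaleC lookup_add
      scaleC_add_right scaleC_add_left scaleC_scaleC scaleC_one)
end

lemma scaleC_single: "c *\<^sub>C Poly_Mapping.single k (d::complex) = Poly_Mapping.single k (c * d)"
  by (rule poly_mapping_eqI) (simp add: lookup_scaleC lookup_single when_def scaleC_complex_def)

lemma scaleC_eq_single_mult: "c *\<^sub>C p = Poly_Mapping.single 0 c * p"
  for p :: "'a::monoid_add \<Rightarrow>\<^sub>0 complex"
  unfolding mult_map_scale_conv_mult[symmetric] scaleC_poly_mapping_def scaleC_complex_def ..

instance poly_mapping :: (comm_monoid_add, "{complex_calgebra, comm_ring_1}") complex_calgebra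
proof
  fix c :: complex and x y :: "'a \<Rightarrow>\<^sub>0 'b"
  have *: "c *\<^sub>C p = Poly_Mapping.single 0 (c *\<^sub>C 1) * p" for p :: "'a \<Rightarrow>\<^sub>0 'b"
    unfolding mult_map_scale_conv_mult[symmetric] scaleC_poly_mapping_def
    by (rule poly_mapping_eqI) (auto simp: Poly_Mapping.map.rep_eq when_def scaleC_mult_left)
  show "c *\<^sub>C x * y = c *\<^sub>C (x * y)"
    unfolding * by (simp add: mult.assoc)
qed

text \<open>Linear extension of a function on the canonical basis of a free vector space.\<close>

definition lin_ext :: "('k \<Rightarrow> 'a::complex_space) \<Rightarrow> ('k \<Rightarrow>\<^sub>0 complex) \<Rightarrow> 'a"
  where "lin_ext f p = (\<Sum>k\<in>Poly_Mapping.keys p. Poly_Mapping.lookup p k *\<^sub>C f k)"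

lemma lin_ext_superset:
  assumes "finite K" "Poly_Mapping.keys p \<subseteq> K"
  shows "lin_ext f p = (\<Sum>k\<in>K. Poly_Mapping.lookup p k *\<^sub>C f k)"
  unfolding lin_ext_def by (rule sum.mono_neutral_left) (use assms in \<open>auto simp: in_keys_iff\<close>)

lemma clinear_lin_ext: "clinear (lin_ext f)"
proof (rule clinearI)
  fix p q :: "'a \<Rightarrow>\<^sub>0 complex" and c
  let ?K = "Poly_Mapping.keys p \<union> Poly_Mapping.keys q"
  show "lin_ext f (p + q) = lin_ext f p + lin_ext f q"
    using Poly_Mapping.keys_add[of p q]
    by (simp add: lin_ext_superset[of ?K] lookup_add scaleC_add_left sum.distrib)
  have "Poly_Mapping.keys (c *\<^sub>C p) \<subseteq> Poly_Mapping.keys p"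
    by (auto simp: in_keys_iff lookup_scaleC)
  then show "lin_ext f (c *\<^sub>C p) = c *\<^sub>C lin_ext f p"
    by (simp add: lin_ext_superset[of "Poly_Mapping.keys p"] lookup_scaleC cvs.scale_sum_right
        scaleC_complex_def scaleC_scaleC)
qed

lemma lin_ext_single [simp]: "lin_ext f (Poly_Mapping.single k c) = c *\<^sub>C f k"
  by (simp add: lin_ext_superset[of "{k}"])

lemma poly_eq_sum: "p = (\<Sum>k\<in>Poly_Mapping.keys p. Poly_Mapping.lookup p k *\<^sub>C Poly_Mapping.single k (1::complex))"
  by (rule poly_mapping_eqI)
    (auto simp: lookup_sum lookup_scaleC scaleC_complex_def lookup_single when_def in_keys_iff
      sum.delta if_distrib[of "(*) _"] cong: if_cong)

lemma poly_linear_induct [case_names zero add scale single]: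
  fixes p :: "'k \<Rightarrow>\<^sub>0 complex"
  assumes "P 0" "\<And>p q. P p \<Longrightarrow> P q \<Longrightarrow> P (p + q)" "\<And>c p. P p \<Longrightarrow> P (c *\<^sub>C p)"
    "\<And>k. P (Poly_Mapping.single k 1)"
  shows "P p"
proof -
  have "P (\<Sum>k\<in>K. Poly_Mapping.lookup p k *\<^sub>C Poly_Mapping.single k 1)" if "finite K" for K
    using that by induction (auto intro: assms)
  then show ?thesis by (subst poly_eq_sum) auto
qed

lemma clinear_poly_eq:
  fixes f g :: "('k \<Rightarrow>\<^sub>0 complex) \<Rightarrow> 'a::complex_space"
  assumes "clinear f" "clinear g" "\<And>k. f (Poly_Mapping.single k 1) = g (Poly_Mapping.single k 1)"
  shows "f p = g p"
  by (induction p rule: poly_linear_induct)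
    (simp_all add: assms(3) clinear_0[OF assms(1)] clinear_0[OF assms(2)] clinear_add[OF assms(1)]
      clinear_add[OF assms(2)] clinear_scale[OF assms(1)] clinear_scale[OF assms(2)])

section \<open>Algebraic tensor products\<close>

definition tensor_rels :: "(('a::complex_space \<times> 'b::complex_space) \<Rightarrow>\<^sub>0 complex) set"
  where "tensor_rels =
    {Poly_Mapping.single (x + x', y) 1 - Poly_Mapping.single (x, y) 1 - Poly_Mapping.single (x', y) 1 | x x' y. True} \<union>
    {Poly_Mapping.single (x, y + y') 1 - Poly_Mapping.single (x, y) 1 - Poly_Mapping.single (x, y') 1 | x y y'. True} \<union>
    {Poly_Mapping.single (c *\<^sub>C x, y) 1 - c *\<^sub>C Poly_Mapping.single (x, y) 1 | c x y. True} \<union>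
    {Poly_Mapping.single (x, c *\<^sub>C y) 1 - c *\<^sub>C Poly_Mapping.single (x, y) 1 | c x y. True}"

lemma equivp_mod_subspace: "equivp (\<lambda>p q. p - q \<in> cspan S)"
proof (intro equivpI reflpI sympI transpI)
  fix p q r :: 'a
  show "p - p \<in> cspan S" by (simp add: cvs.span_zero)
  show "q - p \<in> cspan S" if "p - q \<in> cspan S" using cvs.span_neg[OF that] by simp
  show "p - r \<in> cspan S" if "p - q \<in> cspan S" "q - r \<in> cspan S"
    using cvs.span_add[OF that] by simp
qed

quotient_type (overloaded) ('a, 'b) tensor = "('a::complex_space \<times> 'b::complex_space) \<Rightarrow>\<^sub>0 complex" /
    "\<lambda>p q. p - q \<in> cspan tensor_rels"
  by (rule equivp_mod_subspace)

instantiation tensor :: (complex_space, complex_space) complex_space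
begin
lift_definition zero_tensor :: "('a, 'b) tensor" is 0 .
lift_definition plus_tensor :: "('a, 'b) tensor \<Rightarrow> ('a, 'b) tensor \<Rightarrow> ('a, 'b) tensor" is "(+)"
  subgoal for p p' q q' using cvs.span_add[of "p - p'" tensor_rels "q - q'"] by (simp add: algebra_simps)
  done
lift_definition minus_tensor :: "('a, 'b) tensor \<Rightarrow> ('a, 'b) tensor \<Rightarrow> ('a, 'b) tensor" is "(-)"
  subgoal for p p' q q' using cvs.span_diff[of "p - p'" tensor_rels "q - q'"] by (simp add: algebra_simps)
  done
lift_definition uminus_tensor :: "('a, 'b) tensor \<Rightarrow> ('a, 'b) tensor" is uminus
  subgoal for p p' using cvs.span_neg[of "p - p'" tensor_rels] by (simp add: algebra_simps)
  done
lift_definition scaleC_tensor :: "complex \<Rightarrow> ('a, 'b) tensor \<Rightarrow> ('a, 'b) tensor" is scaleC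
  subgoal for c p p' using cvs.span_scale[of "p - p'" tensor_rels c] by (simp add: cvs.scale_right_diff_distrib)
  done
instance
proof
  fix s t u :: "('a, 'b) tensor" and c d
  have eq: "p - q \<in> cspan tensor_rels" if "p = q" for p q :: "('a \<times> 'b) \<Rightarrow>\<^sub>0 complex"
    using that by (simp add: cvs.span_zero)
  show "s + t + u = s + (t + u)" by (transfer, rule eq) (rule add.assoc)
  show "s + t = t + s" by (transfer, rule eq) (rule add.commute)
  show "0 + s = s" by (transfer, rule eq) simp
  show "- s + s = 0" by (transfer, rule eq) simp
  show "s - t = s + - t" by (transfer, rule eq) simp
  show "c *\<^sub>C (s + t) = c *\<^sub>C s + c *\<^sub>C t" by (transfer, rule eq) (rule scaleC_add_right)
  show "(c + d) *\<^sub>C s = c *\<^sub>C s + d *\<^sub>C s" by (transfer, rule eq) (rule scaleC_add_left)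
  show "c *\<^sub>C d *\<^sub>C s = (c * d) *\<^sub>C s" by (transfer, rule eq) (rule scaleC_scaleC)
  show "1 *\<^sub>C s = s" by (transfer, rule eq) (rule scaleC_one)
qed
end

lift_definition tensor :: "'a::complex_space \<Rightarrow> 'b::complex_space \<Rightarrow> ('a, 'b) tensor" (infixr \<open>\<otimes>\<close> 78)
  is "\<lambda>x y. Poly_Mapping.single (x, y) 1" .

lemma cbilinear_tensor: "cbilinear (\<otimes>)"
proof (rule cbilinearI)
  fix x x' :: 'a and y y' :: 'b and c
  have *: "p - q \<in> cspan tensor_rels" if "p - q \<in> tensor_rels" for p q :: "('a \<times> 'b) \<Rightarrow>\<^sub>0 complex"
    using that by (rule cvs.span_base)
  show "(x + x') \<otimes> y = x \<otimes> y + x' \<otimes> y"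
    by (transfer, rule *, unfold tensor_rels_def diff_diff_eq[symmetric]) blast
  show "x \<otimes> (y + y') = x \<otimes> y + x \<otimes> y'"
    by (transfer, rule *, unfold tensor_rels_def diff_diff_eq[symmetric]) blast
  show "(c *\<^sub>C x) \<otimes> y = c *\<^sub>C (x \<otimes> y)"
    by (transfer, rule *, unfold tensor_rels_def) blast
  show "x \<otimes> (c *\<^sub>C y) = c *\<^sub>C (x \<otimes> y)"
    by (transfer, rule *, unfold tensor_rels_def) blast
qed

text \<open>The linear map induced by a bilinear map.\<close>

definition tensor_lift ::
    "('a::complex_space \<Rightarrow> 'b::complex_space \<Rightarrow> 'c::complex_space) \<Rightarrow> ('a, 'b) tensor \<Rightarrow> 'c"
  where "tensor_lift f t = lin_ext (\<lambda>(x, y). f x y) (rep_tensor t)"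

lemma tensor_lift_abs:
  assumes "cbilinear f"
  shows "tensor_lift f (abs_tensor p) = lin_ext (\<lambda>(x, y). f x y) p"
proof -
  let ?F = "lin_ext (\<lambda>(x, y). f x y)"
  have l: "clinear (\<lambda>x. f x y)" "clinear (f x)" for x y
    using assms by (auto simp: cbilinear_def)
  have "rep_tensor (abs_tensor p) - p \<in> cspan tensor_rels"
    by (rule rep_abs_rsp_left[OF Quotient3_tensor]) (simp add: cvs.span_zero)
  then have "?F (rep_tensor (abs_tensor p) - p) = 0"
    by (rule cspan_eq_zero[OF _ clinear_lin_ext])
      (auto simp: tensor_rels_def clinear_diff[OF clinear_lin_ext] clinear_scale[OF clinear_lin_ext]
         clinear_add[OF l(1)] clinear_add[OF l(2)] clinear_scale[OF l(1)] clinear_scale[OF l(2)])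
  then show ?thesis by (simp add: tensor_lift_def clinear_diff[OF clinear_lin_ext])
qed

lemma tensor_lift_tensor [simp]: "cbilinear f \<Longrightarrow> tensor_lift f (x \<otimes> y) = f x y"
  by (simp add: tensor.abs_eq tensor_lift_abs)

lemma clinear_tensor_lift:
  assumes "cbilinear f" shows "clinear (tensor_lift f)"
proof (rule clinearI)
  fix s t :: "('a, 'b) tensor" and c
  show "tensor_lift f (s + t) = tensor_lift f s + tensor_lift f t"
    by (induction s; induction t)
      (simp add: plus_tensor.abs_eq tensor_lift_abs[OF assms] clinear_add[OF clinear_lin_ext])
  show "tensor_lift f (c *\<^sub>C s) = c *\<^sub>C tensor_lift f s"
    by (induction s)
      (simp add: scaleC_tensor.abs_eq tensor_lift_abs[OF assms] clinear_scale[OF clinear_lin_ext])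
qed

lemma tensor_add_left: "(x + x') \<otimes> y = x \<otimes> y + x' \<otimes> y"
  and tensor_add_right: "x \<otimes> (y + y') = x \<otimes> y + x \<otimes> y'"
  and tensor_scale_left: "(c *\<^sub>C x) \<otimes> y = c *\<^sub>C (x \<otimes> y)"
  and tensor_scale_right: "x \<otimes> (c *\<^sub>C y) = c *\<^sub>C (x \<otimes> y)"
  and tensor_zero_left: "0 \<otimes> y = 0"
  and tensor_zero_right: "x \<otimes> 0 = 0"
  and tensor_diff_left: "(x - x') \<otimes> y = x \<otimes> y - x' \<otimes> y"
  and tensor_diff_right: "x \<otimes> (y - y') = x \<otimes> y - x \<otimes> y'"
proof -
  have l: "clinear (\<lambda>x. x \<otimes> y)" "clinear ((\<otimes>) x)" for x :: 'a and y :: 'b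
    using cbilinear_tensor by (auto simp: cbilinear_def)
  show "(x + x') \<otimes> y = x \<otimes> y + x' \<otimes> y" "(c *\<^sub>C x) \<otimes> y = c *\<^sub>C (x \<otimes> y)" "0 \<otimes> y = 0"
    "(x - x') \<otimes> y = x \<otimes> y - x' \<otimes> y"
    using clinear_add[OF l(1)] clinear_scale[OF l(1)] clinear_0[OF l(1)] clinear_diff[OF l(1)] by auto
  show "x \<otimes> (y + y') = x \<otimes> y + x \<otimes> y'" "x \<otimes> (c *\<^sub>C y) = c *\<^sub>C (x \<otimes> y)" "x \<otimes> 0 = 0"
    "x \<otimes> (y - y') = x \<otimes> y - x \<otimes> y'"
    using clinear_add[OF l(2)] clinear_scale[OF l(2)] clinear_0[OF l(2)] clinear_diff[OF l(2)] by auto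
qed

lemma tensor_induct [case_names tensor add]:
  assumes "\<And>x y. P (x \<otimes> y)" "\<And>s t. P s \<Longrightarrow> P t \<Longrightarrow> P (s + t)"
  shows "P t"
proof -
  have scale: "P (c *\<^sub>C (x \<otimes> y))" for c x y
    using assms(1)[of "c *\<^sub>C x" y] by (simp add: tensor_scale_left)
  have "P (abs_tensor (\<Sum>k\<in>K. l k *\<^sub>C Poly_Mapping.single k 1))" if "finite K" for K l
    using that
  proof induction
    case empty
    show ?case using assms(1)[of 0 0] by (simp add: tensor_zero_left zero_tensor.abs_eq)
  next
    case (insert k K)
    then show ?case
      using scale[of "l k" "fst k" "snd k"]
      by (auto simp: plus_tensor.abs_eq[symmetric] scaleC_tensor.abs_eq tensor.abs_eq intro: assms(2))
  qed
  then show ?thesis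
    by (induction t) (subst poly_eq_sum, auto)
qed

lemma clinear_tensor_eq:
  assumes "clinear f" "clinear g" "\<And>x y. f (x \<otimes> y) = g (x \<otimes> y)"
  shows "f t = g t"
  by (induction t rule: tensor_induct) (simp_all add: assms(3) clinear_add[OF assms(1)] clinear_add[OF assms(2)])

lemma tensor_lift_cong_linear:
  assumes "\<And>x y. cbilinear (F x y)"
    and "\<And>t. cbilinear (\<lambda>x y. tensor_lift (F x y) t)"
  shows "cbilinear (\<lambda>s t. tensor_lift (\<lambda>x y. tensor_lift (F x y) t) s)"
proof (rule cbilinearI)
  fix s s' t t' c
  let ?G = "\<lambda>s t. tensor_lift (\<lambda>x y. tensor_lift (F x y) t) s"
  have l1: "clinear (\<lambda>s. ?G s t)" for t by (rule clinear_tensor_lift[OF assms(2)])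
  have l2: "clinear (tensor_lift (F x y))" for x y by (rule clinear_tensor_lift[OF assms(1)])
  show "?G (s + s') t = ?G s t + ?G s' t" "?G (c *\<^sub>C s) t = c *\<^sub>C ?G s t"
    by (simp_all add: clinear_add[OF l1] clinear_scale[OF l1])
  have G: "?G (x \<otimes> y) t = tensor_lift (F x y) t" for x y t
    by (rule tensor_lift_tensor[OF assms(2)])
  show "?G s (t + t') = ?G s t + ?G s t'"
  proof (induction s rule: tensor_induct)
    case (tensor x y) show ?case unfolding G by (rule clinear_add[OF l2])
  next
    case (add s s') then show ?case unfolding clinear_add[OF l1] by (simp only: ac_simps)
  qed
  show "?G s (c *\<^sub>C t) = c *\<^sub>C ?G s t"
  proof (induction s rule: tensor_induct)
    case (tensor x y) show ?case unfolding G by (rule clinear_scale[OF l2])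
  next
    case (add s s') then show ?case unfolding clinear_add[OF l1] by (simp only: scaleC_add_right)
  qed
qed

lemma cbilinear_tensor_lift:
  assumes "\<And>x y. cbilinear (F x y)" "\<And>u v. cbilinear (\<lambda>x y. F x y u v)"
  shows "cbilinear (\<lambda>x y. tensor_lift (F x y) t)"
proof (rule cbilinearI)
  fix x x' y y' c
  have l1: "clinear (\<lambda>x. F x y u v)" "clinear (\<lambda>y. F x y u v)" for x y u v
    using assms(2) by (auto simp: cbilinear_def)
  have l2: "clinear (tensor_lift (F x y))" for x y by (rule clinear_tensor_lift[OF assms(1)])
  have T: "tensor_lift (F x y) (u \<otimes> v) = F x y u v" for x y u v
    by (rule tensor_lift_tensor[OF assms(1)])
  show "tensor_lift (F (x + x') y) t = tensor_lift (F x y) t + tensor_lift (F x' y) t"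
  proof (induction t rule: tensor_induct)
    case (tensor u v) show ?case unfolding T by (rule clinear_add[OF l1(1)])
  next
    case (add s s') then show ?case unfolding clinear_add[OF l2] by (simp only: ac_simps)
  qed
  show "tensor_lift (F (c *\<^sub>C x) y) t = c *\<^sub>C tensor_lift (F x y) t"
  proof (induction t rule: tensor_induct)
    case (tensor u v) show ?case unfolding T by (rule clinear_scale[OF l1(1)])
  next
    case (add s s') then show ?case unfolding clinear_add[OF l2] by (simp only: scaleC_add_right)
  qed
  show "tensor_lift (F x (y + y')) t = tensor_lift (F x y) t + tensor_lift (F x y') t"
  proof (induction t rule: tensor_induct)
    case (tensor u v) show ?case unfolding T by (rule clinear_add[OF l1(2)])
  next
    case (add s s') then show ?case unfolding clinear_add[OF l2] by (simp only: ac_simps)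
  qed
  show "tensor_lift (F x (c *\<^sub>C y)) t = c *\<^sub>C tensor_lift (F x y) t"
  proof (induction t rule: tensor_induct)
    case (tensor u v) show ?case unfolding T by (rule clinear_scale[OF l1(2)])
  next
    case (add s s') then show ?case unfolding clinear_add[OF l2] by (simp only: scaleC_add_right)
  qed
qed

instantiation tensor :: (complex_calgebra, complex_calgebra) complex_calgebra
begin

definition one_tensor :: "('a, 'b) tensor" where "one_tensor = 1 \<otimes> 1"

definition times_tensor :: "('a, 'b) tensor \<Rightarrow> ('a, 'b) tensor \<Rightarrow> ('a, 'b) tensor"
  where "times_tensor s t =
    tensor_lift (\<lambda>x y. tensor_lift (\<lambda>x' y'. (x * x') \<otimes> (y * y')) t) s"

lemma cbilinear_times_tensor: "cbilinear ((*) :: ('a, 'b) tensor \<Rightarrow> _)"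
  and times_tensor_tensor: "(x \<otimes> y) * (x' \<otimes> y') = (x * x') \<otimes> (y * y' :: 'b)" for x x' :: 'a
proof -
  have F: "cbilinear (\<lambda>x' y'. (x * x') \<otimes> (y * y'))" "cbilinear (\<lambda>x' y'. (x' * x) \<otimes> (y' * y))"
    for x :: 'a and y :: 'b
    by (rule cbilinearI; simp add: algebra_simps tensor_add_left tensor_add_right scaleC_mult_left
        scaleC_mult_right tensor_scale_left tensor_scale_right)+
  have G: "cbilinear (\<lambda>x y. tensor_lift (\<lambda>x' y'. (x * x') \<otimes> (y * y')) t)" for t :: "('a, 'b) tensor"
    by (rule cbilinear_tensor_lift) (rule F)+
  show "cbilinear ((*) :: ('a, 'b) tensor \<Rightarrow> _)"
    unfolding times_tensor_def[abs_def] by (rule tensor_lift_cong_linear) (rule F G)+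
  show "(x \<otimes> y) * (x' \<otimes> y') = (x * x') \<otimes> (y * y')" for x x' :: 'a and y y' :: 'b
    by (simp add: times_tensor_def F G)
qed

instance
proof
  fix s t u :: "('a, 'b) tensor" and c
  have l: "clinear (\<lambda>s. s * t)" "clinear ((*) t)" for t :: "('a, 'b) tensor"
    using cbilinear_times_tensor by (auto simp: cbilinear_def)
  note d = clinear_add[OF l(1)] clinear_add[OF l(2)]
  show distrib: "(s + t) * u = s * u + t * u" by (rule d)
  show "c *\<^sub>C s * t = c *\<^sub>C (s * t)" by (rule clinear_scale[OF l(1)])
  have 1: "(x \<otimes> y) * t = t * (x \<otimes> y)" for x y and t :: "('a, 'b) tensor"
    by (induction t rule: tensor_induct)
      (simp_all only: times_tensor_tensor d mult.commute[of x] mult.commute[of y])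
  show "s * t = t * s"
    by (induction s rule: tensor_induct) (simp_all only: 1 d)
  show "1 * s = s"
    by (induction s rule: tensor_induct) (simp_all only: one_tensor_def times_tensor_tensor d mult_1_left)
  have 2: "((x \<otimes> y) * (x' \<otimes> y')) * u = (x \<otimes> y) * ((x' \<otimes> y') * u)" for x y x' y'
    by (induction u rule: tensor_induct) (simp_all only: times_tensor_tensor d mult.assoc)
  have 3: "((x \<otimes> y) * t) * u = (x \<otimes> y) * (t * u)" for x y
    by (induction t rule: tensor_induct) (simp_all only: 2 d)
  show "s * t * u = s * (t * u)"
    by (induction s rule: tensor_induct) (simp_all only: 3 d)
qed

end

section \<open>Commutative *-algebras by generators and relations\<close>

text \<open>The free commutative *-algebra on a set of generators is the polynomial ring in the
  generators and their formal adjoints.\<close>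

datatype 'g letter = Gen 'g | Adj 'g

type_synonym 'g star_poly = "('g letter \<Rightarrow>\<^sub>0 nat) \<Rightarrow>\<^sub>0 complex"

fun adj_letter :: "'g letter \<Rightarrow> 'g letter" where
  "adj_letter (Gen g) = Adj g"
| "adj_letter (Adj g) = Gen g"

definition var :: "'g letter \<Rightarrow> 'g star_poly"
  where "var x = Poly_Mapping.single (Poly_Mapping.single x 1) 1"

definition poly_star :: "'g star_poly \<Rightarrow> 'g star_poly"
  where "poly_star p =
    lin_ext (\<lambda>m. Poly_Mapping.single (Poly_Mapping.map_key adj_letter m) 1) (Poly_Mapping.map cnj p)"

class star_presentation =
  fixes relators :: "(('a letter \<Rightarrow>\<^sub>0 nat) \<Rightarrow>\<^sub>0 complex) set"

inductive_set star_ideal :: "'g::star_presentation star_poly set" where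
  relator: "r \<in> relators \<Longrightarrow> r \<in> star_ideal"
| zero: "0 \<in> star_ideal"
| add: "p \<in> star_ideal \<Longrightarrow> q \<in> star_ideal \<Longrightarrow> p + q \<in> star_ideal"
| mult: "q \<in> star_ideal \<Longrightarrow> p * q \<in> star_ideal"
| star: "p \<in> star_ideal \<Longrightarrow> poly_star p \<in> star_ideal"

lemma star_ideal_uminus: "p \<in> star_ideal \<Longrightarrow> - p \<in> star_ideal"
  using star_ideal.mult[of p "- 1"] by simp

lemma star_ideal_diff: "p \<in> star_ideal \<Longrightarrow> q \<in> star_ideal \<Longrightarrow> p - q \<in> star_ideal"
  using star_ideal.add[OF _ star_ideal_uminus] by (metis diff_conv_add_uminus)

lemma star_ideal_scale: "p \<in> star_ideal \<Longrightarrow> c *\<^sub>C p \<in> star_ideal"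
  unfolding scaleC_eq_single_mult by (rule star_ideal.mult)

quotient_type (overloaded) 'g star_alg = "'g::star_presentation star_poly" / "\<lambda>p q. p - q \<in> star_ideal"
proof (intro equivpI reflpI sympI transpI)
  fix p q r :: "'g star_poly"
  show "p - p \<in> star_ideal" by (simp add: star_ideal.zero)
  show "q - p \<in> star_ideal" if "p - q \<in> star_ideal" using star_ideal_uminus[OF that] by simp
  show "p - r \<in> star_ideal" if "p - q \<in> star_ideal" "q - r \<in> star_ideal"
    using star_ideal.add[OF that] by simp
qed

lemma poly_map_cnj:
  "Poly_Mapping.map cnj (p + q) = Poly_Mapping.map cnj p + Poly_Mapping.map cnj q"
  "Poly_Mapping.map cnj (p - q) = Poly_Mapping.map cnj p - Poly_Mapping.map cnj q"
  "Poly_Mapping.map cnj (c *\<^sub>C p) = cnj c *\<^sub>C Poly_Mapping.map cnj p"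
proof -
  have l: "Poly_Mapping.lookup (Poly_Mapping.map cnj p) k = cnj (Poly_Mapping.lookup p k)" for p :: "'a \<Rightarrow>\<^sub>0 complex" and k
    by (auto simp: Poly_Mapping.map.rep_eq when_def)
  show "Poly_Mapping.map cnj (p + q) = Poly_Mapping.map cnj p + Poly_Mapping.map cnj q"
    "Poly_Mapping.map cnj (p - q) = Poly_Mapping.map cnj p - Poly_Mapping.map cnj q"
    "Poly_Mapping.map cnj (c *\<^sub>C p) = cnj c *\<^sub>C Poly_Mapping.map cnj p"
    by (rule poly_mapping_eqI; simp add: l lookup_add lookup_minus lookup_scaleC scaleC_complex_def)+
qed

lemma poly_star_add: "poly_star (p + q) = poly_star p + poly_star q"
  and poly_star_diff: "poly_star (p - q) = poly_star p - poly_star q"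
  and poly_star_scale: "poly_star (c *\<^sub>C p) = cnj c *\<^sub>C poly_star p"
  by (simp_all add: poly_star_def poly_map_cnj clinear_add[OF clinear_lin_ext]
      clinear_diff[OF clinear_lin_ext] clinear_scale[OF clinear_lin_ext])

lemma inj_adj_letter: "inj adj_letter"
proof (rule injI)
  fix x y :: "'a letter"
  show "x = y" if "adj_letter x = adj_letter y" using that by (cases x; cases y) auto
qed

lemma poly_star_single:
  "poly_star (Poly_Mapping.single m c) = Poly_Mapping.single (Poly_Mapping.map_key adj_letter m) (cnj c)"
  by (simp add: poly_star_def scaleC_single)

lemma poly_star_mult: "poly_star (p * q) = poly_star p * poly_star q"
proof (induction p rule: poly_linear_induct)
  case (single k)
  show ?case
  proof (induction q rule: poly_linear_induct)
    case (single m)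
    show ?case by (simp add: mult_single poly_star_single map_key_plus[OF inj_adj_letter])
  qed (simp_all add: distrib_left poly_star_add poly_star_scale scaleC_mult_right poly_star_diff[of 0 0, simplified])
qed (simp_all add: distrib_right poly_star_add poly_star_scale scaleC_mult_left poly_star_diff[of 0 0, simplified])

lemma poly_star_poly_star: "poly_star (poly_star p) = p"
proof (induction p rule: poly_linear_induct)
  case (single k)
  have "adj_letter (adj_letter x) = x" for x :: "'a letter" by (cases x) auto
  then have "Poly_Mapping.map_key adj_letter (Poly_Mapping.map_key adj_letter k) = k"
    by (intro poly_mapping_eqI) (simp add: Poly_Mapping.map_key.rep_eq inj_adj_letter)
  then show ?case by (simp add: poly_star_single)
qed (simp_all add: poly_star_add poly_star_scale poly_star_diff[of 0 0, simplified])

instantiation star_alg :: (star_presentation) complex_calgebra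
begin
lift_definition zero_star_alg :: "'a star_alg" is 0 .
lift_definition one_star_alg :: "'a star_alg" is 1 .
lift_definition plus_star_alg :: "'a star_alg \<Rightarrow> 'a star_alg \<Rightarrow> 'a star_alg" is "(+)"
  subgoal for p p' q q' using star_ideal.add[of "p - p'" "q - q'"] by (simp add: algebra_simps)
  done
lift_definition minus_star_alg :: "'a star_alg \<Rightarrow> 'a star_alg \<Rightarrow> 'a star_alg" is "(-)"
  subgoal for p p' q q' using star_ideal_diff[of "p - p'" "q - q'"] by (simp add: algebra_simps)
  done
lift_definition uminus_star_alg :: "'a star_alg \<Rightarrow> 'a star_alg" is uminus
  subgoal for p p' using star_ideal_uminus[of "p - p'"] by (simp add: algebra_simps)
  done
lift_definition times_star_alg :: "'a star_alg \<Rightarrow> 'a star_alg \<Rightarrow> 'a star_alg" is "(*)"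
  subgoal for p p' q q'
    using star_ideal.add[OF star_ideal.mult[of "p - p'" q] star_ideal.mult[of "q - q'" p']]
    by (simp add: algebra_simps)
  done
lift_definition scaleC_star_alg :: "complex \<Rightarrow> 'a star_alg \<Rightarrow> 'a star_alg" is scaleC
  subgoal for c p p' using star_ideal_scale[of "p - p'" c] by (simp add: cvs.scale_right_diff_distrib)
  done
instance
proof
  fix a b e :: "'a star_alg" and c d
  have eq: "p - q \<in> star_ideal" if "p = q" for p q :: "'a star_poly"
    using that by (simp add: star_ideal.zero)
  show "a + b + e = a + (b + e)" by (transfer, rule eq) (rule add.assoc)
  show "a + b = b + a" by (transfer, rule eq) (rule add.commute)
  show "0 + a = a" by (transfer, rule eq) simp
  show "- a + a = 0" by (transfer, rule eq) simp
  show "a - b = a + - b" by (transfer, rule eq) simp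
  show "a * b * e = a * (b * e)" by (transfer, rule eq) (rule mult.assoc)
  show "a * b = b * a" by (transfer, rule eq) (rule mult.commute)
  show "1 * a = a" by (transfer, rule eq) simp
  show "(a + b) * e = a * e + b * e" by (transfer, rule eq) (rule distrib_right)
  show "c *\<^sub>C (a + b) = c *\<^sub>C a + c *\<^sub>C b" by (transfer, rule eq) (rule scaleC_add_right)
  show "(c + d) *\<^sub>C a = c *\<^sub>C a + d *\<^sub>C a" by (transfer, rule eq) (rule scaleC_add_left)
  show "c *\<^sub>C d *\<^sub>C a = (c * d) *\<^sub>C a" by (transfer, rule eq) (rule scaleC_scaleC)
  show "1 *\<^sub>C a = a" by (transfer, rule eq) (rule scaleC_one)
  show "c *\<^sub>C a * b = c *\<^sub>C (a * b)" by (transfer, rule eq) (rule scaleC_mult_left)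
qed
end

lift_definition star :: "'g::star_presentation star_alg \<Rightarrow> 'g star_alg" is poly_star
  using star_ideal.star by (simp flip: poly_star_diff)

lift_definition generator :: "'g::star_presentation \<Rightarrow> 'g star_alg" is "\<lambda>g. var (Gen g)" .

text \<open>The algebra map that sends each generator and each adjoint of a generator to a given value.\<close>

definition poly_eval :: "('g letter \<Rightarrow> 'a::complex_calgebra) \<Rightarrow> 'g star_poly \<Rightarrow> 'a"
  where "poly_eval f = lin_ext (\<lambda>m. \<Prod>x\<in>Poly_Mapping.keys m. f x ^ Poly_Mapping.lookup m x)"

definition alg_lift :: "('g letter \<Rightarrow> 'a::complex_calgebra) \<Rightarrow> 'g::star_presentation star_alg \<Rightarrow> 'a"
  where "alg_lift f a = poly_eval f (rep_star_alg a)"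

definition respects_relators :: "('g::star_presentation letter \<Rightarrow> 'a::complex_calgebra) \<Rightarrow> bool"
  where "respects_relators f \<longleftrightarrow> (\<forall>r\<in>relators. poly_eval f r = 0 \<and> poly_eval f (poly_star r) = 0)"

lemma clinear_poly_eval: "clinear (poly_eval f)"
  unfolding poly_eval_def by (rule clinear_lin_ext)

lemmas poly_eval_linear = clinear_add[OF clinear_poly_eval] clinear_scale[OF clinear_poly_eval]
  clinear_0[OF clinear_poly_eval] clinear_diff[OF clinear_poly_eval]

lemma poly_eval_single:
  "poly_eval f (Poly_Mapping.single m c) = c *\<^sub>C (\<Prod>x\<in>Poly_Mapping.keys m. f x ^ Poly_Mapping.lookup m x)"
  by (simp add: poly_eval_def)

lemma poly_eval_one [simp]: "poly_eval f 1 = 1"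
  by (simp add: poly_eval_single[of f 0 1, simplified])

lemma poly_eval_var [simp]: "poly_eval f (var x) = f x"
  by (simp add: var_def poly_eval_single)

lemma poly_eval_mult: "poly_eval f (p * q) = poly_eval f p * poly_eval f q"
proof (induction p rule: poly_linear_induct)
  case (single m)
  show ?case
  proof (induction q rule: poly_linear_induct)
    case (single n)
    have *: "(\<Prod>x\<in>Poly_Mapping.keys m. f x ^ Poly_Mapping.lookup m x) = (\<Prod>x\<in>K. f x ^ Poly_Mapping.lookup m x)"
      if "Poly_Mapping.keys m \<subseteq> K" "finite K" for m K
      by (rule prod.mono_neutral_left) (use that in \<open>auto simp: in_keys_iff\<close>)
    let ?K = "Poly_Mapping.keys m \<union> Poly_Mapping.keys n"
    show ?case
      using *[of m ?K] *[of n ?K] *[of "m + n" ?K] Poly_Mapping.keys_add[of m n]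
      by (simp add: mult_single poly_eval_single lookup_add power_add prod.distrib)
  qed (simp_all add: distrib_left poly_eval_linear scaleC_mult_right)
qed (simp_all add: distrib_right poly_eval_linear scaleC_mult_left)

lemma poly_eval_star_ideal:
  assumes "respects_relators f" "p \<in> star_ideal"
  shows "poly_eval f p = 0"
proof -
  have "poly_eval f p = 0 \<and> poly_eval f (poly_star p) = 0"
    using assms(2)
    by induction
      (use assms(1) in \<open>auto simp: respects_relators_def poly_eval_linear poly_eval_mult poly_star_add
        poly_star_mult poly_star_poly_star poly_star_diff[of 0 0, simplified]\<close>)
  then show ?thesis ..
qed

lemma alg_lift_abs:
  assumes "respects_relators f"
  shows "alg_lift f (abs_star_alg p) = poly_eval f p"
proof -
  have "rep_star_alg (abs_star_alg p) - p \<in> star_ideal"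
    by (rule rep_abs_rsp_left[OF Quotient3_star_alg]) (simp add: star_ideal.zero)
  from poly_eval_star_ideal[OF assms this] show ?thesis
    by (simp add: alg_lift_def poly_eval_linear)
qed

lemma
  assumes "respects_relators f"
  shows alg_lift_add: "alg_lift f (a + b) = alg_lift f a + alg_lift f b"
    and alg_lift_scale: "alg_lift f (c *\<^sub>C a) = c *\<^sub>C alg_lift f a"
    and alg_lift_mult: "alg_lift f (a * b) = alg_lift f a * alg_lift f b"
    and alg_lift_one: "alg_lift f 1 = 1"
    and alg_lift_generator: "alg_lift f (generator g) = f (Gen g)"
    and alg_lift_star_generator: "alg_lift f (star (generator g)) = f (Adj g)"
    and clinear_alg_lift: "clinear (alg_lift f)"
proof -
  note s = alg_lift_abs[OF assms] poly_eval_linear poly_eval_mult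
  show add: "alg_lift f (a + b) = alg_lift f a + alg_lift f b" for a b
    by (induction a; induction b) (simp add: plus_star_alg.abs_eq s)
  show scale: "alg_lift f (c *\<^sub>C a) = c *\<^sub>C alg_lift f a" for c a
    by (induction a) (simp add: scaleC_star_alg.abs_eq s)
  show "alg_lift f (a * b) = alg_lift f a * alg_lift f b"
    by (induction a; induction b) (simp add: times_star_alg.abs_eq s)
  show "alg_lift f 1 = 1" by (simp add: one_star_alg.abs_eq s)
  show "alg_lift f (generator g) = f (Gen g)" by (simp add: generator.abs_eq s)
  have "poly_star (var (Gen g)) = var (Adj g)"
    using map_key_single[OF inj_adj_letter, of "Adj g" "1::nat"] by (simp add: var_def poly_star_single)
  then show "alg_lift f (star (generator g)) = f (Adj g)" by (simp add: generator.abs_eq star.abs_eq s)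
  show "clinear (alg_lift f)" by (rule clinearI add scale)+
qed

section \<open>The algebras of the 3-sphere, the circle and the 2-torus\<close>

datatype sphere_gen = Z1 | Z2

datatype circle_gen = T

instantiation sphere_gen :: star_presentation
begin
definition relators_sphere_gen :: "sphere_gen star_poly set"
  where "relators_sphere_gen = {var (Adj Z1) * var (Gen Z1) + var (Adj Z2) * var (Gen Z2) - 1}"
instance ..
end

instantiation circle_gen :: star_presentation
begin
definition relators_circle_gen :: "circle_gen star_poly set"
  where "relators_circle_gen = {var (Adj T) * var (Gen T) - 1}"
instance ..
end

type_synonym sphere = "sphere_gen star_alg"
type_synonym circle = "circle_gen star_alg"

text \<open>The group algebra of the integer lattice.\<close>

type_synonym torus = "(int \<times> int) \<Rightarrow>\<^sub>0 complex"

abbreviation z1 :: sphere where "z1 \<equiv> generator Z1"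
abbreviation z2 :: sphere where "z2 \<equiv> generator Z2"
abbreviation circle_t :: circle where "circle_t \<equiv> generator T"

definition tm :: "int \<times> int \<Rightarrow> torus" where "tm m = Poly_Mapping.single m 1"

definition delta_letter :: "sphere_gen letter \<Rightarrow> (sphere, circle) tensor"
  where "delta_letter x = (case x of Gen g \<Rightarrow> generator g \<otimes> circle_t | Adj g \<Rightarrow> star (generator g) \<otimes> star circle_t)"

definition delta :: "sphere \<Rightarrow> (sphere, circle) tensor"
  where "delta = alg_lift delta_letter"

fun weight :: "sphere_gen \<Rightarrow> int \<times> int" where
  "weight Z1 = (1, 0)"
| "weight Z2 = (0, 1)"

definition rho_letter :: "sphere_gen letter \<Rightarrow> (torus, sphere) tensor"
  where "rho_letter x =
    (case x of Gen g \<Rightarrow> tm (weight g) \<otimes> generator g | Adj g \<Rightarrow> tm (- weight g) \<otimes> star (generator g))"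

definition rho :: "sphere \<Rightarrow> (torus, sphere) tensor"
  where "rho = alg_lift rho_letter"

lemma poly_star_var: "poly_star (var x) = var (adj_letter x)"
proof -
  have "adj_letter (adj_letter x) = x" by (cases x) auto
  then show ?thesis
    using map_key_single[OF inj_adj_letter, of "adj_letter x" "1::nat"] by (simp add: var_def poly_star_single)
qed

lemma poly_star_one: "poly_star 1 = (1 :: 'a star_poly)"
proof -
  have "Poly_Mapping.map_key adj_letter 0 = (0 :: 'a letter \<Rightarrow>\<^sub>0 nat)"
    by (intro poly_mapping_eqI) (simp add: Poly_Mapping.map_key.rep_eq inj_adj_letter)
  then show ?thesis using poly_star_single[of "0 :: 'a letter \<Rightarrow>\<^sub>0 nat" 1] by simp
qed

lemma sphere_relation: "star z1 * z1 + star z2 * z2 = 1"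
proof -
  have "var (Adj Z1) * var (Gen Z1) + var (Adj Z2) * var (Gen Z2) - 1 \<in> star_ideal"
    by (rule star_ideal.relator) (simp add: relators_sphere_gen_def)
  then show ?thesis by transfer (simp add: poly_star_var)
qed

lemma circle_relation: "star circle_t * circle_t = 1"
proof -
  have "var (Adj T) * var (Gen T) - 1 \<in> star_ideal"
    by (rule star_ideal.relator) (simp add: relators_circle_gen_def)
  then show ?thesis by transfer (simp add: poly_star_var)
qed

lemma respects_delta: "respects_relators delta_letter"
  by (simp add: respects_relators_def relators_sphere_gen_def delta_letter_def poly_eval_linear
      poly_eval_mult poly_star_diff poly_star_add poly_star_mult poly_star_var poly_star_one
      times_tensor_tensor circle_relation mult.commute[of _ "star _"] flip: tensor_add_left)
    (simp add: sphere_relation one_tensor_def)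

lemma respects_rho: "respects_relators rho_letter"
  by (simp add: respects_relators_def relators_sphere_gen_def rho_letter_def poly_eval_linear
      poly_eval_mult poly_star_diff poly_star_add poly_star_mult poly_star_var poly_star_one
      times_tensor_tensor tm_def mult_single mult.commute[of _ "star _"] flip: tensor_add_right zero_prod_def)
    (simp add: sphere_relation one_tensor_def)

text \<open>\<open>X\<close> is the linear functional with value \<open>n\<close> on the \<open>n\<close>-th integer power of the generator; it is
  computed on Laurent polynomials.\<close>

definition laurent_letter :: "circle_gen letter \<Rightarrow> (int \<Rightarrow>\<^sub>0 complex)"
  where "laurent_letter x = (case x of Gen _ \<Rightarrow> Poly_Mapping.single 1 1 | Adj _ \<Rightarrow> Poly_Mapping.single (- 1) 1)"

definition X :: "circle \<Rightarrow> complex"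
  where "X h = lin_ext of_int (alg_lift laurent_letter h)"

lemma respects_laurent: "respects_relators laurent_letter"
  by (simp add: respects_relators_def relators_circle_gen_def laurent_letter_def poly_eval_linear
      poly_eval_mult poly_star_diff poly_star_mult poly_star_var poly_star_one mult_single)

lemma clinear_X: "clinear X"
  by (rule clinearI) (simp_all add: X_def alg_lift_add[OF respects_laurent]
      alg_lift_scale[OF respects_laurent] clinear_add[OF clinear_lin_ext] clinear_scale[OF clinear_lin_ext])

lemma X_power: "X (circle_t ^ n) = of_nat n" and X_star_power: "X (star circle_t ^ n) = - of_nat n"
proof -
  have v: "laurent_letter (Gen T) = Poly_Mapping.single 1 1" "laurent_letter (Adj T) = Poly_Mapping.single (- 1) 1"
    by (simp_all add: laurent_letter_def)
  have a: "alg_lift laurent_letter (circle_t ^ n) = Poly_Mapping.single (int n) 1"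
    by (induction n) (simp_all add: alg_lift_one[OF respects_laurent] alg_lift_mult[OF respects_laurent]
        alg_lift_generator[OF respects_laurent] v mult_single)
  have b: "alg_lift laurent_letter (star circle_t ^ n) = Poly_Mapping.single (- int n) 1"
    by (induction n) (simp_all add: alg_lift_one[OF respects_laurent] alg_lift_mult[OF respects_laurent]
        alg_lift_star_generator[OF respects_laurent] v mult_single)
  show "X (circle_t ^ n) = of_nat n" "X (star circle_t ^ n) = - of_nat n"
    by (simp_all add: X_def a b)
qed

lemma clinear_delta: "clinear delta" and delta_mult: "delta (a * b) = delta a * delta b" and delta_one: "delta 1 = 1"
  unfolding delta_def using respects_delta by (auto simp: clinear_alg_lift alg_lift_mult alg_lift_one)

lemma clinear_rho: "clinear rho" and rho_mult: "rho (a * b) = rho a * rho b" and rho_one: "rho 1 = 1"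
  unfolding rho_def using respects_rho by (auto simp: clinear_alg_lift alg_lift_mult alg_lift_one)

section \<open>Coinvariants\<close>

typedef base = "{a :: sphere. delta a = a \<otimes> 1}"
  by (rule exI[of _ 0]) (simp add: clinear_0[OF clinear_delta] tensor_zero_left)

setup_lifting type_definition_base

instantiation base :: complex_calgebra
begin
lift_definition zero_base :: base is 0
  by (simp add: clinear_0[OF clinear_delta] tensor_zero_left)
lift_definition one_base :: base is 1
  by (simp add: delta_one one_tensor_def)
lift_definition plus_base :: "base \<Rightarrow> base \<Rightarrow> base" is "(+)"
  by (simp add: clinear_add[OF clinear_delta] tensor_add_left)
lift_definition minus_base :: "base \<Rightarrow> base \<Rightarrow> base" is "(-)"
  by (simp add: clinear_diff[OF clinear_delta] tensor_diff_left)
lift_definition uminus_base :: "base \<Rightarrow> base" is uminus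
  subgoal for a
    using clinear_diff[OF clinear_delta, of 0 a] tensor_diff_left[of 0 a "1 :: circle"]
    by (simp add: clinear_0[OF clinear_delta] tensor_zero_left)
  done
lift_definition times_base :: "base \<Rightarrow> base \<Rightarrow> base" is "(*)"
  by (simp add: delta_mult times_tensor_tensor)
lift_definition scaleC_base :: "complex \<Rightarrow> base \<Rightarrow> base" is scaleC
  by (simp add: clinear_scale[OF clinear_delta] tensor_scale_left)
instance
proof
  fix a b e :: base and c d
  show "a + b + e = a + (b + e)" by transfer (rule add.assoc)
  show "a + b = b + a" by transfer (rule add.commute)
  show "0 + a = a" by transfer simp
  show "- a + a = 0" by transfer simp
  show "a - b = a + - b" by transfer simp
  show "a * b * e = a * (b * e)" by transfer (rule mult.assoc)
  show "a * b = b * a" by transfer (rule mult.commute)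
  show "1 * a = a" by transfer simp
  show "(a + b) * e = a * e + b * e" by transfer (rule distrib_right)
  show "c *\<^sub>C (a + b) = c *\<^sub>C a + c *\<^sub>C b" by transfer (rule scaleC_add_right)
  show "(c + d) *\<^sub>C a = c *\<^sub>C a + d *\<^sub>C a" by transfer (rule scaleC_add_left)
  show "c *\<^sub>C d *\<^sub>C a = (c * d) *\<^sub>C a" by transfer (rule scaleC_scaleC)
  show "1 *\<^sub>C a = a" by transfer (rule scaleC_one)
  show "c *\<^sub>C a * b = c *\<^sub>C (a * b)" by transfer (rule scaleC_mult_left)
qed
end

section \<open>The twist\<close>

text \<open>Sweedler notation is rendered by \<^const>\<open>tensor_lift\<close>: an expression that is bilinear in
  the two legs \<open>k\<close>, \<open>x\<close> of \<open>rho a\<close> is \<open>tensor_lift (\<lambda>k x. _) (rho a)\<close>. A function of two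
  lattice points extends bilinearly to a form on the torus algebra.\<close>

definition torus_form :: "(int \<times> int \<Rightarrow> int \<times> int \<Rightarrow> complex) \<Rightarrow> torus \<Rightarrow> torus \<Rightarrow> complex"
  where "torus_form f k k' = lin_ext (\<lambda>m. lin_ext (f m) k') k"

definition sigma :: "real \<Rightarrow> torus \<Rightarrow> torus \<Rightarrow> complex"
  where "sigma \<theta> = torus_form (\<lambda>(m1, m2) (n1, n2). exp (pi * \<i> * \<theta> * of_int (m1 * n2 - m2 * n1)))"

definition Rform :: "real \<Rightarrow> torus \<Rightarrow> torus \<Rightarrow> complex"
  where "Rform \<theta> = torus_form (\<lambda>(m1, m2) (n1, n2). exp (- 2 * pi * \<i> * \<theta> * of_int (m1 * n2 - m2 * n1)))"

definition twist_mult :: "real \<Rightarrow> sphere \<Rightarrow> sphere \<Rightarrow> sphere"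
  where "twist_mult \<theta> a a' =
    tensor_lift (\<lambda>k x. tensor_lift (\<lambda>k' x'. sigma \<theta> k k' *\<^sub>C (x * x')) (rho a')) (rho a)"

definition braid_mult ::
    "real \<Rightarrow> (sphere, sphere) tensor \<Rightarrow> (sphere, sphere) tensor \<Rightarrow> (sphere, sphere) tensor"
  where "braid_mult \<theta> s s' =
    tensor_lift (\<lambda>a a'. tensor_lift (\<lambda>b b'.
      tensor_lift (\<lambda>k y. tensor_lift (\<lambda>k' y'.
        Rform \<theta> k k' *\<^sub>C (twist_mult \<theta> a y \<otimes> twist_mult \<theta> y' b')) (rho a')) (rho b)) s') s"

section \<open>Kaehler forms\<close>

text \<open>The constructions are parametrised by a product \<open>m\<close> on a space and a product \<open>M\<close> on its
  tensor square, which is the usual one or the braided one (the latter depends on a real parameter,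
  so that the forms are a set and not a type). A form is represented as a coset; the
  sum of cosets is the elementwise sum.\<close>

definition mult_ker :: "('a::complex_calgebra \<Rightarrow> 'a \<Rightarrow> 'a) \<Rightarrow> ('a, 'a) tensor set"
  where "mult_ker m = {s. tensor_lift m s = 0}"

definition mult_ker_sq ::
    "('a::complex_calgebra \<Rightarrow> 'a \<Rightarrow> 'a) \<Rightarrow> (('a, 'a) tensor \<Rightarrow> ('a, 'a) tensor \<Rightarrow> ('a, 'a) tensor) \<Rightarrow> ('a, 'a) tensor set"
  where "mult_ker_sq m M = cspan {M s s' | s s'. s \<in> mult_ker m \<and> s' \<in> mult_ker m}"

definition form_class ::
    "('a::complex_calgebra \<Rightarrow> 'a \<Rightarrow> 'a) \<Rightarrow> (('a, 'a) tensor \<Rightarrow> ('a, 'a) tensor \<Rightarrow> ('a, 'a) tensor) \<Rightarrow> ('a, 'a) tensor \<Rightarrow> ('a, 'a) tensor set"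
  where "form_class m M s = s +o mult_ker_sq m M"

definition Omega ::
    "('a::complex_calgebra \<Rightarrow> 'a \<Rightarrow> 'a) \<Rightarrow> (('a, 'a) tensor \<Rightarrow> ('a, 'a) tensor \<Rightarrow> ('a, 'a) tensor) \<Rightarrow> ('a, 'a) tensor set set"
  where "Omega m M = form_class m M ` mult_ker m"

definition form_d ::
    "('a::complex_calgebra \<Rightarrow> 'a \<Rightarrow> 'a) \<Rightarrow> (('a, 'a) tensor \<Rightarrow> ('a, 'a) tensor \<Rightarrow> ('a, 'a) tensor) \<Rightarrow> 'a \<Rightarrow> ('a, 'a) tensor set"
  where "form_d m M a = form_class m M (1 \<otimes> a - a \<otimes> 1)"

definition form_act ::
    "('a::complex_calgebra \<Rightarrow> 'a \<Rightarrow> 'a) \<Rightarrow> (('a, 'a) tensor \<Rightarrow> ('a, 'a) tensor \<Rightarrow> ('a, 'a) tensor) \<Rightarrow> 'a \<Rightarrow> ('a, 'a) tensor set \<Rightarrow> ('a, 'a) tensor set"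
  where "form_act m M a \<omega> = (\<Union>s\<in>\<omega>. form_class m M (M (a \<otimes> 1) s))"

text \<open>The additive map on forms that is determined by its values \<open>g a a'\<close> on the forms \<open>a da'\<close>.
  For all the maps defined in this way, existence and uniqueness are proved below.\<close>

definition is_form_map ::
    "('a::complex_calgebra \<Rightarrow> 'a \<Rightarrow> 'a) \<Rightarrow> (('a, 'a) tensor \<Rightarrow> ('a, 'a) tensor \<Rightarrow> ('a, 'a) tensor) \<Rightarrow>
      ('a \<Rightarrow> 'a \<Rightarrow> 'c::plus) \<Rightarrow> (('a, 'a) tensor set \<Rightarrow> 'c) \<Rightarrow> bool"
  where "is_form_map m M g f \<longleftrightarrow>
    f \<in> extensional (Omega m M) \<and>
    (\<forall>\<omega>\<in>Omega m M. \<forall>\<omega>'\<in>Omega m M. f (\<omega> + \<omega>') = f \<omega> + f \<omega>') \<and>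
    (\<forall>a a'. f (form_act m M a (form_d m M a')) = g a a')"

definition form_map ::
    "('a::complex_calgebra \<Rightarrow> 'a \<Rightarrow> 'a) \<Rightarrow> (('a, 'a) tensor \<Rightarrow> ('a, 'a) tensor \<Rightarrow> ('a, 'a) tensor) \<Rightarrow>
      ('a \<Rightarrow> 'a \<Rightarrow> 'c::plus) \<Rightarrow> ('a, 'a) tensor set \<Rightarrow> 'c"
  where "form_map m M g = (THE f. is_form_map m M g f)"

abbreviation OmegaA :: "(sphere, sphere) tensor set set" where "OmegaA \<equiv> Omega (*) (*)"
abbreviation dA :: "sphere \<Rightarrow> (sphere, sphere) tensor set" where "dA \<equiv> form_d (*) (*)"
abbreviation actA :: "sphere \<Rightarrow> (sphere, sphere) tensor set \<Rightarrow> (sphere, sphere) tensor set"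
  where "actA \<equiv> form_act (*) (*)"

abbreviation OmegaB :: "(base, base) tensor set set" where "OmegaB \<equiv> Omega (*) (*)"

abbreviation Omega_theta :: "real \<Rightarrow> (sphere, sphere) tensor set set"
  where "Omega_theta \<theta> \<equiv> Omega (twist_mult \<theta>) (braid_mult \<theta>)"
abbreviation d_theta :: "real \<Rightarrow> sphere \<Rightarrow> (sphere, sphere) tensor set"
  where "d_theta \<theta> \<equiv> form_d (twist_mult \<theta>) (braid_mult \<theta>)"
abbreviation act_theta :: "real \<Rightarrow> sphere \<Rightarrow> (sphere, sphere) tensor set \<Rightarrow> (sphere, sphere) tensor set"
  where "act_theta \<theta> \<equiv> form_act (twist_mult \<theta>) (braid_mult \<theta>)"

text \<open>The identification of the forms on the base with forms on the sphere, for both calculi.\<close>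

definition iota :: "(base, base) tensor set \<Rightarrow> (sphere, sphere) tensor set"
  where "iota = form_map (*) (*) (\<lambda>b b'. actA (Rep_base b) (dA (Rep_base b')))"

definition iota_theta :: "real \<Rightarrow> (base, base) tensor set \<Rightarrow> (sphere, sphere) tensor set"
  where "iota_theta \<theta> = form_map (*) (*) (\<lambda>b b'. act_theta \<theta> (Rep_base b) (d_theta \<theta> (Rep_base b')))"

section \<open>Coactions on forms\<close>

definition rho2 :: "(sphere, sphere) tensor \<Rightarrow> (torus, (sphere, sphere) tensor) tensor"
  where "rho2 = tensor_lift (\<lambda>a a'.
    tensor_lift (\<lambda>k x. tensor_lift (\<lambda>k' x'. (k * k') \<otimes> (x \<otimes> x')) (rho a')) (rho a))"

definition delta2 :: "(sphere, sphere) tensor \<Rightarrow> ((sphere, sphere) tensor, circle) tensor"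
  where "delta2 = tensor_lift (\<lambda>a a'.
    tensor_lift (\<lambda>x h. tensor_lift (\<lambda>x' h'. (x \<otimes> x') \<otimes> (h * h')) (delta a')) (delta a))"

text \<open>The coactions on forms are induced by the tensor product coactions.
  With \<open>N\<close> the square of the kernel \<open>I\<close> of the product, the tensor product of the space of forms
  with \<open>H\<close> is the quotient of \<open>I \<otimes> H\<close> by \<open>N \<otimes> H\<close>, and likewise for \<open>K\<close> on the left.\<close>

definition coinvariant_forms ::
    "(sphere \<Rightarrow> sphere \<Rightarrow> sphere) \<Rightarrow> ((sphere, sphere) tensor \<Rightarrow> (sphere, sphere) tensor \<Rightarrow> (sphere, sphere) tensor) \<Rightarrow>
      (sphere, sphere) tensor set set"
  where "coinvariant_forms m M =
    (let NH = cspan {n \<otimes> h | n h. n \<in> mult_ker_sq m M}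
     in {\<omega> \<in> Omega m M. (\<Union>s\<in>\<omega>. delta2 s +o NH) = (\<Union>s\<in>\<omega>. (s \<otimes> 1) +o NH)})"

definition twist_act :: "real \<Rightarrow> sphere \<Rightarrow> (sphere, sphere) tensor set \<Rightarrow> (sphere, sphere) tensor set"
  where "twist_act \<theta> a \<omega> =
    (let KN = cspan {k \<otimes> n | k n. n \<in> mult_ker_sq (*) (*)}
     in \<Union>w\<in>(\<Union>s\<in>\<omega>. rho2 s +o KN). form_class (*) (*)
       (tensor_lift (\<lambda>k x. tensor_lift (\<lambda>k' s. sigma \<theta> k k' *\<^sub>C ((x \<otimes> 1) * s)) w) (rho a)))"

definition phi_bar :: "real \<Rightarrow> (sphere, sphere) tensor set \<Rightarrow> (sphere, sphere) tensor set"
  where "phi_bar \<theta> = form_map (twist_mult \<theta>) (braid_mult \<theta>) (\<lambda>a a'. twist_act \<theta> a (dA a'))"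

section \<open>Connections\<close>

text \<open>\<open>X_act a\<close> is the contraction of \<open>X\<close> with the second leg of \<open>delta a\<close>.\<close>

definition X_act :: "sphere \<Rightarrow> sphere"
  where "X_act a = tensor_lift (\<lambda>x h. X h *\<^sub>C x) (delta a)"

definition ver :: "(sphere, sphere) tensor set \<Rightarrow> sphere"
  where "ver = form_map (*) (*) (\<lambda>a a'. a * X_act a')"

definition ver_theta :: "real \<Rightarrow> (sphere, sphere) tensor set \<Rightarrow> sphere"
  where "ver_theta \<theta> = form_map (twist_mult \<theta>) (braid_mult \<theta>) (\<lambda>a a'. twist_mult \<theta> a (X_act a'))"

definition Con :: "(sphere, sphere) tensor set set"
  where "Con = {\<omega> \<in> coinvariant_forms (*) (*). ver \<omega> = 1}"

definition Con_theta :: "real \<Rightarrow> (sphere, sphere) tensor set set"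
  where "Con_theta \<theta> = {\<omega> \<in> coinvariant_forms (twist_mult \<theta>) (braid_mult \<theta>). ver_theta \<theta> \<omega> = 1}"

definition omega0 :: "(sphere, sphere) tensor set"
  where "omega0 = actA (star z1) (dA z1) + actA (star z2) (dA z2)"

definition omega0_theta :: "real \<Rightarrow> (sphere, sphere) tensor set"
  where "omega0_theta \<theta> = act_theta \<theta> (star z1) (d_theta \<theta> z1) + act_theta \<theta> (star z2) (d_theta \<theta> z2)"

section \<open>Well-definedness\<close>

text \<open>The facts \<open>phi_bar_is_form_map\<close>, \<open>ver_is_form_map\<close>, \<open>ver_theta_is_form_map\<close>,
  \<open>iota_is_form_map\<close> and \<open>iota_theta_is_form_map\<close> below, together with
  \<open>is_form_map_unique\<close>, justify the definite descriptions used above.\<close>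

lemma cbilinearD:
  assumes "cbilinear f"
  shows "f (x + x') y = f x y + f x' y" "f x (y + y') = f x y + f x y'"
    "f (x - x') y = f x y - f x' y" "f x (y - y') = f x y - f x y'"
    "f (c *\<^sub>C x) y = c *\<^sub>C f x y" "f x (c *\<^sub>C y) = c *\<^sub>C f x y" "f 0 y = 0" "f x 0 = 0"
proof -
  have l: "clinear (\<lambda>x. f x y)" "clinear (f x)" for x y
    using assms by (auto simp: cbilinear_def)
  show "f (x + x') y = f x y + f x' y" by (rule clinear_add[OF l(1)])
  show "f x (y + y') = f x y + f x y'" by (rule clinear_add[OF l(2)])
  show "f (x - x') y = f x y - f x' y" by (rule clinear_diff[OF l(1)])
  show "f x (y - y') = f x y - f x y'" by (rule clinear_diff[OF l(2)])
  show "f (c *\<^sub>C x) y = c *\<^sub>C f x y" by (rule clinear_scale[OF l(1)])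
  show "f x (c *\<^sub>C y) = c *\<^sub>C f x y" by (rule clinear_scale[OF l(2)])
  show "f 0 y = 0" by (rule clinear_0[OF l(1)])
  show "f x 0 = 0" by (rule clinear_0[OF l(2)])
qed

lemma cbilinear_sum:
  assumes "cbilinear f"
  shows "f (\<Sum>i\<in>I. g i) (\<Sum>j\<in>J. h j) = (\<Sum>i\<in>I. \<Sum>j\<in>J. f (g i) (h j))"
proof -
  have l: "clinear (\<lambda>x. f x y)" "clinear (f x)" for x y
    using assms by (auto simp: cbilinear_def)
  show ?thesis unfolding clinear_sum[OF l(1)] clinear_sum[OF l(2)] by (rule sum.swap)
qed

lemma cbilinear_mult: "cbilinear ((*) :: 'a::complex_calgebra \<Rightarrow> _)"
  by (rule cbilinearI) (simp_all add: distrib_left distrib_right scaleC_mult_left scaleC_mult_right)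

lemma tensor_lift_fun_add:
  "tensor_lift (\<lambda>x y. f x y + g x y) s = tensor_lift f s + tensor_lift g s"
  by (simp add: tensor_lift_def lin_ext_def scaleC_add_right case_prod_unfold sum.distrib)

lemma tensor_lift_fun_scale:
  "tensor_lift (\<lambda>x y. c *\<^sub>C f x y) s = c *\<^sub>C tensor_lift f s"
  by (simp add: tensor_lift_def lin_ext_def case_prod_unfold cvs.scale_sum_right scaleC_scaleC mult.commute)

lemma tensor_lift_in_span:
  assumes "\<And>x y. f x y \<in> cspan S"
  shows "tensor_lift f s \<in> cspan S"
  unfolding tensor_lift_def lin_ext_def
  by (rule cvs.span_sum, rule cvs.span_scale) (auto simp: assms split: prod.split)

subsection \<open>Maps on forms\<close>

locale kaehler =
  fixes m :: "'a::complex_calgebra \<Rightarrow> 'a \<Rightarrow> 'a"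
    and M :: "('a, 'a) tensor \<Rightarrow> ('a, 'a) tensor \<Rightarrow> ('a, 'a) tensor"
  assumes m: "cbilinear m" and m_one: "m a 1 = a"
    and M: "cbilinear M"
    and M_left_right: "M (a \<otimes> 1) (1 \<otimes> b) = a \<otimes> b"
    and M_left_left: "M (a \<otimes> 1) (b \<otimes> 1) = m a b \<otimes> 1"
    and M_assoc: "M (a \<otimes> 1) (M s s') = M (M (a \<otimes> 1) s) s'"
    and m_M: "tensor_lift m (M (a \<otimes> 1) s) = m a (tensor_lift m s)"
begin

lemma form_class_eq_iff: "form_class m M s = form_class m M s' \<longleftrightarrow> s - s' \<in> mult_ker_sq m M"
proof
  assume "form_class m M s = form_class m M s'"
  moreover have "s \<in> form_class m M s"
    unfolding form_class_def mult_ker_sq_def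
    using set_plus_intro2[OF cvs.span_zero, of s] by simp
  ultimately show "s - s' \<in> mult_ker_sq m M"
    unfolding form_class_def by (simp add: set_plus_imp_minus)
next
  let ?N = "mult_ker_sq m M"
  have sub: "form_class m M s \<subseteq> form_class m M s'" if "s - s' \<in> ?N" for s s'
  proof
    fix x assume "x \<in> form_class m M s"
    then have "x - s \<in> ?N" by (simp add: form_class_def set_plus_imp_minus)
    then have "(x - s) + (s - s') \<in> ?N" using that unfolding mult_ker_sq_def by (rule cvs.span_add)
    then show "x \<in> form_class m M s'" by (simp add: form_class_def set_minus_plus)
  qed
  assume *: "s - s' \<in> ?N"
  then have "s' - s \<in> ?N" unfolding mult_ker_sq_def using cvs.span_neg by fastforce
  then show "form_class m M s = form_class m M s'" using sub * by blast
qed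

lemma in_form_class_iff: "s' \<in> form_class m M s \<longleftrightarrow> s' - s \<in> mult_ker_sq m M"
  by (simp add: form_class_def set_minus_plus)

lemma form_class_self: "s \<in> form_class m M s"
  by (simp add: in_form_class_iff mult_ker_sq_def cvs.span_zero)

lemma form_class_add: "form_class m M s + form_class m M s' = form_class m M (s + s')"
proof -
  let ?N = "mult_ker_sq m M"
  have "?N + ?N = ?N"
  proof
    show "?N + ?N \<subseteq> ?N" unfolding mult_ker_sq_def by (auto elim!: set_plus_elim intro: cvs.span_add)
    show "?N \<subseteq> ?N + ?N" by (rule set_zero_plus2) (simp add: mult_ker_sq_def cvs.span_zero)
  qed
  then show ?thesis unfolding form_class_def set_plus_rearrange by simp
qed

lemma mult_ker_add: "s \<in> mult_ker m \<Longrightarrow> s' \<in> mult_ker m \<Longrightarrow> s + s' \<in> mult_ker m"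
  by (simp add: mult_ker_def clinear_add[OF clinear_tensor_lift[OF m]])

lemma mult_ker_sq_left:
  assumes "s \<in> mult_ker_sq m M" shows "M (a \<otimes> 1) s \<in> mult_ker_sq m M"
  using assms unfolding mult_ker_sq_def
proof (induction rule: cvs.span_induct_alt[consumes 1])
  case base show ?case by (simp add: cbilinearD[OF M] cvs.span_zero)
next
  case (step c x y)
  from step(1) obtain s s' where s: "x = M s s'" "s \<in> mult_ker m" "s' \<in> mult_ker m" by blast
  then have "M (a \<otimes> 1) s \<in> mult_ker m" by (simp add: mult_ker_def m_M cbilinearD[OF m])
  then have "M (a \<otimes> 1) x \<in> cspan {M s s' |s s'. s \<in> mult_ker m \<and> s' \<in> mult_ker m}"
    unfolding s(1) M_assoc using s(3) by (intro cvs.span_base) blast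
  with step show ?case by (simp add: cbilinearD[OF M] cvs.span_add cvs.span_scale)
qed

lemma form_act_class: "form_act m M a (form_class m M s) = form_class m M (M (a \<otimes> 1) s)"
proof -
  have "form_class m M (M (a \<otimes> 1) s') = form_class m M (M (a \<otimes> 1) s)" if "s' \<in> form_class m M s" for s'
    using mult_ker_sq_left[of "s' - s" a] that
    by (simp add: form_class_eq_iff in_form_class_iff cbilinearD[OF M])
  then show ?thesis unfolding form_act_def using form_class_self by blast
qed

lemma form_act_d: "form_act m M a (form_d m M b) = form_class m M (a \<otimes> b - m a b \<otimes> 1)"
  by (simp add: form_d_def form_act_class cbilinearD[OF M] M_left_right M_left_left)

definition normal :: "('a, 'a) tensor \<Rightarrow> ('a, 'a) tensor"
  where "normal s = s - tensor_lift m s \<otimes> 1"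

lemma normal_add: "normal (s + s') = normal s + normal s'"
  by (simp add: normal_def clinear_add[OF clinear_tensor_lift[OF m]] tensor_add_left)

lemma normal_in_mult_ker: "normal s \<in> mult_ker m"
  by (simp add: normal_def mult_ker_def clinear_diff[OF clinear_tensor_lift[OF m]]
      tensor_lift_tensor[OF m] m_one)

lemma normal_mult_ker: "s \<in> mult_ker m \<Longrightarrow> normal s = s"
  by (simp add: normal_def mult_ker_def tensor_zero_left)

lemma is_form_map_unique:
  assumes "is_form_map m M g f" "is_form_map m M g f'"
  shows "f = f'"
proof (rule extensionalityI)
  show "f \<in> extensional (Omega m M)" "f' \<in> extensional (Omega m M)"
    using assms by (auto simp: is_form_map_def)
  have *: "f (form_class m M (normal s)) = f' (form_class m M (normal s))" for s
  proof (induction s rule: tensor_induct)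
    case (tensor a b)
    show ?case using assms
      by (simp add: is_form_map_def normal_def tensor_lift_tensor[OF m] flip: form_act_d)
  next
    case (add s s')
    have split: "f'' (form_class m M (normal (s + s'))) =
        f'' (form_class m M (normal s)) + f'' (form_class m M (normal s'))"
      if "is_form_map m M g f''" for f''
      using that normal_in_mult_ker unfolding normal_add form_class_add[symmetric] is_form_map_def Omega_def
      by blast
    show ?case by (simp add: split[OF assms(1)] split[OF assms(2)] add)
  qed
  show "f \<omega> = f' \<omega>" if "\<omega> \<in> Omega m M" for \<omega>
  proof -
    from that obtain s where "s \<in> mult_ker m" "\<omega> = form_class m M s" by (auto simp: Omega_def)
    then show ?thesis using *[of s] by (simp add: normal_mult_ker)
  qed
qed

lemma form_map_exists:
  assumes add: "\<And>s s'. s \<in> mult_ker m \<Longrightarrow> s' \<in> mult_ker m \<Longrightarrow> F (s + s') = F s + F s'"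
    and cong: "\<And>s s'. s - s' \<in> mult_ker_sq m M \<Longrightarrow> F s = F s'"
    and g: "\<And>a b. F (a \<otimes> b - m a b \<otimes> 1) = g a b"
  shows "is_form_map m M g (form_map m M g)"
    and "s \<in> mult_ker m \<Longrightarrow> form_map m M g (form_class m M s) = F s"
proof -
  define f where "f = (\<lambda>\<omega>. if \<omega> \<in> Omega m M then F (SOME s. s \<in> mult_ker m \<and> form_class m M s = \<omega>) else undefined)"
  have f: "f (form_class m M s) = F s" if "s \<in> mult_ker m" for s
  proof -
    have "\<exists>s'. s' \<in> mult_ker m \<and> form_class m M s' = form_class m M s" using that by blast
    then have "form_class m M (SOME s'. s' \<in> mult_ker m \<and> form_class m M s' = form_class m M s) = form_class m M s"
      by (rule someI2_ex) simp
    then have "F (SOME s'. s' \<in> mult_ker m \<and> form_class m M s' = form_class m M s) = F s"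
      by (intro cong) (simp add: form_class_eq_iff)
    then show ?thesis using that by (simp add: f_def Omega_def)
  qed
  have *: "is_form_map m M g f"
    unfolding is_form_map_def
  proof (intro conjI ballI allI)
    show "f \<in> extensional (Omega m M)" by (simp add: f_def extensional_def)
    fix \<omega> \<omega>' assume "\<omega> \<in> Omega m M" "\<omega>' \<in> Omega m M"
    then show "f (\<omega> + \<omega>') = f \<omega> + f \<omega>'"
      by (auto simp: Omega_def form_class_add f add mult_ker_add)
  next
    fix a b
    have "a \<otimes> b - m a b \<otimes> 1 \<in> mult_ker m"
      using normal_in_mult_ker[of "a \<otimes> b"] by (simp add: normal_def tensor_lift_tensor[OF m])
    then show "f (form_act m M a (form_d m M b)) = g a b" by (simp add: form_act_d f g)
  qed
  have "form_map m M g = f"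
    unfolding form_map_def using * by (intro the_equality) (auto intro: is_form_map_unique)
  with * f show "is_form_map m M g (form_map m M g)"
    "s \<in> mult_ker m \<Longrightarrow> form_map m M g (form_class m M s) = F s" by simp_all
qed

end

interpretation comm: kaehler "(*) :: 'a::complex_calgebra \<Rightarrow> _" "(*)"
proof
  have l: "clinear (tensor_lift ((*) :: 'a \<Rightarrow> _))" by (rule clinear_tensor_lift[OF cbilinear_mult])
  show "tensor_lift (*) (a \<otimes> 1 * s) = a * tensor_lift (*) s" for a :: 'a and s
    by (induction s rule: tensor_induct)
      (simp_all add: distrib_left clinear_add[OF l] times_tensor_tensor tensor_lift_tensor[OF cbilinear_mult] mult.assoc)
qed (simp_all add: cbilinear_mult times_tensor_tensor mult.assoc)

lemma tensor_lift_mult_hom: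
  "tensor_lift (*) (s * s') = tensor_lift (*) s * tensor_lift (*) (s' :: ('a::complex_calgebra, 'a) tensor)"
proof -
  have l: "clinear (tensor_lift ((*) :: 'a \<Rightarrow> _))" by (rule clinear_tensor_lift[OF cbilinear_mult])
  note d = distrib_left distrib_right clinear_add[OF l]
  have *: "tensor_lift (*) ((a \<otimes> b) * s') = tensor_lift (*) (a \<otimes> b) * tensor_lift (*) s'" for a b :: 'a
    by (induction s' rule: tensor_induct)
      (simp_all add: d times_tensor_tensor tensor_lift_tensor[OF cbilinear_mult] ac_simps)
  show ?thesis
    by (induction s rule: tensor_induct) (simp_all only: d *)
qed

subsection \<open>Homogeneous elements\<close>

definition circle_power :: "int \<Rightarrow> circle"
  where "circle_power n = (if 0 \<le> n then circle_t ^ nat n else star circle_t ^ nat (- n))"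

lemma circle_power_add_one: "circle_power (n + 1) = circle_power n * circle_t"
proof (cases "0 \<le> n")
  case True
  then have "nat (n + 1) = Suc (nat n)" by simp
  with True show ?thesis by (simp add: circle_power_def mult.commute)
next
  case False
  then have "nat (- n) = Suc (nat (- (n + 1)))" by simp
  then have "circle_power n = star circle_t ^ nat (- (n + 1)) * star circle_t"
    using False by (simp only: circle_power_def if_False power_Suc2)
  then have *: "circle_power n * circle_t = star circle_t ^ nat (- (n + 1))"
    by (simp only: mult.assoc circle_relation mult_1_right)
  have "circle_power (n + 1) = star circle_t ^ nat (- (n + 1))"
    using False by (cases "n = - 1") (simp_all add: circle_power_def)
  with * show ?thesis by simp
qed

lemma circle_power_add: "circle_power (m + n) = circle_power m * circle_power n"
proof (induction n rule: int_induct[where k = 0])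
  case base show ?case by (simp add: circle_power_def)
next
  case (step1 n)
  then show ?case
    using circle_power_add_one[of "m + n"] circle_power_add_one[of n] by (simp add: add.assoc mult.assoc)
next
  case (step2 n)
  have c: "a = b" if "a * circle_t = b * circle_t" for a b
  proof -
    have "a * circle_t * star circle_t = b * circle_t * star circle_t" using that by simp
    then show ?thesis using circle_relation by (simp add: mult.assoc mult.commute[of circle_t])
  qed
  have "circle_power (m + (n - 1)) * circle_t = circle_power m * circle_power (n - 1) * circle_t"
    using circle_power_add_one[of "m + n - 1"] circle_power_add_one[of "n - 1"] step2
    by (simp add: mult.assoc algebra_simps)
  then show ?case by (rule c)
qed

lemma X_circle_power: "X (circle_power n) = of_int n"
  by (simp add: circle_power_def X_power X_star_power)

definition homogeneous :: "int \<times> int \<Rightarrow> sphere \<Rightarrow> bool"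
  where "homogeneous m a \<longleftrightarrow> rho a = tm m \<otimes> a \<and> delta a = a \<otimes> circle_power (fst m + snd m)"

lemma tm_add: "tm (m + n) = tm m * tm n"
  by (simp add: tm_def mult_single)

lemma tm_zero: "tm 0 = 1"
  by (simp add: tm_def)

lemma homogeneous_one: "homogeneous 0 1"
  by (simp add: homogeneous_def rho_one delta_one one_tensor_def tm_zero circle_power_def)

lemma homogeneous_mult: "homogeneous m a \<Longrightarrow> homogeneous n b \<Longrightarrow> homogeneous (m + n) (a * b)"
  using circle_power_add[of "fst m + snd m" "fst n + snd n"]
  by (simp add: homogeneous_def rho_mult delta_mult times_tensor_tensor tm_add ac_simps)

lemma homogeneous_add: "homogeneous m a \<Longrightarrow> homogeneous m b \<Longrightarrow> homogeneous m (a + b)"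
  by (simp add: homogeneous_def clinear_add[OF clinear_rho] clinear_add[OF clinear_delta] tensor_add_left tensor_add_right)

lemma homogeneous_scale: "homogeneous m a \<Longrightarrow> homogeneous m (c *\<^sub>C a)"
  by (simp add: homogeneous_def clinear_scale[OF clinear_rho] clinear_scale[OF clinear_delta] tensor_scale_left tensor_scale_right)

lemma homogeneous_zero: "homogeneous m 0"
  by (simp add: homogeneous_def clinear_0[OF clinear_rho] clinear_0[OF clinear_delta] tensor_zero_left tensor_zero_right)

lemma homogeneous_letter: "\<exists>m. homogeneous m (abs_star_alg (var x))"
proof (cases x)
  case (Gen g)
  have "homogeneous (weight g) (generator g)"
    by (cases g) (simp_all add: homogeneous_def rho_def delta_def alg_lift_generator[OF respects_rho]
        alg_lift_generator[OF respects_delta] rho_letter_def delta_letter_def circle_power_def)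
  then show ?thesis unfolding Gen generator.abs_eq by (rule exI)
next
  case (Adj g)
  have "homogeneous (- weight g) (star (generator g))"
    by (cases g) (simp_all add: homogeneous_def rho_def delta_def alg_lift_star_generator[OF respects_rho]
        alg_lift_star_generator[OF respects_delta] rho_letter_def delta_letter_def circle_power_def)
  then show ?thesis unfolding Adj generator.abs_eq star.abs_eq poly_star_var adj_letter.simps by (rule exI)
qed

lemma homogeneous_monomial: "\<exists>w. homogeneous w (abs_star_alg (Poly_Mapping.single m 1))"
proof -
  have 1: "\<exists>w. homogeneous w (abs_star_alg (Poly_Mapping.single (Poly_Mapping.single x n) 1))" for x and n :: nat
  proof (induction n)
    case 0 then show ?case using homogeneous_one by (auto simp: one_star_alg.abs_eq simp del: split_paired_Ex)
  next
    case (Suc n)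
    have "Poly_Mapping.single (Poly_Mapping.single x (Suc n)) 1 =
        var x * Poly_Mapping.single (Poly_Mapping.single x n) 1"
      by (simp add: var_def mult_single flip: single_add)
    then show ?case using Suc homogeneous_letter[of x] homogeneous_mult
      by (metis times_star_alg.abs_eq)
  qed
  have 2: "\<exists>w. homogeneous w (abs_star_alg (Poly_Mapping.single (\<Sum>x\<in>K. Poly_Mapping.single x (l x)) 1))"
    if "finite K" for K and l :: "sphere_gen letter \<Rightarrow> nat"
    using that
  proof induction
    case empty then show ?case using homogeneous_one by (auto simp: one_star_alg.abs_eq simp del: split_paired_Ex)
  next
    case (insert x K)
    have "Poly_Mapping.single (\<Sum>x\<in>insert x K. Poly_Mapping.single x (l x)) 1 =
        Poly_Mapping.single (Poly_Mapping.single x (l x)) (1 :: complex) *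
        Poly_Mapping.single (\<Sum>x\<in>K. Poly_Mapping.single x (l x)) 1"
      using insert by (simp add: mult_single)
    then have *: "abs_star_alg (Poly_Mapping.single (\<Sum>x\<in>insert x K. Poly_Mapping.single x (l x)) 1) =
        abs_star_alg (Poly_Mapping.single (Poly_Mapping.single x (l x)) 1) *
        abs_star_alg (Poly_Mapping.single (\<Sum>x\<in>K. Poly_Mapping.single x (l x)) 1)"
      by (simp only: times_star_alg.abs_eq)
    show ?case unfolding * using insert.IH 1[of x "l x"] homogeneous_mult by blast
  qed
  have "(\<Sum>x\<in>Poly_Mapping.keys m. Poly_Mapping.single x (Poly_Mapping.lookup m x)) = m"
    by (rule poly_mapping_eqI)
      (auto simp: lookup_sum lookup_single when_def in_keys_iff sum.delta cong: if_cong)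
  then show ?thesis using 2[where l = "Poly_Mapping.lookup m", OF finite_keys, of m] by (simp only:)
qed

lemma homogeneous_induct [case_names homogeneous add]:
  assumes "\<And>m a. homogeneous m a \<Longrightarrow> P a" "\<And>a b. P a \<Longrightarrow> P b \<Longrightarrow> P (a + b)"
  shows "P a"
proof -
  have "P (abs_star_alg (\<Sum>k\<in>K. l k *\<^sub>C Poly_Mapping.single k 1))" if "finite K" for K l
    using that
  proof induction
    case empty
    show ?case using assms(1)[OF homogeneous_zero] by (simp add: zero_star_alg.abs_eq)
  next
    case (insert k K)
    obtain w where "homogeneous w (abs_star_alg (Poly_Mapping.single k 1))"
      using homogeneous_monomial by blast
    from assms(1)[OF homogeneous_scale[OF this]] insert show ?case
      by (auto simp: plus_star_alg.abs_eq[symmetric] scaleC_star_alg.abs_eq intro: assms(2))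
  qed
  then show ?thesis by (induction a) (subst poly_eq_sum, auto)
qed

lemma tensor_homogeneous_induct [case_names homogeneous add]:
  assumes "\<And>m a n b. homogeneous m a \<Longrightarrow> homogeneous n b \<Longrightarrow> P (a \<otimes> b)"
    and "\<And>s s'. P s \<Longrightarrow> P s' \<Longrightarrow> P (s + s')"
  shows "P s"
proof (induction s rule: tensor_induct)
  case (tensor a b)
  show ?case
  proof (induction a rule: homogeneous_induct)
    case (homogeneous m a)
    then show ?case
      by (induction b rule: homogeneous_induct) (auto simp: tensor_add_right intro: assms)
  qed (simp add: tensor_add_left assms)
qed (rule assms)

lemma X_act_homogeneous: "homogeneous m a \<Longrightarrow> X_act a = of_int (fst m + snd m) *\<^sub>C a"
  and clinear_X_act: "clinear X_act"
proof -
  have b: "cbilinear (\<lambda>x h. X h *\<^sub>C x)"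
    by (rule cbilinearI) (simp_all add: scaleC_add_left scaleC_add_right clinear_add[OF clinear_X]
        clinear_scale[OF clinear_X] scaleC_scaleC scaleC_complex_def mult.commute)
  show "X_act a = of_int (fst m + snd m) *\<^sub>C a" if "homogeneous m a"
    using that by (simp add: X_act_def homogeneous_def tensor_lift_tensor[OF b] X_circle_power)
  show "clinear X_act"
    by (rule clinearI) (simp_all add: X_act_def clinear_add[OF clinear_delta] clinear_scale[OF clinear_delta]
        clinear_add[OF clinear_tensor_lift[OF b]] clinear_scale[OF clinear_tensor_lift[OF b]])
qed

subsection \<open>The twisted products\<close>

definition weyl :: "real \<Rightarrow> int \<times> int \<Rightarrow> int \<times> int \<Rightarrow> complex"
  where "weyl \<theta> m n = exp (pi * \<i> * \<theta> * of_int (fst m * snd n - snd m * fst n))"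

lemma weyl_add_left: "weyl \<theta> (m + m') n = weyl \<theta> m n * weyl \<theta> m' n"
  and weyl_add_right: "weyl \<theta> n (m + m') = weyl \<theta> n m * weyl \<theta> n m'"
  and weyl_zero_left [simp]: "weyl \<theta> 0 n = 1"
  and weyl_zero_right [simp]: "weyl \<theta> n 0 = 1"
  and weyl_swap: "weyl \<theta> m n * weyl \<theta> n m = 1"
  and weyl_minus_two: "weyl (- 2 * \<theta>) m n = weyl \<theta> n m * weyl \<theta> n m"
  unfolding weyl_def exp_add[symmetric] by (simp_all add: algebra_simps)

lemma cbilinear_torus_form: "cbilinear (torus_form f)"
proof (rule cbilinearI)
  fix x x' y y' :: torus and c
  note l = clinear_add[OF clinear_lin_ext] clinear_scale[OF clinear_lin_ext]
  show "torus_form f (x + x') y = torus_form f x y + torus_form f x' y"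
    "torus_form f (c *\<^sub>C x) y = c *\<^sub>C torus_form f x y"
    by (simp_all add: torus_form_def l)
  show "torus_form f x (y + y') = torus_form f x y + torus_form f x y'"
    by (simp add: torus_form_def l) (simp add: lin_ext_def scaleC_add_right sum.distrib)
  show "torus_form f x (c *\<^sub>C y) = c *\<^sub>C torus_form f x y"
    by (simp add: torus_form_def l) (simp add: lin_ext_def cvs.scale_sum_right scaleC_scaleC ac_simps)
qed

lemma cbilinear_sigma: "cbilinear (sigma \<theta>)" and cbilinear_Rform: "cbilinear (Rform \<theta>)"
  by (simp_all add: sigma_def Rform_def cbilinear_torus_form)

lemma sigma_tm: "sigma \<theta> (tm m) (tm n) = weyl \<theta> m n"
  by (simp add: sigma_def torus_form_def tm_def weyl_def case_prod_unfold)

lemma Rform_tm: "Rform \<theta> (tm m) (tm n) = weyl \<theta> n m * weyl \<theta> n m"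
proof -
  have "Rform \<theta> (tm m) (tm n) = weyl (- 2 * \<theta>) m n"
    by (simp add: Rform_def torus_form_def tm_def weyl_def case_prod_unfold algebra_simps)
  then show ?thesis by (simp only: weyl_minus_two)
qed

text \<open>A pairing of torus coefficients and a bilinear map combine to a bilinear map on comodules.\<close>

lemma cbilinear_pairing:
  fixes G :: "'a::complex_space \<Rightarrow> 'b::complex_space \<Rightarrow> 'c::complex_space" and p :: "torus \<Rightarrow> torus \<Rightarrow> complex"
  assumes p: "cbilinear p" and G: "cbilinear G"
  defines "B \<equiv> \<lambda>u v. tensor_lift (\<lambda>k x. tensor_lift (\<lambda>k' x'. p k k' *\<^sub>C G x x') v) u"
  shows "cbilinear B" and "B (k \<otimes> x) (k' \<otimes> x') = p k k' *\<^sub>C G x x'"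
proof -
  note s = cbilinearD[OF p] cbilinearD[OF G] scaleC_add_left scaleC_add_right scaleC_scaleC scaleC_complex_def
  have 1: "cbilinear (\<lambda>k' x'. p k k' *\<^sub>C G x x')" for k x
    by (rule cbilinearI) (simp_all add: s mult.commute)
  have 2: "cbilinear (\<lambda>k x. p k k' *\<^sub>C G x x')" for k' x'
    by (rule cbilinearI) (simp_all add: s mult.commute)
  have 3: "cbilinear (\<lambda>k x. tensor_lift (\<lambda>k' x'. p k k' *\<^sub>C G x x') v)" for v
    by (rule cbilinear_tensor_lift) (rule 1 2)+
  show "cbilinear B"
    unfolding B_def by (rule tensor_lift_cong_linear) (rule 1 3)+
  show "B (k \<otimes> x) (k' \<otimes> x') = p k k' *\<^sub>C G x x'"
    unfolding B_def by (simp only: tensor_lift_tensor[OF 3] tensor_lift_tensor[OF 2] tensor_lift_tensor[OF 1])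
qed

lemma cbilinear_twist_mult: "cbilinear (twist_mult \<theta>)"
  and twist_mult_homogeneous:
    "homogeneous m a \<Longrightarrow> homogeneous n b \<Longrightarrow> twist_mult \<theta> a b = weyl \<theta> m n *\<^sub>C (a * b)"
proof -
  note c = cbilinear_pairing[OF cbilinear_sigma cbilinear_mult, of \<theta>]
  show "cbilinear (twist_mult \<theta>)"
    by (rule cbilinearI) (simp_all add: twist_mult_def clinear_add[OF clinear_rho]
        clinear_scale[OF clinear_rho] cbilinearD[OF c(1)])
  show "twist_mult \<theta> a b = weyl \<theta> m n *\<^sub>C (a * b)" if "homogeneous m a" "homogeneous n b"
    using that by (simp add: twist_mult_def homogeneous_def c(2) sigma_tm)
qed

lemmas twist_mult_linear = cbilinearD[OF cbilinear_twist_mult]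

lemma cbilinear_braid_mult: "cbilinear (braid_mult \<theta>)"
  and braid_mult_homogeneous:
    "homogeneous m a \<Longrightarrow> homogeneous n a' \<Longrightarrow> homogeneous p b \<Longrightarrow> homogeneous q b' \<Longrightarrow>
      braid_mult \<theta> (a \<otimes> a') (b \<otimes> b') =
        (weyl \<theta> n p * weyl \<theta> n p * weyl \<theta> m p * weyl \<theta> n q) *\<^sub>C ((a * b) \<otimes> (a' * b'))"
proof -
  define C where "C = (\<lambda>a b' u v. tensor_lift (\<lambda>k y. tensor_lift (\<lambda>k' y'.
        Rform \<theta> k k' *\<^sub>C (twist_mult \<theta> a y \<otimes> twist_mult \<theta> y' b')) v) u)"
  have G: "cbilinear (\<lambda>y y'. twist_mult \<theta> a y \<otimes> twist_mult \<theta> y' b')" for a b'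
    by (rule cbilinearI) (simp_all add: twist_mult_linear tensor_add_left tensor_add_right tensor_scale_left tensor_scale_right)
  have C: "cbilinear (C a b')"
    "C a b' (k \<otimes> y) (k' \<otimes> y') = Rform \<theta> k k' *\<^sub>C (twist_mult \<theta> a y \<otimes> twist_mult \<theta> y' b')" for a b' k y k' y'
    using cbilinear_pairing[OF cbilinear_Rform G, of \<theta> a b'] by (simp_all add: C_def)
  have C_outer: "C (a + e) b' u v = C a b' u v + C e b' u v" "C (c *\<^sub>C a) b' u v = c *\<^sub>C C a b' u v"
    "C a (b' + e) u v = C a b' u v + C a e u v" "C a (c *\<^sub>C b') u v = c *\<^sub>C C a b' u v" for a e b' c u v
    unfolding C_def twist_mult_linear tensor_add_left tensor_add_right tensor_scale_left tensor_scale_right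
      scaleC_add_right tensor_lift_fun_add cvs.scale_left_commute[of _ c] tensor_lift_fun_scale
    by simp_all
  note s = C_outer cbilinearD[OF C(1)] clinear_add[OF clinear_rho] clinear_scale[OF clinear_rho]
  have 1: "cbilinear (\<lambda>b b'. C a b' (rho b) (rho a'))" for a a'
    by (rule cbilinearI) (simp_all add: s)
  have 2: "cbilinear (\<lambda>a a'. C a b' (rho b) (rho a'))" for b b'
    by (rule cbilinearI) (simp_all add: s)
  have 3: "cbilinear (\<lambda>a a'. tensor_lift (\<lambda>b b'. C a b' (rho b) (rho a')) v)" for v
    by (rule cbilinear_tensor_lift) (rule 1 2)+
  have braid: "braid_mult \<theta> = (\<lambda>u v. tensor_lift (\<lambda>a a'. tensor_lift (\<lambda>b b'. C a b' (rho b) (rho a')) v) u)"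
    by (simp add: braid_mult_def C_def fun_eq_iff)
  show "cbilinear (braid_mult \<theta>)"
    unfolding braid by (rule tensor_lift_cong_linear) (rule 1 3)+
  show "braid_mult \<theta> (a \<otimes> a') (b \<otimes> b') =
      (weyl \<theta> n p * weyl \<theta> n p * weyl \<theta> m p * weyl \<theta> n q) *\<^sub>C ((a * b) \<otimes> (a' * b'))"
    if h: "homogeneous m a" "homogeneous n a'" "homogeneous p b" "homogeneous q b'"
  proof -
    have "braid_mult \<theta> (a \<otimes> a') (b \<otimes> b') = C a b' (tm p \<otimes> b) (tm n \<otimes> a')"
      unfolding braid tensor_lift_tensor[OF 3] tensor_lift_tensor[OF 1] using h by (simp add: homogeneous_def)
    then show ?thesis
      using h by (simp add: C(2) Rform_tm twist_mult_homogeneous[of m _ p] twist_mult_homogeneous[of n _ q]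
          tensor_scale_left tensor_scale_right scaleC_scaleC mult.assoc)
  qed
qed

lemmas braid_mult_linear = cbilinearD[OF cbilinear_braid_mult]

lemma twist_mult_assoc: "twist_mult \<theta> (twist_mult \<theta> a b) c = twist_mult \<theta> a (twist_mult \<theta> b c)"
proof (induction a rule: homogeneous_induct)
  case a: (homogeneous m a)
  show ?case
  proof (induction b rule: homogeneous_induct)
    case b: (homogeneous n b)
    show ?case
    proof (induction c rule: homogeneous_induct)
      case c: (homogeneous p c)
      show ?case using a b c homogeneous_mult[OF a b] homogeneous_mult[OF b c]
        by (simp add: twist_mult_homogeneous[of m _ n] twist_mult_homogeneous[of n _ p]
            twist_mult_homogeneous[of "m + n" _ p] twist_mult_homogeneous[of m _ "n + p"]
            twist_mult_linear weyl_add_left weyl_add_right scaleC_scaleC ac_simps)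
    qed (simp only: twist_mult_linear)
  qed (simp only: twist_mult_linear)
qed (simp only: twist_mult_linear)

lemma twist_mult_one: "twist_mult \<theta> a 1 = a"
  by (induction a rule: homogeneous_induct)
    (simp_all add: twist_mult_homogeneous[OF _ homogeneous_one] twist_mult_linear)

lemma braid_mult_tensor_right: "braid_mult \<theta> (a \<otimes> 1) (b \<otimes> b') = twist_mult \<theta> a b \<otimes> b'"
proof (induction a rule: homogeneous_induct)
  case a: (homogeneous m a)
  show ?case
  proof (induction b rule: homogeneous_induct)
    case b: (homogeneous n b)
    show ?case
    proof (induction b' rule: homogeneous_induct)
      case b': (homogeneous p b')
      show ?case
        by (simp add: braid_mult_homogeneous[OF a homogeneous_one b b'] twist_mult_homogeneous[OF a b] tensor_scale_left)
    qed (simp add: braid_mult_linear tensor_add_right)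
  qed (simp add: braid_mult_linear twist_mult_linear tensor_add_left)
qed (simp add: braid_mult_linear twist_mult_linear tensor_add_left)

interpretation theta: kaehler "twist_mult \<theta>" "braid_mult \<theta>" for \<theta>
proof
  note l = clinear_add[OF clinear_tensor_lift[OF cbilinear_twist_mult]]
  fix a b :: sphere and s s' :: "(sphere, sphere) tensor"
  show "cbilinear (twist_mult \<theta>)" "cbilinear (braid_mult \<theta>)"
    by (rule cbilinear_twist_mult cbilinear_braid_mult)+
  show one: "twist_mult \<theta> a 1 = a" for a by (rule twist_mult_one)
  show "braid_mult \<theta> (a \<otimes> 1) (1 \<otimes> b) = a \<otimes> b"
    "braid_mult \<theta> (a \<otimes> 1) (b \<otimes> 1) = twist_mult \<theta> a b \<otimes> 1"
    by (simp_all add: braid_mult_tensor_right one)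
  show "tensor_lift (twist_mult \<theta>) (braid_mult \<theta> (a \<otimes> 1) s) = twist_mult \<theta> a (tensor_lift (twist_mult \<theta>) s)"
    by (induction s rule: tensor_induct)
      (simp_all add: braid_mult_tensor_right tensor_lift_tensor[OF cbilinear_twist_mult] twist_mult_assoc
        braid_mult_linear l twist_mult_linear)
  show "braid_mult \<theta> (a \<otimes> 1) (braid_mult \<theta> s s') = braid_mult \<theta> (braid_mult \<theta> (a \<otimes> 1) s) s'"
  proof (induction a rule: homogeneous_induct)
    case a: (homogeneous m a)
    show ?case
    proof (induction s rule: tensor_homogeneous_induct)
      case s: (homogeneous n b p b')
      show ?case
      proof (induction s' rule: tensor_homogeneous_induct)
        case s': (homogeneous q e r e')
        show ?case
          by (simp add: braid_mult_homogeneous[OF s s'] braid_mult_linear braid_mult_tensor_right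
              braid_mult_homogeneous[OF homogeneous_mult[OF a s(1)] s(2) s'] twist_mult_homogeneous[OF a s(1)]
              twist_mult_homogeneous[OF a homogeneous_mult[OF s(1) s'(1)]] tensor_scale_left scaleC_scaleC
              weyl_add_left weyl_add_right ac_simps)
      qed (simp only: braid_mult_linear)
    qed (simp only: braid_mult_linear)
  qed (simp only: braid_mult_linear tensor_add_left)
qed

subsection \<open>Homogeneous tensors\<close>

lemma cbilinear_comodule_tensor:
  fixes G :: "'a::complex_space \<Rightarrow> 'b::complex_space \<Rightarrow> 'c::complex_space"
  assumes G: "cbilinear G"
  defines "B \<equiv> \<lambda>u v. tensor_lift (\<lambda>k x. tensor_lift (\<lambda>k' x'. (k * k') \<otimes> G x x') v) u"
  shows "cbilinear (B :: (torus, 'a) tensor \<Rightarrow> (torus, 'b) tensor \<Rightarrow> _)"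
    and "B (k \<otimes> x) (k' \<otimes> x') = (k * k' :: torus) \<otimes> G x x'"
proof -
  note s = cbilinearD[OF G] cbilinearD[OF cbilinear_mult] tensor_add_left tensor_add_right
    tensor_scale_left tensor_scale_right
  have 1: "cbilinear (\<lambda>k' x'. (k * k') \<otimes> G x x')" for k :: torus and x
    by (rule cbilinearI) (simp_all only: s)
  have 2: "cbilinear (\<lambda>k x. (k * k') \<otimes> G x x')" for k' :: torus and x'
    by (rule cbilinearI) (simp_all only: s)
  have 3: "cbilinear (\<lambda>k x. tensor_lift (\<lambda>k' x'. (k * k') \<otimes> G x x') v)" for v :: "(torus, 'b) tensor"
    by (rule cbilinear_tensor_lift) (rule 1 2)+
  show "cbilinear (B :: (torus, 'a) tensor \<Rightarrow> (torus, 'b) tensor \<Rightarrow> _)"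
    unfolding B_def by (rule tensor_lift_cong_linear) (rule 1 3)+
  show "B (k \<otimes> x) (k' \<otimes> x') = (k * k' :: torus) \<otimes> G x x'"
    unfolding B_def by (simp only: tensor_lift_tensor[OF 3] tensor_lift_tensor[OF 2] tensor_lift_tensor[OF 1])
qed

lemma clinear_rho2: "clinear rho2"
  and rho2_homogeneous: "homogeneous m a \<Longrightarrow> homogeneous n b \<Longrightarrow> rho2 (a \<otimes> b) = tm (m + n) \<otimes> (a \<otimes> b)"
proof -
  note c = cbilinear_comodule_tensor[OF cbilinear_tensor]
  have b: "cbilinear (\<lambda>a a'. tensor_lift (\<lambda>k x. tensor_lift (\<lambda>k' x'. (k * k') \<otimes> (x \<otimes> x')) (rho a')) (rho a))"
    by (rule cbilinearI) (simp_all only: cbilinearD[OF c(1)] clinear_add[OF clinear_rho] clinear_scale[OF clinear_rho])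
  show "clinear rho2" unfolding rho2_def by (rule clinear_tensor_lift[OF b])
  show "rho2 (a \<otimes> b) = tm (m + n) \<otimes> (a \<otimes> b)" if "homogeneous m a" "homogeneous n b"
  proof -
    have "rho a = tm m \<otimes> a" "rho b = tm n \<otimes> b" using that by (simp_all add: homogeneous_def)
    then show ?thesis
      unfolding rho2_def tensor_lift_tensor[OF b] by (simp only: c(2) tm_add)
  qed
qed

lemma rho2_mult: "rho2 (s * s') = rho2 s * rho2 s'"
proof (induction s rule: tensor_homogeneous_induct)
  case s: (homogeneous m a n b)
  show ?case
  proof (induction s' rule: tensor_homogeneous_induct)
    case s': (homogeneous p c q e)
    show ?case
      using rho2_homogeneous[OF homogeneous_mult[OF s(1) s'(1)] homogeneous_mult[OF s(2) s'(2)]]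
      by (simp add: rho2_homogeneous[OF s] rho2_homogeneous[OF s'] times_tensor_tensor ac_simps flip: tm_add)
  qed (simp only: distrib_left clinear_add[OF clinear_rho2])
qed (simp only: distrib_right clinear_add[OF clinear_rho2])

definition homogeneous2 :: "int \<times> int \<Rightarrow> (sphere, sphere) tensor \<Rightarrow> bool"
  where "homogeneous2 m s \<longleftrightarrow> rho2 s = tm m \<otimes> s"

lemma homogeneous2_zero: "homogeneous2 m 0"
  by (simp add: homogeneous2_def clinear_0[OF clinear_rho2] tensor_zero_right)

lemma homogeneous2_add: "homogeneous2 m s \<Longrightarrow> homogeneous2 m s' \<Longrightarrow> homogeneous2 m (s + s')"
  by (simp add: homogeneous2_def clinear_add[OF clinear_rho2] tensor_add_right)

lemma cbilinear_component: "cbilinear (\<lambda>(k :: torus) x. Poly_Mapping.lookup k m *\<^sub>C x)"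
  by (rule cbilinearI) (simp_all add: lookup_add lookup_scaleC scaleC_complex_def scaleC_add_left
      scaleC_add_right scaleC_scaleC mult.commute)

definition component :: "int \<times> int \<Rightarrow> sphere \<Rightarrow> sphere"
  where "component m a = tensor_lift (\<lambda>k x. Poly_Mapping.lookup k m *\<^sub>C x) (rho a)"

definition component2 :: "int \<times> int \<Rightarrow> (sphere, sphere) tensor \<Rightarrow> (sphere, sphere) tensor"
  where "component2 m s = tensor_lift (\<lambda>k x. Poly_Mapping.lookup k m *\<^sub>C x) (rho2 s)"

lemma component_add: "component m (a + b) = component m a + component m b"
  by (simp add: component_def clinear_add[OF clinear_rho] clinear_add[OF clinear_tensor_lift[OF cbilinear_component]])

lemma component_zero: "component m 0 = 0"
  by (simp add: component_def clinear_0[OF clinear_rho] clinear_0[OF clinear_tensor_lift[OF cbilinear_component]])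

lemma component2_add: "component2 m (a + b) = component2 m a + component2 m b"
  by (simp add: component2_def clinear_add[OF clinear_rho2] clinear_add[OF clinear_tensor_lift[OF cbilinear_component]])

lemma component_homogeneous: "homogeneous n a \<Longrightarrow> component m a = (if m = n then a else 0)"
  by (simp add: component_def homogeneous_def tensor_lift_tensor[OF cbilinear_component] tm_def lookup_single when_def)

lemma component2_homogeneous2: "homogeneous2 n s \<Longrightarrow> component2 m s = (if m = n then s else 0)"
  by (simp add: component2_def homogeneous2_def tensor_lift_tensor[OF cbilinear_component] tm_def lookup_single when_def)

lemma homogeneous2_tensor: "homogeneous m a \<Longrightarrow> homogeneous n b \<Longrightarrow> homogeneous2 (m + n) (a \<otimes> b)"
  by (simp add: homogeneous2_def rho2_homogeneous)

lemma homogeneous_component: "homogeneous m (component m a)"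
proof (induction a rule: homogeneous_induct)
  case (homogeneous n a)
  then show ?case by (simp add: component_homogeneous[OF homogeneous] homogeneous_zero)
qed (simp add: component_add homogeneous_add)

lemma homogeneous2_component2: "homogeneous2 m (component2 m s)"
proof (induction s rule: tensor_homogeneous_induct)
  case (homogeneous n a p b)
  show ?case
    using homogeneous2_tensor[OF homogeneous]
    by (simp add: component2_homogeneous2[OF homogeneous2_tensor[OF homogeneous]] homogeneous2_zero)
qed (simp add: component2_add homogeneous2_add)

lemma tensor_lift_component2:
  "tensor_lift (*) (component2 m s) = component m (tensor_lift (*) s)"
proof (induction s rule: tensor_homogeneous_induct)
  case (homogeneous n a p b)
  show ?case
    by (simp add: component2_homogeneous2[OF homogeneous2_tensor[OF homogeneous]]
        tensor_lift_tensor[OF cbilinear_mult] component_homogeneous[OF homogeneous_mult[OF homogeneous]]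
        clinear_0[OF clinear_tensor_lift[OF cbilinear_mult]])
qed (simp add: component2_add component_add clinear_add[OF clinear_tensor_lift[OF cbilinear_mult]])

lemma sum_component: "\<exists>F. finite F \<and> a = (\<Sum>m\<in>F. component m a)"
proof -
  have "\<exists>F. finite F \<and> (\<forall>G. finite G \<longrightarrow> F \<subseteq> G \<longrightarrow> a = (\<Sum>m\<in>G. component m a))"
  proof (induction a rule: homogeneous_induct)
    case (homogeneous n a)
    show ?case by (rule exI[of _ "{n}"]) (auto simp: component_homogeneous[OF homogeneous] sum.delta)
  next
    case (add a b)
    then obtain F F' where "finite F" "finite F'"
      "\<And>G. finite G \<Longrightarrow> F \<subseteq> G \<Longrightarrow> a = (\<Sum>m\<in>G. component m a)"
      "\<And>G. finite G \<Longrightarrow> F' \<subseteq> G \<Longrightarrow> b = (\<Sum>m\<in>G. component m b)" by blast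
    then show ?case
      by (intro exI[of _ "F \<union> F'"]) (simp add: component_add sum.distrib)
  qed
  then show ?thesis by blast
qed

lemma sum_component2: "\<exists>F. finite F \<and> s = (\<Sum>m\<in>F. component2 m s)"
proof -
  have "\<exists>F. finite F \<and> (\<forall>G. finite G \<longrightarrow> F \<subseteq> G \<longrightarrow> s = (\<Sum>m\<in>G. component2 m s))"
  proof (induction s rule: tensor_homogeneous_induct)
    case (homogeneous n a p b)
    show ?case
      by (rule exI[of _ "{n + p}"])
        (auto simp: component2_homogeneous2[OF homogeneous2_tensor[OF homogeneous]] sum.delta)
  next
    case (add s s')
    then obtain F F' where "finite F" "finite F'"
      "\<And>G. finite G \<Longrightarrow> F \<subseteq> G \<Longrightarrow> s = (\<Sum>m\<in>G. component2 m s)"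
      "\<And>G. finite G \<Longrightarrow> F' \<subseteq> G \<Longrightarrow> s' = (\<Sum>m\<in>G. component2 m s')" by blast
    then show ?case
      by (intro exI[of _ "F \<union> F'"]) (simp add: component2_add sum.distrib)
  qed
  then show ?thesis by blast
qed

abbreviation mult_kerA :: "(sphere, sphere) tensor set" where "mult_kerA \<equiv> mult_ker (*)"
abbreviation mult_ker_sqA :: "(sphere, sphere) tensor set" where "mult_ker_sqA \<equiv> mult_ker_sq (*) (*)"

lemma component2_mult_ker: "s \<in> mult_kerA \<Longrightarrow> component2 m s \<in> mult_kerA"
  by (simp add: mult_ker_def tensor_lift_component2 component_zero)

lemma rho2_mult_ker_sq:
  assumes "s \<in> mult_ker_sqA"
  shows "rho2 s \<in> cspan {k \<otimes> n |k n. n \<in> mult_ker_sqA}"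
proof -
  have *: "rho2 (s * s') \<in> cspan {k \<otimes> n |k n. n \<in> mult_ker_sqA}"
    if ss: "s \<in> mult_kerA" "s' \<in> mult_kerA" for s s'
  proof -
    obtain F F' where F: "finite F" "s = (\<Sum>m\<in>F. component2 m s)" "finite F'" "s' = (\<Sum>m\<in>F'. component2 m s')"
      using sum_component2 by metis
    have r: "rho2 (component2 m s * component2 n s') = (tm m * tm n) \<otimes> (component2 m s * component2 n s')" for m n
      using homogeneous2_component2[of m s] homogeneous2_component2[of n s']
      by (simp add: rho2_mult homogeneous2_def times_tensor_tensor)
    have k: "component2 m s * component2 n s' \<in> mult_ker_sqA" for m n
      unfolding mult_ker_sq_def using component2_mult_ker[OF ss(1)] component2_mult_ker[OF ss(2)]
      by (intro cvs.span_base) blast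
    have "rho2 (component2 m s * component2 n s') \<in> cspan {k \<otimes> n |k n. n \<in> mult_ker_sqA}" for m n
      unfolding r using k by (intro cvs.span_base) blast
    then have "(\<Sum>m\<in>F. \<Sum>n\<in>F'. rho2 (component2 m s * component2 n s')) \<in> cspan {k \<otimes> n |k n. n \<in> mult_ker_sqA}"
      by (intro cvs.span_sum)
    also have "(\<Sum>m\<in>F. \<Sum>n\<in>F'. rho2 (component2 m s * component2 n s')) =
        rho2 ((\<Sum>m\<in>F. component2 m s) * (\<Sum>n\<in>F'. component2 n s'))"
      by (simp only: cbilinear_sum[OF cbilinear_mult] clinear_sum[OF clinear_rho2])
    also have "\<dots> = rho2 (s * s')" by (simp only: F(2)[symmetric] F(4)[symmetric])
    finally show ?thesis .
  qed
  have "s \<in> cspan {s * s' |s s'. s \<in> mult_kerA \<and> s' \<in> mult_kerA}"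
    using assms by (simp add: mult_ker_sq_def)
  then show ?thesis
  proof (induction rule: cvs.span_induct_alt[consumes 1])
    case base show ?case by (simp add: clinear_0[OF clinear_rho2] cvs.span_zero)
  next
    case (step c x y)
    then have "rho2 x \<in> cspan {k \<otimes> n |k n. n \<in> mult_ker_sqA}" using * by blast
    with step(2) show ?case
      by (simp add: clinear_add[OF clinear_rho2] clinear_scale[OF clinear_rho2] cvs.span_add cvs.span_scale)
  qed
qed

subsection \<open>The twist of tensors\<close>

definition tensor_twist :: "real \<Rightarrow> (sphere, sphere) tensor \<Rightarrow> (sphere, sphere) tensor"
  where "tensor_twist \<theta> = tensor_lift (\<lambda>a a'.
    tensor_lift (\<lambda>k x. tensor_lift (\<lambda>k' x'. sigma \<theta> k k' *\<^sub>C (x \<otimes> x')) (rho a')) (rho a))"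

lemma clinear_tensor_twist: "clinear (tensor_twist \<theta>)"
  and tensor_twist_homogeneous:
    "homogeneous m a \<Longrightarrow> homogeneous n b \<Longrightarrow> tensor_twist \<theta> (a \<otimes> b) = weyl \<theta> m n *\<^sub>C (a \<otimes> b)"
proof -
  note c = cbilinear_pairing[OF cbilinear_sigma[of \<theta>] cbilinear_tensor]
  have b: "cbilinear (\<lambda>a a'. tensor_lift (\<lambda>k x. tensor_lift (\<lambda>k' x'. sigma \<theta> k k' *\<^sub>C (x \<otimes> x')) (rho a')) (rho a))"
    by (rule cbilinearI) (simp_all only: cbilinearD[OF c(1)] clinear_add[OF clinear_rho] clinear_scale[OF clinear_rho])
  show "clinear (tensor_twist \<theta>)" unfolding tensor_twist_def by (rule clinear_tensor_lift[OF b])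
  show "tensor_twist \<theta> (a \<otimes> b) = weyl \<theta> m n *\<^sub>C (a \<otimes> b)" if "homogeneous m a" "homogeneous n b"
  proof -
    have "rho a = tm m \<otimes> a" "rho b = tm n \<otimes> b" using that by (simp_all add: homogeneous_def)
    then show ?thesis
      unfolding tensor_twist_def tensor_lift_tensor[OF b] by (simp only: c(2) sigma_tm)
  qed
qed

lemma tensor_lift_tensor_twist: "tensor_lift (*) (tensor_twist \<theta> s) = tensor_lift (twist_mult \<theta>) s"
proof (induction s rule: tensor_homogeneous_induct)
  case (homogeneous m a n b)
  show ?case
    by (simp add: tensor_twist_homogeneous[OF homogeneous] twist_mult_homogeneous[OF homogeneous]
        tensor_lift_tensor[OF cbilinear_mult] tensor_lift_tensor[OF cbilinear_twist_mult]
        clinear_scale[OF clinear_tensor_lift[OF cbilinear_mult]])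
qed (simp add: clinear_add[OF clinear_tensor_twist] clinear_add[OF clinear_tensor_lift[OF cbilinear_mult]]
    clinear_add[OF clinear_tensor_lift[OF cbilinear_twist_mult]])

lemma tensor_twist_mult_ker: "s \<in> mult_ker (twist_mult \<theta>) \<Longrightarrow> tensor_twist \<theta> s \<in> mult_kerA"
  by (simp add: mult_ker_def tensor_lift_tensor_twist)

definition twist_mult2 :: "real \<Rightarrow> (sphere, sphere) tensor \<Rightarrow> (sphere, sphere) tensor \<Rightarrow> (sphere, sphere) tensor"
  where "twist_mult2 \<theta> s s' =
    tensor_lift (\<lambda>k x. tensor_lift (\<lambda>k' x'. sigma \<theta> k k' *\<^sub>C (x * x')) (rho2 s')) (rho2 s)"

lemma cbilinear_twist_mult2: "cbilinear (twist_mult2 \<theta>)"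
  and twist_mult2_homogeneous:
    "homogeneous2 m s \<Longrightarrow> homogeneous2 n s' \<Longrightarrow> twist_mult2 \<theta> s s' = weyl \<theta> m n *\<^sub>C (s * s')"
proof -
  note c = cbilinear_pairing[OF cbilinear_sigma cbilinear_mult, of \<theta>]
  show "cbilinear (twist_mult2 \<theta>)"
    by (rule cbilinearI) (simp_all add: twist_mult2_def clinear_add[OF clinear_rho2]
        clinear_scale[OF clinear_rho2] cbilinearD[OF c(1)])
  show "twist_mult2 \<theta> s s' = weyl \<theta> m n *\<^sub>C (s * s')" if "homogeneous2 m s" "homogeneous2 n s'"
    using that by (simp add: twist_mult2_def homogeneous2_def c(2) sigma_tm)
qed

lemma tensor_twist_braid_mult:
  "tensor_twist \<theta> (braid_mult \<theta> s s') = twist_mult2 \<theta> (tensor_twist \<theta> s) (tensor_twist \<theta> s')"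
proof (induction s rule: tensor_homogeneous_induct)
  case s: (homogeneous m a n b)
  show ?case
  proof (induction s' rule: tensor_homogeneous_induct)
    case s': (homogeneous p c q e)
    have w: "weyl \<theta> n p * (weyl \<theta> p n * x) = x" for x
      using weyl_swap[of \<theta> n p] by (simp flip: mult.assoc)
    show ?case
      by (simp add: braid_mult_homogeneous[OF s s'] clinear_scale[OF clinear_tensor_twist]
          tensor_twist_homogeneous[OF s] tensor_twist_homogeneous[OF s'] cbilinearD[OF cbilinear_twist_mult2]
          tensor_twist_homogeneous[OF homogeneous_mult[OF s(1) s'(1)] homogeneous_mult[OF s(2) s'(2)]]
          twist_mult2_homogeneous[OF homogeneous2_tensor[OF s] homogeneous2_tensor[OF s']]
          scaleC_scaleC times_tensor_tensor weyl_add_left weyl_add_right)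
        (simp add: ac_simps w weyl_swap)
  qed (simp only: braid_mult_linear clinear_add[OF clinear_tensor_twist] cbilinearD[OF cbilinear_twist_mult2])
qed (simp only: braid_mult_linear clinear_add[OF clinear_tensor_twist] cbilinearD[OF cbilinear_twist_mult2])

lemma twist_mult2_mult_ker_sq:
  assumes "s \<in> mult_kerA" "s' \<in> mult_kerA"
  shows "twist_mult2 \<theta> s s' \<in> mult_ker_sqA"
proof -
  obtain F F' where F: "finite F" "s = (\<Sum>m\<in>F. component2 m s)" "finite F'" "s' = (\<Sum>m\<in>F'. component2 m s')"
    using sum_component2 by metis
  have "twist_mult2 \<theta> (component2 m s) (component2 n s') \<in> mult_ker_sqA" for m n
    unfolding twist_mult2_homogeneous[OF homogeneous2_component2 homogeneous2_component2] mult_ker_sq_def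
    using component2_mult_ker[OF assms(1)] component2_mult_ker[OF assms(2)]
    by (intro cvs.span_scale cvs.span_base) blast
  then have "(\<Sum>m\<in>F. \<Sum>n\<in>F'. twist_mult2 \<theta> (component2 m s) (component2 n s')) \<in> mult_ker_sqA"
    unfolding mult_ker_sq_def by (intro cvs.span_sum)
  also have "(\<Sum>m\<in>F. \<Sum>n\<in>F'. twist_mult2 \<theta> (component2 m s) (component2 n s')) =
      twist_mult2 \<theta> (\<Sum>m\<in>F. component2 m s) (\<Sum>n\<in>F'. component2 n s')"
    by (simp only: cbilinear_sum[OF cbilinear_twist_mult2])
  also have "\<dots> = twist_mult2 \<theta> s s'" by (simp only: F(2)[symmetric] F(4)[symmetric])
  finally show ?thesis .
qed

lemma tensor_twist_mult_ker_sq: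
  assumes "s \<in> mult_ker_sq (twist_mult \<theta>) (braid_mult \<theta>)"
  shows "tensor_twist \<theta> s \<in> mult_ker_sqA"
  using assms unfolding mult_ker_sq_def[of "twist_mult \<theta>"]
proof (induction rule: cvs.span_induct_alt[consumes 1])
  case base show ?case by (simp add: clinear_0[OF clinear_tensor_twist] mult_ker_sq_def cvs.span_zero)
next
  case (step c x y)
  then have "tensor_twist \<theta> x \<in> mult_ker_sqA"
    using twist_mult2_mult_ker_sq tensor_twist_mult_ker by (auto simp: tensor_twist_braid_mult)
  with step(2) show ?case
    unfolding mult_ker_sq_def
    by (simp add: clinear_add[OF clinear_tensor_twist] clinear_scale[OF clinear_tensor_twist] cvs.span_add cvs.span_scale)
qed

subsection \<open>The maps on forms\<close>

definition act_lift :: "real \<Rightarrow> sphere \<Rightarrow> (torus, (sphere, sphere) tensor) tensor \<Rightarrow> (sphere, sphere) tensor"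
  where "act_lift \<theta> a w =
    tensor_lift (\<lambda>k x. tensor_lift (\<lambda>k' s. sigma \<theta> k k' *\<^sub>C ((x \<otimes> 1) * s)) w) (rho a)"

lemma cbilinear_act_lift: "cbilinear (act_lift \<theta>)"
  and act_lift_homogeneous: "homogeneous m a \<Longrightarrow> act_lift \<theta> a (tm n \<otimes> s) = weyl \<theta> m n *\<^sub>C ((a \<otimes> 1) * s)"
proof -
  have "cbilinear (\<lambda>(x :: sphere) (s :: (sphere, sphere) tensor). (x \<otimes> 1) * s)"
    by (rule cbilinearI) (simp_all add: distrib_left distrib_right scaleC_mult_left scaleC_mult_right
        tensor_add_left tensor_scale_left)
  note c = cbilinear_pairing[OF cbilinear_sigma this, of \<theta>]
  show "cbilinear (act_lift \<theta>)"
    by (rule cbilinearI) (simp_all add: act_lift_def clinear_add[OF clinear_rho]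
        clinear_scale[OF clinear_rho] cbilinearD[OF c(1)])
  show "act_lift \<theta> a (tm n \<otimes> s) = weyl \<theta> m n *\<^sub>C ((a \<otimes> 1) * s)" if "homogeneous m a"
    using that by (simp add: act_lift_def homogeneous_def c(2) sigma_tm)
qed

lemma act_lift_mult_ker_sq:
  assumes "w \<in> cspan {k \<otimes> n |k n. n \<in> mult_ker_sqA}"
  shows "act_lift \<theta> a w \<in> mult_ker_sqA"
  using assms
proof (induction rule: cvs.span_induct_alt[consumes 1])
  case base show ?case by (simp add: cbilinearD[OF cbilinear_act_lift] mult_ker_sq_def cvs.span_zero)
next
  case (step c w v)
  then obtain k n where w: "w = k \<otimes> n" "n \<in> mult_ker_sqA" by blast
  have "(x \<otimes> 1) * n \<in> mult_ker_sqA" for x by (rule comm.mult_ker_sq_left[OF w(2)])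
  moreover have b: "cbilinear (\<lambda>k' s. sigma \<theta> l k' *\<^sub>C ((x \<otimes> 1) * s))" for l and x :: sphere
    by (rule cbilinearI) (simp_all add: cbilinearD[OF cbilinear_sigma] scaleC_add_left scaleC_add_right
        distrib_left scaleC_mult_right scaleC_scaleC scaleC_complex_def mult.commute[of c])
  ultimately have "tensor_lift (\<lambda>k' s. sigma \<theta> l k' *\<^sub>C ((x \<otimes> 1) * s)) w \<in> mult_ker_sqA" for l x
    unfolding w(1) tensor_lift_tensor[OF b] mult_ker_sq_def by (intro cvs.span_scale)
  then have "act_lift \<theta> a w \<in> mult_ker_sqA"
    unfolding act_lift_def mult_ker_sq_def by (rule tensor_lift_in_span)
  with step(2) show ?case
    unfolding mult_ker_sq_def
    by (simp add: cbilinearD[OF cbilinear_act_lift] cvs.span_add cvs.span_scale)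
qed

lemma twist_act_class:
  "twist_act \<theta> a (form_class (*) (*) s) = form_class (*) (*) (act_lift \<theta> a (rho2 s))"
proof -
  let ?KN = "cspan {k \<otimes> n |k n. n \<in> mult_ker_sqA}"
  have *: "form_class (*) (*) (act_lift \<theta> a w) = form_class (*) (*) (act_lift \<theta> a (rho2 s))"
    if "s' \<in> form_class (*) (*) s" "w \<in> rho2 s' +o ?KN" for s' w
  proof -
    have "rho2 (s' - s) \<in> ?KN" by (rule rho2_mult_ker_sq) (use that(1) comm.in_form_class_iff in blast)
    moreover have "w - rho2 s' \<in> ?KN" using that(2) by (rule set_plus_imp_minus)
    ultimately have "w - rho2 s' + rho2 (s' - s) \<in> ?KN" by (rule cvs.span_add[rotated])
    then have "w - rho2 s \<in> ?KN" by (simp add: clinear_diff[OF clinear_rho2])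
    from act_lift_mult_ker_sq[OF this] show ?thesis
      by (simp add: comm.form_class_eq_iff cbilinearD[OF cbilinear_act_lift])
  qed
  have "rho2 s \<in> rho2 s +o ?KN" using set_plus_intro2[OF cvs.span_zero, of "rho2 s"] by simp
  with comm.form_class_self[of s] have "rho2 s \<in> (\<Union>s'\<in>form_class (*) (*) s. rho2 s' +o ?KN)" by blast
  with * show ?thesis unfolding twist_act_def Let_def act_lift_def[symmetric] by blast
qed

lemma tensor_twist_form:
  "tensor_twist \<theta> (a \<otimes> b - twist_mult \<theta> a b \<otimes> 1) = act_lift \<theta> a (rho2 (1 \<otimes> b - b \<otimes> 1))"
proof (induction a rule: homogeneous_induct)
  case a: (homogeneous m a)
  show ?case
  proof (induction b rule: homogeneous_induct)
    case b: (homogeneous n b)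
    have "rho2 (1 \<otimes> b) = tm n \<otimes> (1 \<otimes> b)" "rho2 (b \<otimes> 1) = tm n \<otimes> (b \<otimes> 1)"
      using rho2_homogeneous[OF homogeneous_one b] rho2_homogeneous[OF b homogeneous_one] by simp_all
    then show ?case
      by (simp add: clinear_diff[OF clinear_rho2] clinear_diff[OF clinear_tensor_twist]
          cbilinearD[OF cbilinear_act_lift] act_lift_homogeneous[OF a] tensor_twist_homogeneous[OF a b]
          twist_mult_homogeneous[OF a b] tensor_scale_left clinear_scale[OF clinear_tensor_twist]
          tensor_twist_homogeneous[OF homogeneous_mult[OF a b] homogeneous_one] times_tensor_tensor)
  next
    case (add b c)
    then show ?case
      by (simp add: tensor_add_left tensor_add_right clinear_diff[OF clinear_rho2] clinear_diff[OF clinear_tensor_twist]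
          clinear_add[OF clinear_rho2] clinear_add[OF clinear_tensor_twist] twist_mult_linear
          cbilinearD[OF cbilinear_act_lift] add_diff_add)
  qed
next
  case (add a c)
  then show ?case
    by (simp add: tensor_add_left clinear_diff[OF clinear_tensor_twist] clinear_add[OF clinear_tensor_twist]
        twist_mult_linear cbilinearD[OF cbilinear_act_lift] add_diff_add)
qed

theorem phi_bar_is_form_map:
  "is_form_map (twist_mult \<theta>) (braid_mult \<theta>) (\<lambda>a a'. twist_act \<theta> a (dA a')) (phi_bar \<theta>)"
  and phi_bar_class: "s \<in> mult_ker (twist_mult \<theta>) \<Longrightarrow>
    phi_bar \<theta> (form_class (twist_mult \<theta>) (braid_mult \<theta>) s) = form_class (*) (*) (tensor_twist \<theta> s)"
proof -
  note e = theta.form_map_exists[where F = "\<lambda>s. form_class (*) (*) (tensor_twist \<theta> s)" and \<theta> = \<theta>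
      and g = "\<lambda>a a'. twist_act \<theta> a (dA a')"]
  have 1: "form_class (*) (*) (tensor_twist \<theta> (s + s')) =
      form_class (*) (*) (tensor_twist \<theta> s) + form_class (*) (*) (tensor_twist \<theta> s')" for s s'
    by (simp add: comm.form_class_add clinear_add[OF clinear_tensor_twist])
  have 2: "form_class (*) (*) (tensor_twist \<theta> s) = form_class (*) (*) (tensor_twist \<theta> s')"
    if "s - s' \<in> mult_ker_sq (twist_mult \<theta>) (braid_mult \<theta>)" for s s'
    using tensor_twist_mult_ker_sq[OF that] by (simp add: comm.form_class_eq_iff clinear_diff[OF clinear_tensor_twist])
  have 3: "form_class (*) (*) (tensor_twist \<theta> (a \<otimes> b - twist_mult \<theta> a b \<otimes> 1)) = twist_act \<theta> a (dA b)" for a b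
    by (simp add: form_d_def twist_act_class tensor_twist_form)
  show "is_form_map (twist_mult \<theta>) (braid_mult \<theta>) (\<lambda>a a'. twist_act \<theta> a (dA a')) (phi_bar \<theta>)"
    unfolding phi_bar_def using e(1)[OF 1 2 3] .
  show "phi_bar \<theta> (form_class (twist_mult \<theta>) (braid_mult \<theta>) s) = form_class (*) (*) (tensor_twist \<theta> s)"
    if "s \<in> mult_ker (twist_mult \<theta>)"
    unfolding phi_bar_def using e(2)[OF 1 2 3 that] .
qed

definition ver_lift :: "(sphere, sphere) tensor \<Rightarrow> sphere"
  where "ver_lift = tensor_lift (\<lambda>a a'. a * X_act a')"

lemma X_act_mult: "X_act (a * b) = X_act a * b + a * X_act b"
proof (induction a rule: homogeneous_induct)
  case a: (homogeneous m a)
  show ?case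
  proof (induction b rule: homogeneous_induct)
    case b: (homogeneous n b)
    show ?case
      by (simp add: X_act_homogeneous[OF a] X_act_homogeneous[OF b] X_act_homogeneous[OF homogeneous_mult[OF a b]]
          scaleC_mult_left scaleC_mult_right flip: scaleC_add_left)
  qed (simp add: distrib_left clinear_add[OF clinear_X_act])
qed (simp add: distrib_right clinear_add[OF clinear_X_act])

lemma X_act_one: "X_act 1 = 0"
  using X_act_homogeneous[OF homogeneous_one] by simp

lemma cbilinear_ver: "cbilinear (\<lambda>a a'. a * X_act a')"
  by (rule cbilinearI) (simp_all add: distrib_left distrib_right clinear_add[OF clinear_X_act]
      clinear_scale[OF clinear_X_act] scaleC_mult_left scaleC_mult_right)

lemma clinear_ver_lift: "clinear ver_lift"
  unfolding ver_lift_def by (rule clinear_tensor_lift[OF cbilinear_ver])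

lemma ver_lift_mult: "ver_lift (s * s') = ver_lift s * tensor_lift (*) s' + tensor_lift (*) s * ver_lift s'"
proof (induction s rule: tensor_induct)
  case s: (tensor a b)
  show ?case
  proof (induction s' rule: tensor_induct)
    case (tensor c e)
    show ?case
      by (simp add: ver_lift_def times_tensor_tensor tensor_lift_tensor[OF cbilinear_ver]
          tensor_lift_tensor[OF cbilinear_mult] X_act_mult) (simp add: algebra_simps)
  qed (simp add: distrib_left clinear_add[OF clinear_ver_lift] clinear_add[OF clinear_tensor_lift[OF cbilinear_mult]] algebra_simps)
qed (simp add: distrib_right clinear_add[OF clinear_ver_lift] clinear_add[OF clinear_tensor_lift[OF cbilinear_mult]] algebra_simps)

lemma ver_lift_mult_ker_sq: "s \<in> mult_ker_sqA \<Longrightarrow> ver_lift s = 0"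
  unfolding mult_ker_sq_def
  by (rule cspan_eq_zero[OF _ clinear_ver_lift]) (auto simp: ver_lift_mult mult_ker_def)

theorem ver_is_form_map: "is_form_map (*) (*) (\<lambda>a a'. a * X_act a') ver"
  and ver_class: "s \<in> mult_kerA \<Longrightarrow> ver (form_class (*) (*) s) = ver_lift s"
proof -
  note e = comm.form_map_exists[where F = ver_lift and g = "\<lambda>a a'. a * X_act a'"]
  have 2: "ver_lift s = ver_lift s'" if "s - s' \<in> mult_ker_sqA" for s s'
    using ver_lift_mult_ker_sq[OF that] by (simp add: clinear_diff[OF clinear_ver_lift])
  have 3: "ver_lift (a \<otimes> b - (a * b) \<otimes> 1) = a * X_act b" for a b
    by (simp add: clinear_diff[OF clinear_ver_lift]) (simp add: ver_lift_def tensor_lift_tensor[OF cbilinear_ver] X_act_one)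
  show "is_form_map (*) (*) (\<lambda>a a'. a * X_act a') ver"
    unfolding ver_def using e(1)[OF clinear_add[OF clinear_ver_lift] 2 3] .
  show "ver (form_class (*) (*) s) = ver_lift s" if "s \<in> mult_kerA"
    unfolding ver_def using e(2)[OF clinear_add[OF clinear_ver_lift] 2 3 that] .
qed

lemma ver_lift_tensor_twist: "ver_lift (tensor_twist \<theta> (a \<otimes> b)) = twist_mult \<theta> a (X_act b)"
proof (induction a rule: homogeneous_induct)
  case a: (homogeneous m a)
  show ?case
  proof (induction b rule: homogeneous_induct)
    case b: (homogeneous n b)
    show ?case
      by (simp add: tensor_twist_homogeneous[OF a b] clinear_scale[OF clinear_ver_lift] X_act_homogeneous[OF b]
          twist_mult_linear twist_mult_homogeneous[OF a b])
        (simp add: ver_lift_def tensor_lift_tensor[OF cbilinear_ver] X_act_homogeneous[OF b] scaleC_mult_right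
          scaleC_scaleC mult.commute)
  qed (simp add: tensor_add_right clinear_add[OF clinear_tensor_twist] clinear_add[OF clinear_ver_lift]
      clinear_add[OF clinear_X_act] twist_mult_linear)
qed (simp add: tensor_add_left clinear_add[OF clinear_tensor_twist] clinear_add[OF clinear_ver_lift] twist_mult_linear)

theorem ver_theta_is_form_map:
  "is_form_map (twist_mult \<theta>) (braid_mult \<theta>) (\<lambda>a a'. twist_mult \<theta> a (X_act a')) (ver_theta \<theta>)"
  and ver_theta_class: "s \<in> mult_ker (twist_mult \<theta>) \<Longrightarrow>
    ver_theta \<theta> (form_class (twist_mult \<theta>) (braid_mult \<theta>) s) = ver_lift (tensor_twist \<theta> s)"
proof -
  note e = theta.form_map_exists[where F = "\<lambda>s. ver_lift (tensor_twist \<theta> s)" and \<theta> = \<theta>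
      and g = "\<lambda>a a'. twist_mult \<theta> a (X_act a')"]
  have 1: "ver_lift (tensor_twist \<theta> (s + s')) = ver_lift (tensor_twist \<theta> s) + ver_lift (tensor_twist \<theta> s')" for s s'
    by (simp add: clinear_add[OF clinear_ver_lift] clinear_add[OF clinear_tensor_twist])
  have 2: "ver_lift (tensor_twist \<theta> s) = ver_lift (tensor_twist \<theta> s')"
    if "s - s' \<in> mult_ker_sq (twist_mult \<theta>) (braid_mult \<theta>)" for s s'
    using ver_lift_mult_ker_sq[OF tensor_twist_mult_ker_sq[OF that]]
    by (simp add: clinear_diff[OF clinear_ver_lift] clinear_diff[OF clinear_tensor_twist])
  have 3: "ver_lift (tensor_twist \<theta> (a \<otimes> b - twist_mult \<theta> a b \<otimes> 1)) = twist_mult \<theta> a (X_act b)" for a b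
    by (simp add: clinear_diff[OF clinear_ver_lift] clinear_diff[OF clinear_tensor_twist] ver_lift_tensor_twist
        X_act_one twist_mult_linear)
  show "is_form_map (twist_mult \<theta>) (braid_mult \<theta>) (\<lambda>a a'. twist_mult \<theta> a (X_act a')) (ver_theta \<theta>)"
    unfolding ver_theta_def using e(1)[OF 1 2 3] .
  show "ver_theta \<theta> (form_class (twist_mult \<theta>) (braid_mult \<theta>) s) = ver_lift (tensor_twist \<theta> s)"
    if "s \<in> mult_ker (twist_mult \<theta>)"
    unfolding ver_theta_def using e(2)[OF 1 2 3 that] .
qed

subsection \<open>The base\<close>

definition base_tensor :: "(base, base) tensor \<Rightarrow> (sphere, sphere) tensor"
  where "base_tensor = tensor_lift (\<lambda>b b'. Rep_base b \<otimes> Rep_base b')"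

lemma cbilinear_base_tensor: "cbilinear (\<lambda>b b'. Rep_base b \<otimes> Rep_base b')"
  by (rule cbilinearI) (simp_all add: plus_base.rep_eq scaleC_base.rep_eq tensor_add_left tensor_add_right
      tensor_scale_left tensor_scale_right)

lemma clinear_base_tensor: "clinear base_tensor"
  unfolding base_tensor_def by (rule clinear_tensor_lift[OF cbilinear_base_tensor])

lemma base_tensor_tensor: "base_tensor (b \<otimes> b') = Rep_base b \<otimes> Rep_base b'"
  unfolding base_tensor_def by (rule tensor_lift_tensor[OF cbilinear_base_tensor])

lemma base_homogeneous_induct [case_names homogeneous add]:
  assumes "\<And>k a. homogeneous (k, - k) a \<Longrightarrow> P a" "\<And>a b. P a \<Longrightarrow> P b \<Longrightarrow> P (a + b)"
  shows "P (Rep_base b)"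
proof -
  let ?a = "Rep_base b"
  have c: "component m (X_act a) = X_act (component m a)" for m a
  proof (induction a rule: homogeneous_induct)
    case (homogeneous n a)
    show ?case
      by (simp add: X_act_homogeneous[OF homogeneous] component_homogeneous[OF homogeneous]
          component_homogeneous[OF homogeneous_scale[OF homogeneous]] clinear_0[OF clinear_X_act])
  qed (simp add: component_add clinear_add[OF clinear_X_act])
  have b: "cbilinear (\<lambda>x h. X h *\<^sub>C (x :: sphere))"
    by (rule cbilinearI) (simp_all add: scaleC_add_left scaleC_add_right clinear_add[OF clinear_X]
        clinear_scale[OF clinear_X] scaleC_scaleC scaleC_complex_def mult.commute)
  have "X_act ?a = 0"
    using Rep_base[of b] X_power[of 0] by (simp add: X_act_def tensor_lift_tensor[OF b])
  then have "X_act (component m ?a) = 0" for m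
    using c[of m ?a] by (simp add: component_zero)
  then have 0: "component m ?a = 0" if "fst m + snd m \<noteq> 0" for m
    using that X_act_homogeneous[OF homogeneous_component[of m ?a]]
    by (simp add: cvs.scale_eq_0_iff flip: of_int_add)
  have P: "P (component m ?a)" for m
  proof (cases "fst m + snd m = 0")
    case True
    then have "m = (fst m, - fst m)" by (simp add: prod_eq_iff)
    then show ?thesis using assms(1) homogeneous_component[of m ?a] by metis
  next
    case False
    with 0 assms(1)[OF homogeneous_zero] show ?thesis by simp
  qed
  have "P (\<Sum>m\<in>F. component m ?a)" if "finite F" for F
    using that
  proof induction
    case empty show ?case using assms(1)[OF homogeneous_zero] by simp
  qed (simp add: assms(2) P)
  then show ?thesis using sum_component[of ?a] by metis
qed

lemma weyl_base: "weyl \<theta> (k, - k) (l, - l) = 1"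
  by (simp add: weyl_def)

lemma twist_mult_base: "twist_mult \<theta> (Rep_base b) (Rep_base b') = Rep_base b * Rep_base b'"
proof (induction b rule: base_homogeneous_induct)
  case a: (homogeneous k a)
  show ?case
  proof (induction b' rule: base_homogeneous_induct)
    case b: (homogeneous l b)
    show ?case by (simp add: twist_mult_homogeneous[OF a b] weyl_base)
  qed (simp only: twist_mult_linear distrib_left)
qed (simp only: twist_mult_linear distrib_right)

lemma braid_mult_base: "braid_mult \<theta> (base_tensor s) (base_tensor s') = base_tensor s * base_tensor s'"
proof (induction s rule: tensor_induct)
  case (tensor b c)
  show ?case
  proof (induction s' rule: tensor_induct)
    case (tensor b' c')
    show ?case
      unfolding base_tensor_tensor
    proof (induction b rule: base_homogeneous_induct)
      case a1: (homogeneous k1 a1)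
      show ?case
      proof (induction c rule: base_homogeneous_induct)
        case a2: (homogeneous k2 a2)
        show ?case
        proof (induction b' rule: base_homogeneous_induct)
          case a3: (homogeneous k3 a3)
          show ?case
          proof (induction c' rule: base_homogeneous_induct)
            case a4: (homogeneous k4 a4)
            show ?case by (simp add: braid_mult_homogeneous[OF a1 a2 a3 a4] weyl_base times_tensor_tensor)
          qed (simp only: tensor_add_left tensor_add_right braid_mult_linear distrib_left distrib_right)
        qed (simp only: tensor_add_left tensor_add_right braid_mult_linear distrib_left distrib_right)
      qed (simp only: tensor_add_left tensor_add_right braid_mult_linear distrib_left distrib_right)
    qed (simp only: tensor_add_left tensor_add_right braid_mult_linear distrib_left distrib_right)
  qed (simp only: clinear_add[OF clinear_base_tensor] braid_mult_linear distrib_left)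
qed (simp only: clinear_add[OF clinear_base_tensor] braid_mult_linear distrib_right)

lemma base_tensor_mult: "base_tensor (s * s') = base_tensor s * base_tensor s'"
proof (induction s rule: tensor_induct)
  case (tensor b c)
  show ?case
    by (induction s' rule: tensor_induct)
      (simp_all add: base_tensor_tensor times_tensor_tensor times_base.rep_eq distrib_left clinear_add[OF clinear_base_tensor])
qed (simp add: distrib_right clinear_add[OF clinear_base_tensor])

lemma tensor_lift_base_tensor:
  "tensor_lift (*) (base_tensor s) = Rep_base (tensor_lift (*) s)"
  "tensor_lift (twist_mult \<theta>) (base_tensor s) = Rep_base (tensor_lift (*) s)"
  by (induction s rule: tensor_induct;
      simp add: base_tensor_tensor tensor_lift_tensor[OF cbilinear_mult] tensor_lift_tensor[OF cbilinear_twist_mult]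
        twist_mult_base times_base.rep_eq plus_base.rep_eq clinear_add[OF clinear_base_tensor]
        clinear_add[OF clinear_tensor_lift[OF cbilinear_mult]]
        clinear_add[OF clinear_tensor_lift[OF cbilinear_twist_mult]])+

lemma base_tensor_mult_ker:
  "s \<in> mult_ker (*) \<Longrightarrow> base_tensor s \<in> mult_kerA"
  "s \<in> mult_ker (*) \<Longrightarrow> base_tensor s \<in> mult_ker (twist_mult \<theta>)"
  by (simp_all add: mult_ker_def tensor_lift_base_tensor zero_base.rep_eq)

lemma base_tensor_mult_ker_sq:
  assumes "s \<in> mult_ker_sq (*) (*)"
  shows "base_tensor s \<in> mult_ker_sqA" "base_tensor s \<in> mult_ker_sq (twist_mult \<theta>) (braid_mult \<theta>)"
proof -
  let ?S = "cspan {s * s' |s s'. s \<in> mult_ker (*) \<and> s' \<in> mult_ker (*)} :: (base, base) tensor set"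
  have "s \<in> ?S" using assms by (simp add: mult_ker_sq_def)
  then have "base_tensor s \<in> mult_ker_sqA \<and> base_tensor s \<in> mult_ker_sq (twist_mult \<theta>) (braid_mult \<theta>)"
  proof (induction rule: cvs.span_induct_alt[consumes 1])
    case base show ?case by (simp add: clinear_0[OF clinear_base_tensor] mult_ker_sq_def cvs.span_zero)
  next
    case (step c x y)
    then obtain s s' where s: "x = s * s'" "s \<in> mult_ker (*)" "s' \<in> mult_ker (*)" by blast
    have "base_tensor x \<in> mult_ker_sqA"
      unfolding s(1) base_tensor_mult mult_ker_sq_def
      using base_tensor_mult_ker(1)[OF s(2)] base_tensor_mult_ker(1)[OF s(3)] by (intro cvs.span_base) blast
    moreover have "base_tensor x \<in> mult_ker_sq (twist_mult \<theta>) (braid_mult \<theta>)"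
      unfolding s(1) base_tensor_mult braid_mult_base[of \<theta>, symmetric] mult_ker_sq_def
      using base_tensor_mult_ker(2)[OF s(2)] base_tensor_mult_ker(2)[OF s(3)] by (intro cvs.span_base) blast
    ultimately show ?case using step(2)
      by (auto simp: clinear_add[OF clinear_base_tensor] clinear_scale[OF clinear_base_tensor] mult_ker_sq_def
          intro!: cvs.span_add cvs.span_scale)
  qed
  then show "base_tensor s \<in> mult_ker_sqA" "base_tensor s \<in> mult_ker_sq (twist_mult \<theta>) (braid_mult \<theta>)" by auto
qed

theorem iota_is_form_map:
  "is_form_map (*) (*) (\<lambda>b b'. actA (Rep_base b) (dA (Rep_base b'))) iota"
  and iota_class: "s \<in> mult_ker (*) \<Longrightarrow> iota (form_class (*) (*) s) = form_class (*) (*) (base_tensor s)"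
proof -
  note e = comm.form_map_exists[where F = "\<lambda>s. form_class (*) (*) (base_tensor s)"
      and g = "\<lambda>b b'. actA (Rep_base b) (dA (Rep_base b'))"]
  have 1: "form_class (*) (*) (base_tensor (s + s')) =
      form_class (*) (*) (base_tensor s) + form_class (*) (*) (base_tensor s')" for s s'
    by (simp add: comm.form_class_add clinear_add[OF clinear_base_tensor])
  have 2: "form_class (*) (*) (base_tensor s) = form_class (*) (*) (base_tensor s')"
    if "s - s' \<in> mult_ker_sq (*) (*)" for s s'
    using base_tensor_mult_ker_sq(1)[OF that] by (simp add: comm.form_class_eq_iff clinear_diff[OF clinear_base_tensor])
  have 3: "form_class (*) (*) (base_tensor (b \<otimes> b' - (b * b') \<otimes> 1)) = actA (Rep_base b) (dA (Rep_base b'))" for b b'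
    by (simp add: comm.form_act_d clinear_diff[OF clinear_base_tensor] base_tensor_tensor times_base.rep_eq one_base.rep_eq)
  show "is_form_map (*) (*) (\<lambda>b b'. actA (Rep_base b) (dA (Rep_base b'))) iota"
    unfolding iota_def using e(1)[OF 1 2 3] .
  show "iota (form_class (*) (*) s) = form_class (*) (*) (base_tensor s)" if "s \<in> mult_ker (*)"
    unfolding iota_def using e(2)[OF 1 2 3 that] .
qed

theorem iota_theta_is_form_map:
  "is_form_map (*) (*) (\<lambda>b b'. act_theta \<theta> (Rep_base b) (d_theta \<theta> (Rep_base b'))) (iota_theta \<theta>)"
  and iota_theta_class: "s \<in> mult_ker (*) \<Longrightarrow>
    iota_theta \<theta> (form_class (*) (*) s) = form_class (twist_mult \<theta>) (braid_mult \<theta>) (base_tensor s)"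
proof -
  let ?cl = "form_class (twist_mult \<theta>) (braid_mult \<theta>)"
  note e = comm.form_map_exists[where F = "\<lambda>s. ?cl (base_tensor s)"
      and g = "\<lambda>b b'. act_theta \<theta> (Rep_base b) (d_theta \<theta> (Rep_base b'))"]
  have 1: "?cl (base_tensor (s + s')) = ?cl (base_tensor s) + ?cl (base_tensor s')" for s s'
    by (simp add: theta.form_class_add clinear_add[OF clinear_base_tensor])
  have 2: "?cl (base_tensor s) = ?cl (base_tensor s')" if "s - s' \<in> mult_ker_sq (*) (*)" for s s'
    using base_tensor_mult_ker_sq(2)[OF that] by (simp add: theta.form_class_eq_iff clinear_diff[OF clinear_base_tensor])
  have 3: "?cl (base_tensor (b \<otimes> b' - (b * b') \<otimes> 1)) = act_theta \<theta> (Rep_base b) (d_theta \<theta> (Rep_base b'))" for b b'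
    by (simp add: theta.form_act_d clinear_diff[OF clinear_base_tensor] base_tensor_tensor times_base.rep_eq
        one_base.rep_eq twist_mult_base)
  show "is_form_map (*) (*) (\<lambda>b b'. act_theta \<theta> (Rep_base b) (d_theta \<theta> (Rep_base b'))) (iota_theta \<theta>)"
    unfolding iota_theta_def using e(1)[OF 1 2 3] .
  show "iota_theta \<theta> (form_class (*) (*) s) = ?cl (base_tensor s)" if "s \<in> mult_ker (*)"
    unfolding iota_theta_def using e(2)[OF 1 2 3 that] .
qed

end

theory Submission
  imports Defs
begin

text \<open>Write \<open>I\<close> for the kernel of the product of \<open>A\<close> and \<open>J\<close> for the ideal of \<open>A \<otimes> A\<close> generated by
  the square of the kernel of the product of \<open>B\<close>. In the commutative algebra \<open>A \<otimes> A\<close>, put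
  \<open>e = \<Sum> z\<^sub>i \<otimes> z\<^sub>i\<^sup>*\<close> and \<open>f = \<Sum> z\<^sub>i\<^sup>* \<otimes> z\<^sub>i\<close>, so that \<open>\<omega>\<^sup>0\<close> is the class of \<open>f - 1\<close>. With \<open>p\<^sub>i\<^sub>j = z\<^sub>i z\<^sub>j\<^sup>*\<close> and
  \<open>D\<^sub>i\<^sub>j = 1 \<otimes> p\<^sub>i\<^sub>j - p\<^sub>i\<^sub>j \<otimes> 1\<close> one has \<open>e f - 1 = - (1/2) \<Sum> D\<^sub>i\<^sub>j D\<^sub>j\<^sub>i \<in> J\<close>. Multiplying by
  \<open>e\<^sup>n\<close> (by \<open>f\<^sup>-\<^sup>n\<close> for \<open>n < 0\<close>) on tensors whose second leg has degree \<open>n\<close> is therefore multiplicative modulo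
  \<open>J\<close>. It maps \<open>I\<^sup>2\<close> into \<open>J\<close> and fixes \<open>B \<otimes> B\<close>, so projecting both legs to degree zero shows that
  \<open>\<Omega>\<^sup>1(B)\<close> embeds into \<open>\<Omega>\<^sup>1(A)\<close>. As \<open>e\<^sup>n\<close> equals \<open>1 - n (f - 1)\<close> modulo \<open>I\<^sup>2\<close>, a coinvariant form
  \<open>\<omega>\<close> is the sum of a form on \<open>B\<close> and \<open>ver(\<omega>) \<omega>\<^sup>0\<close>, which describes the connections on \<open>A\<close>.

  The map of forms \<open>phi_bar\<close> is induced by the twist of \<open>A \<otimes> A\<close>, whose inverse is the twist for \<open>- \<theta>\<close>
  and which fixes \<open>f - 1\<close> and \<open>B \<otimes> B\<close>; the description of the connections on \<open>A\<^sub>\<theta>\<close> is transported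
  along it.\<close>

section \<open>Ideals in the tensor squares\<close>

lemma mult_ker_sq_add: "s \<in> mult_ker_sq m M \<Longrightarrow> s' \<in> mult_ker_sq m M \<Longrightarrow> s + s' \<in> mult_ker_sq m M"
  and mult_ker_sq_diff: "s \<in> mult_ker_sq m M \<Longrightarrow> s' \<in> mult_ker_sq m M \<Longrightarrow> s - s' \<in> mult_ker_sq m M"
  and mult_ker_sq_scale: "s \<in> mult_ker_sq m M \<Longrightarrow> c *\<^sub>C s \<in> mult_ker_sq m M"
  and mult_ker_sq_zero: "0 \<in> mult_ker_sq m M"
  and mult_ker_sq_base: "t \<in> mult_ker m \<Longrightarrow> t' \<in> mult_ker m \<Longrightarrow> M t t' \<in> mult_ker_sq m M"
  unfolding mult_ker_sq_def by (auto intro: cvs.span_add cvs.span_diff cvs.span_scale cvs.span_zero cvs.span_base)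

lemma mult_ker_mult: "s \<in> mult_ker (*) \<Longrightarrow> t * s \<in> mult_ker (*)"
  by (simp add: mult_ker_def tensor_lift_mult_hom)

lemma mult_ker_sq_subset: "s \<in> mult_ker_sq (*) (*) \<Longrightarrow> s \<in> mult_ker (*)"
  unfolding mult_ker_sq_def mem_Collect_eq mult_ker_def
  by (rule cspan_eq_zero[OF _ clinear_tensor_lift[OF cbilinear_mult]]) (auto simp: tensor_lift_mult_hom)

lemma mult_ker_sq_mult:
  assumes "s \<in> mult_ker_sq (*) (*)" shows "t * s \<in> mult_ker_sq (*) (*)"
  using assms unfolding mult_ker_sq_def
proof (induction rule: cvs.span_induct_alt[consumes 1])
  case base show ?case by (simp add: cvs.span_zero)
next
  case (step c x y)
  then obtain s s' where s: "x = s * s'" "s \<in> mult_ker (*)" "s' \<in> mult_ker (*)" by blast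
  have "t * x \<in> cspan {s * s' |s s'. s \<in> mult_ker (*) \<and> s' \<in> mult_ker (*)}"
    unfolding s(1) mult.assoc[symmetric] using mult_ker_mult[OF s(2)] s(3) by (intro cvs.span_base) blast
  with step(2) show ?case by (simp add: distrib_left scaleC_mult_right cvs.span_add cvs.span_scale)
qed

text \<open>The squared kernel as \<open>S\<close> gives the ideal \<open>J\<close>; the kernel
  itself gives the ideal into which straightened elements of \<open>I\<close> fall.\<close>

definition base_ideal :: "(base, base) tensor set \<Rightarrow> (sphere, sphere) tensor set"
  where "base_ideal S = cspan {t * base_tensor n |t n. n \<in> S}"

lemma base_ideal_add: "s \<in> base_ideal S \<Longrightarrow> s' \<in> base_ideal S \<Longrightarrow> s + s' \<in> base_ideal S"
  and base_ideal_diff: "s \<in> base_ideal S \<Longrightarrow> s' \<in> base_ideal S \<Longrightarrow> s - s' \<in> base_ideal S"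
  and base_ideal_zero: "0 \<in> base_ideal S"
  and base_ideal_base: "n \<in> S \<Longrightarrow> t * base_tensor n \<in> base_ideal S"
  and base_ideal_sum: "(\<And>i. i \<in> F \<Longrightarrow> g i \<in> base_ideal S) \<Longrightarrow> sum g F \<in> base_ideal S"
  unfolding base_ideal_def
  by (auto intro: cvs.span_add cvs.span_diff cvs.span_zero cvs.span_base cvs.span_sum)

lemma base_ideal_mult:
  assumes "s \<in> base_ideal S" shows "t * s \<in> base_ideal S"
  using assms unfolding base_ideal_def
proof (induction rule: cvs.span_induct_alt[consumes 1])
  case base show ?case by (simp add: cvs.span_zero)
next
  case (step c x y)
  then obtain t' n where s: "x = t' * base_tensor n" "n \<in> S" by blast
  have "t * x \<in> cspan {t * base_tensor n |t n. n \<in> S}"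
    unfolding s(1) mult.assoc[symmetric] using s(2) by (intro cvs.span_base) blast
  with step(2) show ?case by (simp add: distrib_left scaleC_mult_right cvs.span_add cvs.span_scale)
qed

text \<open>\<open>base_tensor\<close> is multiplicative, so a product of generators is again a
  multiple of the image of an element of the squared kernel.\<close>

lemma base_ideal_mult_ker_square:
  assumes "x \<in> base_ideal (mult_ker (*))" "y \<in> base_ideal (mult_ker (*))"
  shows "x * y \<in> base_ideal (mult_ker_sq (*) (*))"
  using assms(1) unfolding base_ideal_def[of "mult_ker (*)"]
proof (induction rule: cvs.span_induct_alt[consumes 1])
  case base show ?case by (simp add: base_ideal_zero)
next
  case (step c x z)
  then obtain t n where x: "x = t * base_tensor n" "n \<in> mult_ker (*)" by blast
  have "base_tensor n * y \<in> base_ideal (mult_ker_sq (*) (*))"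
    using assms(2) unfolding base_ideal_def[of "mult_ker (*)"]
  proof (induction rule: cvs.span_induct_alt[consumes 1])
    case base show ?case by (simp add: base_ideal_zero)
  next
    case (step c y z)
    then obtain t' n' where y: "y = t' * base_tensor n'" "n' \<in> mult_ker (*)" by blast
    have "base_tensor n * (c *\<^sub>C y) = (c *\<^sub>C t') * base_tensor (n * n')"
      by (simp add: y base_tensor_mult scaleC_mult_left scaleC_mult_right ac_simps)
    with step(2) mult_ker_sq_base[OF x(2) y(2)] show ?case
      by (simp add: distrib_left base_ideal_add base_ideal_base)
  qed
  then have "(c *\<^sub>C t) * (base_tensor n * y) \<in> base_ideal (mult_ker_sq (*) (*))" by (rule base_ideal_mult)
  with step(2) show ?case
    by (simp add: x(1) distrib_right base_ideal_add scaleC_mult_left mult.assoc)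
qed

section \<open>Projection onto the base\<close>

abbreviation deg :: "int \<times> int \<Rightarrow> int" where "deg m \<equiv> fst m + snd m"

lemma cbilinear_scale_left: "clinear \<phi> \<Longrightarrow> cbilinear (\<lambda>k x :: 'v::complex_space. \<phi> k *\<^sub>C x)"
  and cbilinear_scale_right: "clinear \<phi> \<Longrightarrow> cbilinear (\<lambda>(x :: 'v::complex_space) k. \<phi> k *\<^sub>C x)"
  by (rule cbilinearI; simp add: clinear_add clinear_scale scaleC_add_left scaleC_add_right scaleC_scaleC
      scaleC_complex_def mult.commute)+

text \<open>The degree is read off from the torus coaction: on a homogeneous element the exponent in
  \<open>delta\<close> is the sum of the two weights.\<close>

definition degree_zero :: "sphere \<Rightarrow> sphere"
  where "degree_zero a = tensor_lift (\<lambda>k x. lin_ext (\<lambda>m. if deg m = 0 then 1 else 0) k *\<^sub>C x) (rho a)"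

lemma clinear_degree_zero: "clinear degree_zero"
  and degree_zero_homogeneous: "homogeneous m a \<Longrightarrow> degree_zero a = (if deg m = 0 then a else 0)"
proof -
  note b = cbilinear_scale_left[OF clinear_lin_ext[of "\<lambda>m. if deg m = 0 then 1 else 0 :: complex"], where 'v = sphere]
  show "clinear degree_zero"
    by (rule clinearI) (simp_all add: degree_zero_def clinear_add[OF clinear_rho] clinear_scale[OF clinear_rho]
      clinear_add[OF clinear_tensor_lift[OF b]] clinear_scale[OF clinear_tensor_lift[OF b]])
  show "degree_zero a = (if deg m = 0 then a else 0)" if "homogeneous m a"
    using that by (simp add: degree_zero_def homogeneous_def tensor_lift_tensor[OF b] tm_def scaleC_complex_def)
qed

lemma delta_degree_zero: "delta (degree_zero a) = degree_zero a \<otimes> 1"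
proof (induction a rule: homogeneous_induct)
  case (homogeneous m a)
  then show ?case
    by (simp add: degree_zero_homogeneous[OF homogeneous] homogeneous_def circle_power_def
        clinear_0[OF clinear_delta] tensor_zero_left)
qed (simp add: clinear_add[OF clinear_degree_zero] clinear_add[OF clinear_delta] tensor_add_left)

lift_definition base_proj :: "sphere \<Rightarrow> base" is degree_zero
  by (rule delta_degree_zero)

lemma clinear_base_proj: "clinear base_proj"
  by (rule clinearI; transfer; simp add: clinear_add[OF clinear_degree_zero] clinear_scale[OF clinear_degree_zero])

lemma degree_zero_base: "degree_zero (Rep_base b) = Rep_base b"
proof (induction b rule: base_homogeneous_induct)
  case (homogeneous k a)
  then show ?case by (simp add: degree_zero_homogeneous[OF homogeneous])
qed (simp add: clinear_add[OF clinear_degree_zero])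

text \<open>A factor from the base has degree zero and leaves the degree of the other factor
  unchanged.\<close>

lemma base_proj_mult: "base_proj (a * Rep_base b) = base_proj a * b"
proof -
  have "degree_zero (a * Rep_base b) = degree_zero a * Rep_base b"
  proof (induction b rule: base_homogeneous_induct)
    case b: (homogeneous k b)
    show ?case
    proof (induction a rule: homogeneous_induct)
      case a: (homogeneous m a)
      show ?case
        by (simp add: degree_zero_homogeneous[OF a] degree_zero_homogeneous[OF homogeneous_mult[OF a b]])
    qed (simp add: distrib_right clinear_add[OF clinear_degree_zero])
  qed (simp add: distrib_left clinear_add[OF clinear_degree_zero])
  then show ?thesis by transfer
qed

lemma base_proj_base: "base_proj (Rep_base b) = b"
  by (metis Rep_base_inverse base_proj.abs_eq base_proj.rep_eq degree_zero_base Rep_base_inject)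

section \<open>The projection of both legs\<close>

definition base_proj2 :: "(sphere, sphere) tensor \<Rightarrow> (base, base) tensor"
  where "base_proj2 = tensor_lift (\<lambda>a a'. base_proj a \<otimes> base_proj a')"

lemma clinear_base_proj2: "clinear base_proj2"
  and base_proj2_tensor: "base_proj2 (a \<otimes> a') = base_proj a \<otimes> base_proj a'"
proof -
  have b: "cbilinear (\<lambda>a a'. base_proj a \<otimes> base_proj a')"
    by (rule cbilinearI) (simp_all add: clinear_add[OF clinear_base_proj] clinear_scale[OF clinear_base_proj]
      tensor_add_left tensor_add_right tensor_scale_left tensor_scale_right)
  show "clinear base_proj2" unfolding base_proj2_def by (rule clinear_tensor_lift[OF b])
  show "base_proj2 (a \<otimes> a') = base_proj a \<otimes> base_proj a'"
    unfolding base_proj2_def by (rule tensor_lift_tensor[OF b])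
qed

lemma base_proj2_mult: "base_proj2 (t * base_tensor s) = base_proj2 t * s"
proof (induction t rule: tensor_induct)
  case (tensor a a')
  show ?case
    by (induction s rule: tensor_induct)
      (simp_all add: base_tensor_tensor times_tensor_tensor base_proj2_tensor base_proj_mult distrib_left
        clinear_add[OF clinear_base_tensor] clinear_add[OF clinear_base_proj2])
qed (simp add: distrib_right clinear_add[OF clinear_base_proj2])

lemma base_proj2_base_tensor: "base_proj2 (base_tensor s) = s"
  by (induction s rule: tensor_induct)
    (simp_all add: base_tensor_tensor base_proj2_tensor base_proj_base
      clinear_add[OF clinear_base_tensor] clinear_add[OF clinear_base_proj2])

text \<open>Linearity over \<open>B \<otimes> B\<close> turns a generator
  \<open>t * base_tensor n\<close> into a multiple of \<open>n\<close>, so extending the ideal to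
  \<open>A \<otimes> A\<close> and projecting back adds nothing.\<close>

lemma base_proj2_base_ideal:
  assumes "s \<in> base_ideal (mult_ker_sq (*) (*))" shows "base_proj2 s \<in> mult_ker_sq (*) (*)"
  using assms unfolding base_ideal_def
proof (induction rule: cvs.span_induct_alt[consumes 1])
  case base show ?case by (simp add: clinear_0[OF clinear_base_proj2] mult_ker_sq_zero)
next
  case (step c x y)
  then show ?case
    by (auto simp: clinear_add[OF clinear_base_proj2] clinear_scale[OF clinear_base_proj2] base_proj2_mult
        intro!: mult_ker_sq_add mult_ker_sq_scale mult_ker_sq_mult)
qed

section \<open>Parallel transport along the fibre\<close>

lemma homogeneous_generator: "homogeneous (weight g) (generator g)"
  and homogeneous_star_generator: "homogeneous (- weight g) (star (generator g))"
  by (cases g; simp add: homogeneous_def rho_def delta_def alg_lift_generator[OF respects_rho]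
        alg_lift_generator[OF respects_delta] alg_lift_star_generator[OF respects_rho]
        alg_lift_star_generator[OF respects_delta] rho_letter_def delta_letter_def circle_power_def)+

lemma deg_weight: "deg (weight g) = 1"
  by (cases g) simp_all

lemma homogeneous_deg_zero: "homogeneous m a \<Longrightarrow> deg m = 0 \<Longrightarrow> Rep_base (Abs_base a) = a"
  by (rule Abs_base_inverse) (simp add: homogeneous_def circle_power_def)

text \<open>Each factor of the contraction multiplies the first leg by \<open>u i\<close> and the
  second by \<open>v i\<close>. This preserves the product by \<open>one\<close> and lowers the
  degree of the second leg by \<open>d\<close>. After \<open>n\<close> factors the second leg lies
  in the base, and so does the first if the total degree is zero. General \<open>u\<close>,
  \<open>v\<close> and \<open>d\<close> cover both \<open>e\<close> and \<open>f\<close>.\<close>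

lemma
  fixes u v :: "sphere_gen \<Rightarrow> sphere" and k :: "sphere_gen \<Rightarrow> int \<times> int"
  assumes v: "\<And>i. homogeneous (- k i) (v i)" and d: "\<And>i. deg (k i) = d"
    and one: "(\<Sum>i\<in>{Z1, Z2}. u i * v i) = 1"
    and a': "homogeneous m' a'" "deg m' = d * int n"
  shows contraction_power_mult_ker:
      "(\<Sum>i\<in>{Z1, Z2}. u i \<otimes> v i) ^ n * (a \<otimes> a') - (a * a') \<otimes> 1 \<in> base_ideal (mult_ker (*))"
    and contraction_power_range:
      "(\<And>i. homogeneous (k i) (u i)) \<Longrightarrow> homogeneous m a \<Longrightarrow> deg m = - d * int n \<Longrightarrow>
        (\<Sum>i\<in>{Z1, Z2}. u i \<otimes> v i) ^ n * (a \<otimes> a') \<in> range base_tensor"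
proof -
  let ?c = "\<Sum>i\<in>{Z1, Z2}. u i \<otimes> v i"
  have step: "?c ^ Suc n * (a \<otimes> a') = (\<Sum>i\<in>{Z1, Z2}. ?c ^ n * ((a * u i) \<otimes> (v i * a')))" for n a a'
    by (simp add: distrib_left distrib_right times_tensor_tensor ac_simps flip: mult.assoc)
  show "?c ^ n * (a \<otimes> a') - (a * a') \<otimes> 1 \<in> base_ideal (mult_ker (*))"
    using a'
  proof (induction n arbitrary: m' a a')
    case 0
    \<comment> \<open>In degree zero \<open>a'\<close> is an element of the base, and the difference
      is a multiple of \<open>1 \<otimes> b - b \<otimes> 1\<close>.\<close>
    define b where "b = Abs_base a'"
    have b: "Rep_base b = a'" unfolding b_def using 0 by (intro homogeneous_deg_zero) simp_all
    have "a \<otimes> a' - (a * a') \<otimes> 1 = (a \<otimes> 1) * base_tensor (1 \<otimes> b - b \<otimes> 1)"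
      by (simp add: clinear_diff[OF clinear_base_tensor] base_tensor_tensor b one_base.rep_eq right_diff_distrib
          times_tensor_tensor)
    moreover have "1 \<otimes> b - b \<otimes> 1 \<in> mult_ker (*)"
      by (simp add: mult_ker_def clinear_diff[OF clinear_tensor_lift[OF cbilinear_mult]]
          tensor_lift_tensor[OF cbilinear_mult])
    ultimately show ?case by (simp add: base_ideal_base)
  next
    case (Suc n)
    have "?c ^ n * ((a * u i) \<otimes> (v i * a')) - (a * u i * (v i * a')) \<otimes> 1 \<in> base_ideal (mult_ker (*))" for i
      by (rule Suc.IH[OF homogeneous_mult[OF v Suc.prems(1)]])
        (use Suc.prems(2) d[of i] in \<open>simp add: algebra_simps\<close>)
    then have "(\<Sum>i\<in>{Z1, Z2}. ?c ^ n * ((a * u i) \<otimes> (v i * a')) - (a * u i * (v i * a')) \<otimes> 1)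
        \<in> base_ideal (mult_ker (*))" by (intro base_ideal_sum)
    \<comment> \<open>By \<open>one\<close> the corrections of the summands add up to a single
      one.\<close>
    moreover have "(\<Sum>i\<in>{Z1, Z2}. (a * u i * (v i * a')) \<otimes> (1::sphere)) = (a * a') \<otimes> 1"
    proof -
      have "(\<Sum>i\<in>{Z1, Z2}. (a * u i * (v i * a')) \<otimes> (1::sphere)) = (a * a' * (\<Sum>i\<in>{Z1, Z2}. u i * v i)) \<otimes> 1"
        by (simp add: distrib_left tensor_add_left ac_simps)
      then show ?thesis unfolding one by simp
    qed
    ultimately show ?case unfolding step sum_subtractf by simp
  qed
  show "?c ^ n * (a \<otimes> a') \<in> range base_tensor"
    if u: "\<And>i. homogeneous (k i) (u i)" and a: "homogeneous m a" "deg m = - d * int n"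
    using a' a
  proof (induction n arbitrary: m m' a a')
    case 0
    then have "a \<otimes> a' = base_tensor (Abs_base a \<otimes> Abs_base a')"
      by (simp add: base_tensor_tensor homogeneous_deg_zero[of m] homogeneous_deg_zero[of m'])
    then show ?case by auto
  next
    case (Suc n)
    have "?c ^ n * ((a * u i) \<otimes> (v i * a')) \<in> range base_tensor" for i
      by (rule Suc.IH[OF homogeneous_mult[OF v Suc.prems(1)] _ homogeneous_mult[OF Suc.prems(3) u]])
        (use Suc.prems(2,4) d[of i] in \<open>simp_all add: algebra_simps\<close>)
    then obtain g where "?c ^ n * ((a * u i) \<otimes> (v i * a')) = base_tensor (g i)" for i
      unfolding image_iff by metis
    then have "?c ^ Suc n * (a \<otimes> a') = base_tensor (\<Sum>i\<in>{Z1, Z2}. g i)"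
      unfolding step by (simp only: clinear_sum[OF clinear_base_tensor])
    then show ?case by blast
  qed
qed

text \<open>The element \<open>e\<close>; \<open>contract_star\<close> below is
  \<open>f\<close>.\<close>

definition contract :: "(sphere, sphere) tensor"
  where "contract = (\<Sum>i\<in>{Z1, Z2}. generator i \<otimes> star (generator i))"

definition contract_star :: "(sphere, sphere) tensor"
  where "contract_star = (\<Sum>i\<in>{Z1, Z2}. star (generator i) \<otimes> generator i)"

text \<open>\<open>f\<close> stands in for the inverse of \<open>e\<close>, so exponents add up only
  modulo \<open>J\<close>.\<close>

definition transport :: "int \<Rightarrow> (sphere, sphere) tensor"
  where "transport n = (if 0 \<le> n then contract ^ nat n else contract_star ^ nat (- n))"

lemma transport_mult_ker:
  assumes "homogeneous m a'"
  shows "transport (deg m) * (a \<otimes> a') - (a * a') \<otimes> 1 \<in> base_ideal (mult_ker (*))"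
proof (cases "0 \<le> deg m")
  case True
  then show ?thesis unfolding transport_def contract_def
    by (simp only: if_True)
      (rule contraction_power_mult_ker[OF homogeneous_star_generator deg_weight _ assms];
        use sphere_relation in \<open>simp add: ac_simps\<close>)
next
  case False
  \<comment> \<open>In negative degree generators and adjoints trade places: \<open>k\<close> is
    minus the weight and \<open>d\<close> is \<open>- 1\<close>.\<close>
  have "homogeneous (- (- weight i)) (generator i)" "deg (- weight i) = - 1" for i
    using homogeneous_generator[of i] deg_weight[of i] by simp_all
  note * = contraction_power_mult_ker[OF this _ assms, where u = "\<lambda>i. star (generator i)"]
  from False show ?thesis unfolding transport_def contract_star_def
    by (simp only: if_False) (rule *; use sphere_relation in \<open>simp add: ac_simps\<close>)
qed

text \<open>Since the total degree is zero, the shift that brings the second leg to degree zero does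
  the same to the first.\<close>

lemma transport_range:
  assumes "homogeneous m' a'" "homogeneous m a" "deg m + deg m' = 0"
  shows "transport (deg m') * (a \<otimes> a') \<in> range base_tensor"
proof (cases "0 \<le> deg m'")
  case True
  then show ?thesis using assms(3) unfolding transport_def contract_def
    by (simp only: if_True)
      (rule contraction_power_range[OF homogeneous_star_generator deg_weight _ assms(1) _ homogeneous_generator assms(2)];
        use sphere_relation in \<open>simp add: ac_simps\<close>)
next
  case False
  have "homogeneous (- (- weight i)) (generator i)" "deg (- weight i) = - 1" for i
    using homogeneous_generator[of i] deg_weight[of i] by simp_all
  note * = contraction_power_range[OF this _ assms(1) _ homogeneous_star_generator assms(2)]
  from False show ?thesis using assms(3) unfolding transport_def contract_star_def
    by (simp only: if_False) (rule *; use sphere_relation in \<open>simp add: ac_simps\<close>)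
qed


section \<open>Invertibility of \<open>e\<close> modulo \<open>J\<close>\<close>

definition base_entry :: "sphere_gen \<Rightarrow> sphere_gen \<Rightarrow> base"
  where "base_entry i j = Abs_base (generator i * star (generator j))"

lemma Rep_base_entry: "Rep_base (base_entry i j) = generator i * star (generator j)"
  unfolding base_entry_def
  by (rule homogeneous_deg_zero[OF homogeneous_mult[OF homogeneous_generator homogeneous_star_generator]])
    (cases i; cases j; simp)

text \<open>Both legs of \<open>e f\<close> have degree zero: it is the image of \<open>Q\<close>.
  As the square of the matrix \<open>p\<close> has trace 1, expanding the sum of the
  \<open>D i j * D j i\<close> gives \<open>2 (1 - Q)\<close>.\<close>

lemma contract_mult_contract_star: "contract * contract_star - 1 \<in> base_ideal (mult_ker_sq (*) (*))"
proof -
  let ?p = "base_entry" and ?I = "{Z1, Z2}"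
  define D where "D i j = 1 \<otimes> ?p i j - ?p i j \<otimes> 1" for i j
  define Q where "Q = (\<Sum>i\<in>?I. \<Sum>j\<in>?I. ?p i j \<otimes> ?p j i)"
  have D: "D i j \<in> mult_ker (*)" for i j
    by (simp add: D_def mult_ker_def clinear_diff[OF clinear_tensor_lift[OF cbilinear_mult]]
          tensor_lift_tensor[OF cbilinear_mult])
  have one: "(\<Sum>i\<in>?I. \<Sum>j\<in>?I. ?p i j * ?p j i) = 1"
  proof -
    \<comment> \<open>The trace of the square of \<open>p\<close> is the square of the left side of
      the sphere relation.\<close>
    have "Rep_base (\<Sum>i\<in>?I. \<Sum>j\<in>?I. ?p i j * ?p j i) = (star z1 * z1 + star z2 * z2) * (star z1 * z1 + star z2 * z2)"
      by (simp add: plus_base.rep_eq times_base.rep_eq Rep_base_entry distrib_left distrib_right ac_simps)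
    then have "Rep_base (\<Sum>i\<in>?I. \<Sum>j\<in>?I. ?p i j * ?p j i) = Rep_base 1"
      unfolding sphere_relation one_base.rep_eq by simp
    then show ?thesis unfolding Rep_base_inject .
  qed
  have "(\<Sum>i\<in>?I. \<Sum>j\<in>?I. D i j * D j i) = 1 \<otimes> (\<Sum>i\<in>?I. \<Sum>j\<in>?I. ?p i j * ?p j i)
      + (\<Sum>i\<in>?I. \<Sum>j\<in>?I. ?p i j * ?p j i) \<otimes> 1 - Q - Q"
    by (simp add: D_def Q_def right_diff_distrib left_diff_distrib times_tensor_tensor tensor_add_left tensor_add_right
      mult.commute)
  then have *: "(\<Sum>i\<in>?I. \<Sum>j\<in>?I. D i j * D j i) = (1 - Q) + (1 - Q)"
    unfolding one by (simp add: one_tensor_def)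
  have Q: "Q - 1 = (- 1 / 2) *\<^sub>C (\<Sum>i\<in>?I. \<Sum>j\<in>?I. D i j * D j i)"
  proof -
    have "(- 1 / 2 :: complex) *\<^sub>C ((1 - Q) + (1 - Q)) = (- 1 / 2 + - 1 / 2) *\<^sub>C (1 - Q)"
      by (simp only: scaleC_add_right scaleC_add_left)
    then show ?thesis unfolding * by (simp add: cvs.scale_minus_left)
  qed
  have "Q - 1 \<in> mult_ker_sq (*) (*)"
    unfolding Q using D by (intro mult_ker_sq_scale) (simp add: mult_ker_sq_add mult_ker_sq_base)
  then have "1 * base_tensor (Q - 1) \<in> base_ideal (mult_ker_sq (*) (*))" by (rule base_ideal_base)
  moreover have "base_tensor (Q - 1) = contract * contract_star - 1"
    by (simp add: Q_def clinear_diff[OF clinear_base_tensor] clinear_add[OF clinear_base_tensor] base_tensor_tensor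
        Rep_base_entry contract_def contract_star_def distrib_left distrib_right times_tensor_tensor
        one_tensor_def one_base.rep_eq ac_simps)
  ultimately show ?thesis by simp
qed

text \<open>The free factor \<open>x\<close> will hold the surplus power in
  \<open>transport_add\<close>.\<close>

lemma contract_star_power:
  "x * contract ^ n * contract_star ^ n - x \<in> base_ideal (mult_ker_sq (*) (*))"
proof (induction n arbitrary: x)
  case 0 show ?case by (simp add: base_ideal_zero)
next
  case (Suc n)
  \<comment> \<open>Telescoping: one pair of factors is cancelled first, the other \<open>n\<close>
    pairs by induction.\<close>
  have "x * contract ^ n * contract_star ^ n * (contract * contract_star - 1) + (x * contract ^ n * contract_star ^ n - x)
      \<in> base_ideal (mult_ker_sq (*) (*))"
    by (intro base_ideal_add base_ideal_mult contract_mult_contract_star Suc)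
  then show ?case by (simp add: right_diff_distrib ac_simps)
qed

lemma transport_add: "transport k * transport l - transport (k + l) \<in> base_ideal (mult_ker_sq (*) (*))"
proof -
  \<comment> \<open>Errors arise only for opposite signs: the smaller power is cancelled and the
    surplus is kept as \<open>x\<close>.\<close>
  have *: "transport (int m) * transport (- int n) - transport (int m - int n) \<in> base_ideal (mult_ker_sq (*) (*))" for m n
  proof (cases "n \<le> m")
    case True
    then obtain d where d: "m = d + n" using nat_le_iff_add[of n m] by (metis add.commute)
    \<comment> \<open>The case \<open>n = 0\<close> is split off because \<open>transport 0\<close>
      is a power of \<open>contract\<close>, not of \<open>contract_star\<close>.\<close>
    show ?thesis using contract_star_power[of "contract ^ d" n]
      by (cases "n = 0") (simp_all add: transport_def d nat_add_distrib power_add base_ideal_zero)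
  next
    case False
    then obtain d where d: "n = d + m" using nat_le_iff_add[of m n] by (metis add.commute nat_le_linear)
    show ?thesis using contract_star_power[of "contract_star ^ d" m] False
      by (simp add: transport_def d nat_add_distrib power_add ac_simps)
  qed
  consider "0 \<le> k" "0 \<le> l" | "k < 0" "l < 0" | "0 \<le> k" "l < 0" | "k < 0" "0 \<le> l" by linarith
  then show ?thesis
  proof cases
    case 1
    then show ?thesis by (simp add: transport_def nat_add_distrib power_add base_ideal_zero)
  next
    case 2
    then have "nat (- (k + l)) = nat (- k) + nat (- l)" by simp
    with 2 show ?thesis by (simp add: transport_def power_add base_ideal_zero)
  next
    case 3
    then show ?thesis using *[of "nat k" "nat (- l)"] by simp
  next
    case 4
    then show ?thesis using *[of "nat l" "nat (- k)"] by (simp add: mult.commute add.commute)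
  qed
qed

text \<open>\<^const>\<open>contract\<close> and \<^const>\<open>contract_star\<close> are inverse to each other modulo the ideal
  generated by the squared kernel of the base, which makes \<open>straighten\<close> multiplicative modulo this ideal.
  It moves the degree of the second leg into the first one.\<close>

definition straighten :: "(sphere, sphere) tensor \<Rightarrow> (sphere, sphere) tensor"
  where "straighten = tensor_lift (\<lambda>a a'. tensor_lift (\<lambda>k x. lin_ext (\<lambda>m. transport (deg m)) k * (a \<otimes> x)) (rho a'))"

lemma clinear_straighten: "clinear straighten"
  and straighten_tensor: "homogeneous m a' \<Longrightarrow> straighten (a \<otimes> a') = transport (deg m) * (a \<otimes> a')"
proof -
  let ?L = "lin_ext (\<lambda>m. transport (deg m))"
  note l = clinear_add[OF clinear_lin_ext] clinear_scale[OF clinear_lin_ext]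
  have b: "cbilinear (\<lambda>k x. ?L k * (a \<otimes> x))" for a
    by (rule cbilinearI) (simp_all add: l distrib_left distrib_right scaleC_mult_left scaleC_mult_right
      tensor_add_right tensor_scale_right)
  have c: "cbilinear (\<lambda>a a'. tensor_lift (\<lambda>k x. ?L k * (a \<otimes> x)) (rho a'))"
    by (rule cbilinearI) (simp_all add: tensor_add_left tensor_scale_left distrib_left scaleC_mult_right
      tensor_lift_fun_add tensor_lift_fun_scale clinear_add[OF clinear_rho] clinear_scale[OF clinear_rho]
      clinear_add[OF clinear_tensor_lift[OF b]] clinear_scale[OF clinear_tensor_lift[OF b]])
  show "clinear straighten" unfolding straighten_def by (rule clinear_tensor_lift[OF c])
  show "straighten (a \<otimes> a') = transport (deg m) * (a \<otimes> a')" if "homogeneous m a'"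
  proof -
    have "rho a' = tm m \<otimes> a'" using that by (simp add: homogeneous_def)
    then show ?thesis
      unfolding straighten_def tensor_lift_tensor[OF c] by (simp add: tensor_lift_tensor[OF b] tm_def scaleC_one)
  qed
qed

section \<open>Straightening the kernels, and the embedding of the forms on the base\<close>

lemma straighten_mult: "straighten s * straighten s' - straighten (s * s') \<in> base_ideal (mult_ker_sq (*) (*))"
proof (induction s rule: tensor_homogeneous_induct)
  case s: (homogeneous m a n b)
  show ?case
  proof (induction s' rule: tensor_homogeneous_induct)
    case s': (homogeneous p c q e)
    \<comment> \<open>The two sides differ by a multiple of the additivity defect of
      \<open>transport\<close>.\<close>
    have "((a * c) \<otimes> (b * e)) * (transport (deg n) * transport (deg q) - transport (deg n + deg q))
        \<in> base_ideal (mult_ker_sq (*) (*))"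
      by (rule base_ideal_mult[OF transport_add])
    moreover have "deg (n + q) = deg n + deg q" by simp
    ultimately show ?case
      by (simp only: times_tensor_tensor straighten_tensor[OF s(2)] straighten_tensor[OF s'(2)]
          straighten_tensor[OF homogeneous_mult[OF s(2) s'(2)]] right_diff_distrib)
        (simp only: ac_simps flip: times_tensor_tensor)
  next
    case (add t t')
    from base_ideal_add[OF add] show ?case
      by (simp add: clinear_add[OF clinear_straighten] distrib_left add_diff_add)
  qed
next
  case (add t t')
  from base_ideal_add[OF add] show ?case
    by (simp add: clinear_add[OF clinear_straighten] distrib_right add_diff_add)
qed

lemma straighten_base_tensor: "straighten (base_tensor s) = base_tensor s"
proof (induction s rule: tensor_induct)
  case (tensor b b')
  show ?case unfolding base_tensor_tensor
    by (induction b' rule: base_homogeneous_induct)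
      (simp_all add: straighten_tensor transport_def tensor_add_right clinear_add[OF clinear_straighten])
qed (simp add: clinear_add[OF clinear_straighten] clinear_add[OF clinear_base_tensor])

lemma straighten_mult_ker:
  assumes "s \<in> mult_kerA" shows "straighten s \<in> base_ideal (mult_ker (*))"
proof -
  \<comment> \<open>Induction over tensors leaves the kernel, so the claim is extended to all
    tensors by subtracting the product.\<close>
  have "straighten s - tensor_lift (*) s \<otimes> 1 \<in> base_ideal (mult_ker (*))" for s
  proof (induction s rule: tensor_homogeneous_induct)
    case (homogeneous m a n b)
    then show ?case using transport_mult_ker
      by (simp add: straighten_tensor tensor_lift_tensor[OF cbilinear_mult])
  next
    case (add t t')
    from base_ideal_add[OF add] show ?case
      by (simp add: clinear_add[OF clinear_straighten] tensor_add_left add_diff_add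
        clinear_add[OF clinear_tensor_lift[OF cbilinear_mult]])
  qed
  from this[of s] assms show ?thesis by (simp add: mult_ker_def tensor_zero_left)
qed

text \<open>The product of two straightened elements of \<open>I\<close> lies in \<open>J\<close>,
  and straightening the product changes it only by an element of \<open>J\<close>.\<close>

lemma straighten_mult_ker_sq:
  assumes "s \<in> mult_ker_sqA" shows "straighten s \<in> base_ideal (mult_ker_sq (*) (*))"
  using assms unfolding mult_ker_sq_def[of "(*) :: sphere \<Rightarrow> _"]
proof (induction rule: cvs.span_induct_alt[consumes 1])
  case base show ?case by (simp add: clinear_0[OF clinear_straighten] base_ideal_zero)
next
  case (step c x y)
  then obtain s s' where s: "x = s * s'" "s \<in> mult_kerA" "s' \<in> mult_kerA" by blast
  have "straighten s * straighten s' - (straighten s * straighten s' - straighten (s * s')) \<in> base_ideal (mult_ker_sq (*) (*))"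
    by (intro base_ideal_diff base_ideal_mult_ker_square straighten_mult straighten_mult_ker s)
  then have "(c *\<^sub>C 1) * straighten x \<in> base_ideal (mult_ker_sq (*) (*))"
    unfolding s(1) by (intro base_ideal_mult) simp
  with step(2) show ?case
    by (simp add: clinear_add[OF clinear_straighten] clinear_scale[OF clinear_straighten] base_ideal_add scaleC_mult_left)
qed

text \<open>This gives the injectivity of \<open>iota\<close>. Straightening sends
  \<open>I\<^sup>2\<close> into \<open>J\<close> but fixes tensors over the base, and the projection
  brings \<open>J\<close> back to the squared kernel of the base.\<close>

lemma base_tensor_mult_ker_sq_iff: "base_tensor s \<in> mult_ker_sqA \<longleftrightarrow> s \<in> mult_ker_sq (*) (*)"
proof
  assume "base_tensor s \<in> mult_ker_sqA"
  from base_proj2_base_ideal[OF straighten_mult_ker_sq[OF this]] show "s \<in> mult_ker_sq (*) (*)"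
    by (simp add: straighten_base_tensor base_proj2_base_tensor)
qed (rule base_tensor_mult_ker_sq)

section \<open>Forms of degree zero\<close>

lemma laurent_circle_power: "alg_lift laurent_letter (circle_power n) = Poly_Mapping.single n 1"
proof -
  have v: "laurent_letter (Gen T) = Poly_Mapping.single 1 1" "laurent_letter (Adj T) = Poly_Mapping.single (- 1) 1"
    by (simp_all add: laurent_letter_def)
  have a: "alg_lift laurent_letter (circle_t ^ n) = Poly_Mapping.single (int n) 1" for n
    by (induction n) (simp_all add: alg_lift_one[OF respects_laurent] alg_lift_mult[OF respects_laurent]
        alg_lift_generator[OF respects_laurent] v mult_single)
  have b: "alg_lift laurent_letter (star circle_t ^ n) = Poly_Mapping.single (- int n) 1" for n
    by (induction n) (simp_all add: alg_lift_one[OF respects_laurent] alg_lift_mult[OF respects_laurent]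
        alg_lift_star_generator[OF respects_laurent] v mult_single)
  show ?thesis by (simp add: circle_power_def a b)
qed

text \<open>The Haar functional of the circle, computed on Laurent polynomials.\<close>

definition constant_term :: "circle \<Rightarrow> complex"
  where "constant_term h = Poly_Mapping.lookup (alg_lift laurent_letter h) 0"

lemma clinear_constant_term: "clinear constant_term"
  by (rule clinearI) (simp_all add: constant_term_def alg_lift_add[OF respects_laurent]
      alg_lift_scale[OF respects_laurent] lookup_add lookup_scaleC)

lemma constant_term_circle_power: "constant_term (circle_power n) = (if n = 0 then 1 else 0)"
  by (simp add: constant_term_def laurent_circle_power lookup_single when_def)

section \<open>The circle coaction on \<open>A \<otimes> A\<close> and its coinvariants\<close>

lemma clinear_delta2: "clinear delta2"
  and delta2_homogeneous:
    "homogeneous m a \<Longrightarrow> homogeneous n b \<Longrightarrow> delta2 (a \<otimes> b) = (a \<otimes> b) \<otimes> circle_power (deg m + deg n)"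
proof -
  define B :: "(sphere, circle) tensor \<Rightarrow> (sphere, circle) tensor \<Rightarrow> _"
    where "B u v = tensor_lift (\<lambda>x h. tensor_lift (\<lambda>x' h'. (x \<otimes> x') \<otimes> (h * h')) v) u" for u v
  note s = distrib_left distrib_right scaleC_mult_left scaleC_mult_right tensor_add_left tensor_add_right
    tensor_scale_left tensor_scale_right
  have 1: "cbilinear (\<lambda>(x' :: sphere) h'. (x \<otimes> x') \<otimes> (h * h'))" for x :: sphere and h :: circle
    by (rule cbilinearI) (simp_all only: s)
  have 2: "cbilinear (\<lambda>(x :: sphere) h. (x \<otimes> x') \<otimes> (h * h'))" for x' :: sphere and h' :: circle
    by (rule cbilinearI) (simp_all only: s)
  have 3: "cbilinear (\<lambda>(x :: sphere) h. tensor_lift (\<lambda>x' h'. (x \<otimes> x') \<otimes> (h * h')) v)" for v :: "(sphere, circle) tensor"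
    by (rule cbilinear_tensor_lift[OF 1 2])
  have B: "cbilinear B" unfolding B_def by (rule tensor_lift_cong_linear[OF 1 3])
  have B_tensor: "B (x \<otimes> h) (x' \<otimes> h') = (x \<otimes> x') \<otimes> (h * h')" for x h x' h'
    unfolding B_def by (simp only: tensor_lift_tensor[OF 3] tensor_lift_tensor[OF 2] tensor_lift_tensor[OF 1])
  have b: "cbilinear (\<lambda>a a'. B (delta a) (delta a'))"
    by (rule cbilinearI) (simp_all only: cbilinearD[OF B] clinear_add[OF clinear_delta] clinear_scale[OF clinear_delta])
  have delta2: "delta2 = tensor_lift (\<lambda>a a'. B (delta a) (delta a'))"
    by (simp add: delta2_def B_def)
  show "clinear delta2" unfolding delta2 by (rule clinear_tensor_lift[OF b])
  show "delta2 (a \<otimes> b) = (a \<otimes> b) \<otimes> circle_power (deg m + deg n)" if "homogeneous m a" "homogeneous n b"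
    using that unfolding delta2 tensor_lift_tensor[OF b] by (simp add: homogeneous_def B_tensor circle_power_add)
qed

text \<open>Averaging with the Haar functional projects onto the coinvariants of
  \<open>delta2\<close>.\<close>

definition degree_zero2 :: "(sphere, sphere) tensor \<Rightarrow> (sphere, sphere) tensor"
  where "degree_zero2 s = tensor_lift (\<lambda>x h. constant_term h *\<^sub>C x) (delta2 s)"

lemma clinear_constant_term_lift:
    "clinear (tensor_lift (\<lambda>(x :: (sphere, sphere) tensor) h. constant_term h *\<^sub>C x))"
  and constant_term_lift_tensor:
    "tensor_lift (\<lambda>x h. constant_term h *\<^sub>C x) (s \<otimes> h) = constant_term h *\<^sub>C (s :: (sphere, sphere) tensor)"
  using cbilinear_scale_right[OF clinear_constant_term, where 'v = "(sphere, sphere) tensor"]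
  by (auto intro: clinear_tensor_lift)

lemma clinear_degree_zero2: "clinear degree_zero2"
  by (rule clinearI) (simp_all add: degree_zero2_def clinear_add[OF clinear_delta2] clinear_scale[OF clinear_delta2]
      clinear_add[OF clinear_constant_term_lift] clinear_scale[OF clinear_constant_term_lift])

lemma degree_zero2_homogeneous:
  "homogeneous m a \<Longrightarrow> homogeneous n b \<Longrightarrow> degree_zero2 (a \<otimes> b) = (if deg m + deg n = 0 then a \<otimes> b else 0)"
  by (simp add: degree_zero2_def delta2_homogeneous constant_term_lift_tensor constant_term_circle_power scaleC_one)

lemma delta2_degree_zero2: "delta2 (degree_zero2 s) = degree_zero2 s \<otimes> 1"
proof (induction s rule: tensor_homogeneous_induct)
  case (homogeneous m a n b)
  then show ?case
    by (simp add: degree_zero2_homogeneous delta2_homogeneous circle_power_def clinear_0[OF clinear_delta2] tensor_zero_left)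
qed (simp add: clinear_add[OF clinear_degree_zero2] clinear_add[OF clinear_delta2] tensor_add_left)

lemma degree_zero2_base_tensor: "degree_zero2 (base_tensor s) = base_tensor s"
proof (induction s rule: tensor_induct)
  case (tensor b b')
  show ?case unfolding base_tensor_tensor
  proof (induction b rule: base_homogeneous_induct)
    case b: (homogeneous k b)
    show ?case
      by (induction b' rule: base_homogeneous_induct)
        (simp_all add: degree_zero2_homogeneous[OF b] tensor_add_right clinear_add[OF clinear_degree_zero2])
  qed (simp add: tensor_add_left clinear_add[OF clinear_degree_zero2])
qed (simp add: clinear_add[OF clinear_degree_zero2] clinear_add[OF clinear_base_tensor])

section \<open>Coinvariance of a form in terms of a representative\<close>

lemma set_plus_subspace_eq_iff: "u +o cspan S = v +o cspan S \<longleftrightarrow> u - v \<in> cspan S"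
proof
  assume "u +o cspan S = v +o cspan S"
  moreover have "u \<in> u +o cspan S" using set_plus_intro2[OF cvs.span_zero, of u] by simp
  ultimately show "u - v \<in> cspan S" by (simp add: set_plus_imp_minus)
next
  have sub: "u +o cspan S \<subseteq> v +o cspan S" if "u - v \<in> cspan S" for u v
  proof
    fix x assume "x \<in> u +o cspan S"
    then have "x - u \<in> cspan S" by (rule set_plus_imp_minus)
    then have "(x - u) + (u - v) \<in> cspan S" using that by (rule cvs.span_add)
    then show "x \<in> v +o cspan S" by (simp add: set_minus_plus)
  qed
  assume *: "u - v \<in> cspan S"
  then have "v - u \<in> cspan S" using cvs.span_neg by fastforce
  with * sub show "u +o cspan S = v +o cspan S" by blast
qed

text \<open>By \<open>stable\<close> the coaction descends to forms, so the two unions of cosets are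
  single cosets and coinvariance concerns one representative only. It then holds exactly when
  averaging leaves that representative unchanged modulo the squared kernel.\<close>

lemma coinvariant_forms_class:
  assumes "kaehler m M" and s: "s \<in> mult_ker m"
    and stable: "\<And>n. n \<in> mult_ker_sq m M \<Longrightarrow> delta2 n \<in> cspan {n \<otimes> h |n h. n \<in> mult_ker_sq m M}"
  shows "form_class m M s \<in> coinvariant_forms m M \<longleftrightarrow> s - degree_zero2 s \<in> mult_ker_sq m M"
proof -
  interpret kaehler m M by fact
  let ?N = "mult_ker_sq m M" and ?c = "tensor_lift (\<lambda>x h. constant_term h *\<^sub>C x)"
  let ?NH = "cspan {n \<otimes> h |n h. n \<in> ?N} :: ((sphere, sphere) tensor, circle) tensor set"
  have union: "(\<Union>s'\<in>form_class m M s. g s' +o ?NH) = g s +o ?NH"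
    if g: "clinear g" "\<And>n. n \<in> ?N \<Longrightarrow> g n \<in> ?NH" for g
  proof -
    have "g s' +o ?NH = g s +o ?NH" if "s' \<in> form_class m M s" for s'
      unfolding set_plus_subspace_eq_iff clinear_diff[OF g(1), symmetric]
      by (rule g(2)) (use that in_form_class_iff in blast)
    then show ?thesis using form_class_self by blast
  qed
  have one: "n \<otimes> 1 \<in> ?NH" if "n \<in> ?N" for n
    using that by (intro cvs.span_base) blast
  have l: "clinear (\<lambda>s. s \<otimes> (1 :: circle))" by (rule clinearI) (simp_all add: tensor_add_left tensor_scale_left)
  have "form_class m M s \<in> coinvariant_forms m M \<longleftrightarrow> delta2 s - s \<otimes> 1 \<in> ?NH"
  proof -
    have "(\<Union>s'\<in>form_class m M s. delta2 s' +o ?NH) = delta2 s +o ?NH"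
      by (rule union[OF clinear_delta2]) (rule stable)
    moreover have "(\<Union>s'\<in>form_class m M s. (s' \<otimes> 1) +o ?NH) = (s \<otimes> 1) +o ?NH"
      by (rule union[OF l]) (rule one)
    moreover have "form_class m M s \<in> Omega m M" using s by (simp add: Omega_def)
    ultimately show ?thesis
      by (simp only: coinvariant_forms_def Let_def mem_Collect_eq simp_thms set_plus_subspace_eq_iff)
  qed
  also have "\<dots> \<longleftrightarrow> s - degree_zero2 s \<in> ?N"
  proof
    assume *: "delta2 s - s \<otimes> 1 \<in> ?NH"
    \<comment> \<open>The Haar functional maps \<open>?NH\<close> into \<open>?N\<close> and turns
      the coinvariance defect into \<open>degree_zero2 s - s\<close>.\<close>
    have "?c w \<in> ?N" if "w \<in> ?NH" for w
      using that
    proof (induction rule: cvs.span_induct_alt[consumes 1])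
      case base show ?case by (simp add: clinear_0[OF clinear_constant_term_lift] mult_ker_sq_zero)
    next
      case (step c x y)
      then show ?case
        by (auto simp: clinear_add[OF clinear_constant_term_lift] clinear_scale[OF clinear_constant_term_lift]
            constant_term_lift_tensor intro!: mult_ker_sq_add mult_ker_sq_scale)
    qed
    from this[OF *] have "degree_zero2 s - s \<in> ?N"
      using constant_term_circle_power[of 0]
      by (simp add: clinear_diff[OF clinear_constant_term_lift] constant_term_lift_tensor degree_zero2_def
          circle_power_def scaleC_one)
    from mult_ker_sq_diff[OF mult_ker_sq_zero this] show "s - degree_zero2 s \<in> ?N" by simp
  next
    assume *: "s - degree_zero2 s \<in> ?N"
    \<comment> \<open>The averaged tensor is strictly coinvariant, so \<open>s\<close> and
      \<open>s - degree_zero2 s\<close> have the same coinvariance defect.\<close>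
    from cvs.span_diff[OF stable[OF this] one[OF this]] show "delta2 s - s \<otimes> 1 \<in> ?NH"
      by (simp add: clinear_diff[OF clinear_delta2] delta2_degree_zero2 tensor_diff_left)
  qed
  finally show ?thesis .
qed


text \<open>The torus coaction preserves the squared kernel, and components arise from it by
  applying functionals to the torus leg.\<close>

lemma component2_mult_ker_sq:
  assumes "s \<in> mult_ker_sqA" shows "component2 k s \<in> mult_ker_sqA"
proof -
  have "tensor_lift (\<lambda>k' x. Poly_Mapping.lookup k' k *\<^sub>C x) w \<in> mult_ker_sqA"
    if "w \<in> cspan {k \<otimes> n |k n. n \<in> mult_ker_sqA}" for w
    using that
  proof (induction rule: cvs.span_induct_alt[consumes 1])
    case base show ?case by (simp add: clinear_0[OF clinear_tensor_lift[OF cbilinear_component]] mult_ker_sq_zero)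
  next
    case (step c x y)
    then show ?case
      by (auto simp: clinear_add[OF clinear_tensor_lift[OF cbilinear_component]]
          clinear_scale[OF clinear_tensor_lift[OF cbilinear_component]] tensor_lift_tensor[OF cbilinear_component]
          intro!: mult_ker_sq_add mult_ker_sq_scale)
  qed
  from this[OF rho2_mult_ker_sq[OF assms]] show ?thesis unfolding component2_def .
qed

lemma delta2_component2: "delta2 (component2 k s) = component2 k s \<otimes> circle_power (deg k)"
proof (induction s rule: tensor_homogeneous_induct)
  case (homogeneous m a n b)
  have "deg (m + n) = deg m + deg n" by simp
  then show ?case
    by (cases "k = m + n")
      (simp_all only: component2_homogeneous2[OF homogeneous2_tensor[OF homogeneous]] delta2_homogeneous[OF homogeneous]
        simp_thms if_True if_False clinear_0[OF clinear_delta2] tensor_zero_left)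
qed (simp add: component2_add clinear_add[OF clinear_delta2] tensor_add_left)

text \<open>Torus weights determine circle degrees, so a space containing all torus components of
  \<open>s\<close> controls the circle coaction as well.\<close>

lemma delta2_in_span:
  assumes "\<And>k. component2 k s \<in> N"
  shows "delta2 s \<in> cspan {n \<otimes> h |n h. n \<in> N}"
proof -
  obtain F where F: "s = (\<Sum>k\<in>F. component2 k s)" using sum_component2 by blast
  have "(\<Sum>k\<in>F. delta2 (component2 k s)) \<in> cspan {n \<otimes> h |n h. n \<in> N}"
    unfolding delta2_component2 using assms by (intro cvs.span_sum cvs.span_base) blast
  then show ?thesis unfolding clinear_sum[OF clinear_delta2, symmetric] F[symmetric] .
qed

section \<open>The inverse twist\<close>

lemma tensor_twist_inverse: "tensor_twist \<theta> (tensor_twist (- \<theta>) s) = s"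
proof (induction s rule: tensor_homogeneous_induct)
  case (homogeneous m a n b)
  have "weyl (- \<theta>) m n * weyl \<theta> m n = 1" by (simp add: weyl_def flip: exp_add)
  then show ?case
    by (simp add: tensor_twist_homogeneous[OF homogeneous] clinear_scale[OF clinear_tensor_twist] scaleC_scaleC scaleC_one)
qed (simp add: clinear_add[OF clinear_tensor_twist])

lemma tensor_twist_inverse': "tensor_twist (- \<theta>) (tensor_twist \<theta> s) = s"
  using tensor_twist_inverse[of "- \<theta>"] by simp

lemma tensor_twist_mult_ker_iff: "tensor_twist \<theta> s \<in> mult_kerA \<longleftrightarrow> s \<in> mult_ker (twist_mult \<theta>)"
  by (simp add: mult_ker_def tensor_lift_tensor_twist)

lemma tensor_twist_component2: "tensor_twist \<theta> (component2 k s) = component2 k (tensor_twist \<theta> s)"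
proof (induction s rule: tensor_homogeneous_induct)
  case (homogeneous m a n b)
  then show ?case
    using component2_homogeneous2[OF homogeneous2_tensor[OF homogeneous_scale[OF homogeneous(1), of "weyl \<theta> m n"] homogeneous(2)], of k]
    by (simp add: component2_homogeneous2[OF homogeneous2_tensor[OF homogeneous]] tensor_twist_homogeneous
        clinear_0[OF clinear_tensor_twist] tensor_scale_left)
qed (simp add: clinear_add[OF clinear_tensor_twist] component2_add)

lemma tensor_twist_degree_zero2: "tensor_twist \<theta> (degree_zero2 s) = degree_zero2 (tensor_twist \<theta> s)"
proof (induction s rule: tensor_homogeneous_induct)
  case (homogeneous m a n b)
  then show ?case
    by (simp add: degree_zero2_homogeneous[OF homogeneous] tensor_twist_homogeneous
        clinear_0[OF clinear_tensor_twist] clinear_scale[OF clinear_degree_zero2])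
qed (simp add: clinear_add[OF clinear_tensor_twist] clinear_add[OF clinear_degree_zero2])

text \<open>For the new direction, products in \<open>I\<^sup>2\<close> are split into torus
  components. On these the ordinary product is, up to a phase, the twist of a braided product of
  elements of the twisted kernel.\<close>

lemma tensor_twist_mult_ker_sq_iff:
  "tensor_twist \<theta> s \<in> mult_ker_sqA \<longleftrightarrow> s \<in> mult_ker_sq (twist_mult \<theta>) (braid_mult \<theta>)"
proof
  let ?N = "mult_ker_sq (twist_mult \<theta>) (braid_mult \<theta>)"
  have prod: "tensor_twist (- \<theta>) (s * s') \<in> ?N" if ss: "s \<in> mult_kerA" "s' \<in> mult_kerA" for s s'
  proof -
    obtain F F' where F: "s = (\<Sum>m\<in>F. component2 m s)" "s' = (\<Sum>m\<in>F'. component2 m s')"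
      using sum_component2 by metis
    have "tensor_twist (- \<theta>) (component2 m s * component2 n s') \<in> ?N" for m n
    proof -
      let ?b = "braid_mult \<theta> (tensor_twist (- \<theta>) (component2 m s)) (tensor_twist (- \<theta>) (component2 n s'))"
      have "tensor_twist \<theta> ?b = weyl \<theta> m n *\<^sub>C (component2 m s * component2 n s')"
        by (simp add: tensor_twist_braid_mult tensor_twist_inverse
            twist_mult2_homogeneous[OF homogeneous2_component2 homogeneous2_component2])
      \<comment> \<open>Exchanging the arguments of \<open>weyl\<close> inverts the phase.\<close>
      then have "weyl \<theta> n m *\<^sub>C tensor_twist \<theta> ?b = component2 m s * component2 n s'"
        using weyl_swap[of \<theta> n m] by (simp add: scaleC_scaleC scaleC_one)
      then have "tensor_twist (- \<theta>) (component2 m s * component2 n s') = weyl \<theta> n m *\<^sub>C ?b"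
        by (metis clinear_scale clinear_tensor_twist tensor_twist_inverse')
      moreover have "tensor_twist (- \<theta>) (component2 k t) \<in> mult_ker (twist_mult \<theta>)" if "t \<in> mult_kerA" for k t
        using component2_mult_ker[OF that] by (simp add: tensor_twist_inverse flip: tensor_twist_mult_ker_iff)
      ultimately show ?thesis using ss by (simp add: mult_ker_sq_scale mult_ker_sq_base)
    qed
    then have "(\<Sum>m\<in>F. \<Sum>n\<in>F'. tensor_twist (- \<theta>) (component2 m s * component2 n s')) \<in> ?N"
      unfolding mult_ker_sq_def by (intro cvs.span_sum)
    also have "(\<Sum>m\<in>F. \<Sum>n\<in>F'. tensor_twist (- \<theta>) (component2 m s * component2 n s')) =
        tensor_twist (- \<theta>) ((\<Sum>m\<in>F. component2 m s) * (\<Sum>n\<in>F'. component2 n s'))"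
      by (simp only: cbilinear_sum[OF cbilinear_mult] clinear_sum[OF clinear_tensor_twist])
    finally show ?thesis by (simp only: F[symmetric])
  qed
  assume "tensor_twist \<theta> s \<in> mult_ker_sqA"
  then have "tensor_twist (- \<theta>) (tensor_twist \<theta> s) \<in> ?N"
    unfolding mult_ker_sq_def[of "(*) :: sphere \<Rightarrow> _"]
  proof (induction rule: cvs.span_induct_alt[consumes 1])
    case base show ?case by (simp add: clinear_0[OF clinear_tensor_twist] mult_ker_sq_zero)
  next
    case (step c x y)
    then show ?case using prod
      by (auto simp: clinear_add[OF clinear_tensor_twist] clinear_scale[OF clinear_tensor_twist]
          intro!: mult_ker_sq_add mult_ker_sq_scale)
  qed
  then show "s \<in> ?N" by (simp add: tensor_twist_inverse')
qed (rule tensor_twist_mult_ker_sq)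

section \<open>The coinvariance criterion in both calculi\<close>

lemma coinvariant_forms_class_comm:
  assumes "s \<in> mult_kerA"
  shows "form_class (*) (*) s \<in> coinvariant_forms (*) (*) \<longleftrightarrow> s - degree_zero2 s \<in> mult_ker_sqA"
  by (rule coinvariant_forms_class[OF comm.kaehler_axioms assms], rule delta2_in_span, rule component2_mult_ker_sq)

lemma coinvariant_forms_class_theta:
  assumes "s \<in> mult_ker (twist_mult \<theta>)"
  shows "form_class (twist_mult \<theta>) (braid_mult \<theta>) s \<in> coinvariant_forms (twist_mult \<theta>) (braid_mult \<theta>) \<longleftrightarrow>
    s - degree_zero2 s \<in> mult_ker_sq (twist_mult \<theta>) (braid_mult \<theta>)"
proof (rule coinvariant_forms_class[OF theta.kaehler_axioms assms])
  fix n assume n: "n \<in> mult_ker_sq (twist_mult \<theta>) (braid_mult \<theta>)"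
  \<comment> \<open>Membership of the components is tested after twisting, where the squared kernel
    is known to be graded.\<close>
  show "delta2 n \<in> cspan {n \<otimes> h |n h. n \<in> mult_ker_sq (twist_mult \<theta>) (braid_mult \<theta>)}"
    by (rule delta2_in_span)
      (use component2_mult_ker_sq[OF tensor_twist_mult_ker_sq[OF n]] in
        \<open>simp add: tensor_twist_component2 flip: tensor_twist_mult_ker_sq_iff\<close>)
qed

section \<open>Connections\<close>

lemma tensor_lift_contract_star: "tensor_lift (*) contract_star = 1"
  by (simp add: contract_star_def clinear_add[OF clinear_tensor_lift[OF cbilinear_mult]]
      tensor_lift_tensor[OF cbilinear_mult] sphere_relation)

lemma tensor_lift_contract: "tensor_lift (*) contract = 1"
  using sphere_relation
  by (simp add: contract_def clinear_add[OF clinear_tensor_lift[OF cbilinear_mult]]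
      tensor_lift_tensor[OF cbilinear_mult] mult.commute)

lemma tensor_lift_one: "tensor_lift (*) (1 :: (sphere, sphere) tensor) = 1"
  by (simp add: one_tensor_def tensor_lift_tensor[OF cbilinear_mult])

lemma contract_star_mult_ker: "contract_star - 1 \<in> mult_kerA" "contract - 1 \<in> mult_kerA"
  by (simp_all add: mult_ker_def clinear_diff[OF clinear_tensor_lift[OF cbilinear_mult]]
      tensor_lift_contract tensor_lift_contract_star tensor_lift_one)

lemma base_ideal_mult_ker_sq:
  assumes "s \<in> base_ideal (mult_ker_sq (*) (*))" shows "s \<in> mult_ker_sqA"
  using assms unfolding base_ideal_def
proof (induction rule: cvs.span_induct_alt[consumes 1])
  case base show ?case by (rule mult_ker_sq_zero)
next
  case (step c x y)
  then show ?case by (auto intro!: mult_ker_sq_add mult_ker_sq_scale mult_ker_sq_mult base_tensor_mult_ker_sq)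
qed

text \<open>First order expansion at 1; the remainder for \<open>Suc n\<close> is \<open>x\<close>
  times the one for \<open>n\<close> plus a multiple of \<open>(x - 1) * (x - 1)\<close>.\<close>

lemma power_mult_ker_sq:
  assumes "x - 1 \<in> mult_kerA"
  shows "x ^ n - 1 - of_nat n *\<^sub>C (x - 1) \<in> mult_ker_sqA"
proof (induction n)
  case 0 show ?case by (simp add: mult_ker_sq_zero)
next
  case (Suc n)
  have "x * (x ^ n - 1 - of_nat n *\<^sub>C (x - 1)) + of_nat n *\<^sub>C ((x - 1) * (x - 1)) \<in> mult_ker_sqA"
    by (intro mult_ker_sq_add mult_ker_sq_mult mult_ker_sq_scale mult_ker_sq_base Suc assms)
  then show ?case
    by (simp add: right_diff_distrib left_diff_distrib scaleC_mult_right scaleC_add_left cvs.scale_right_diff_distrib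
        scaleC_one algebra_simps)
qed

lemma transport_mult_ker_sq: "transport n - 1 + of_int n *\<^sub>C (contract_star - 1) \<in> mult_ker_sqA"
proof (cases "0 \<le> n")
  case True
  \<comment> \<open>Modulo \<open>I\<^sup>2\<close>, \<open>e - 1\<close> is minus
    \<open>f - 1\<close>, because both \<open>e f - 1\<close> and \<open>(e - 1) (f - 1)\<close> lie
    in \<open>I\<^sup>2\<close>.\<close>
  have "(contract * contract_star - 1) - (contract - 1) * (contract_star - 1) \<in> mult_ker_sqA"
    by (intro mult_ker_sq_diff base_ideal_mult_ker_sq contract_mult_contract_star mult_ker_sq_base contract_star_mult_ker)
  then have "(contract - 1) + (contract_star - 1) \<in> mult_ker_sqA"
    by (simp add: algebra_simps)
  from mult_ker_sq_add[OF power_mult_ker_sq[OF contract_star_mult_ker(2), of "nat n"]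
      mult_ker_sq_scale[OF this, of "of_int n"]] True
  show ?thesis by (simp add: transport_def scaleC_add_right)
next
  case False
  with power_mult_ker_sq[OF contract_star_mult_ker(1), of "nat (- n)"] show ?thesis
    by (simp add: transport_def cvs.scale_minus_left)
qed

text \<open>Transport takes a tensor of total degree zero to one over the base. Its first order
  expansion leaves a multiple of \<open>f - 1\<close>, whose coefficient is the vertical part
  because \<open>X_act\<close> measures the degree of the second leg.\<close>

lemma degree_zero_decomposition:
  "\<exists>t. degree_zero2 s - base_tensor t - (ver_lift (degree_zero2 s) \<otimes> 1) * (contract_star - 1) \<in> mult_ker_sqA"
proof (induction s rule: tensor_homogeneous_induct)
  case (homogeneous m a n b)
  show ?case
  proof (cases "deg m + deg n = 0")
    case True
    let ?n = "of_int (deg n) :: complex" and ?s = "a \<otimes> b" and ?w = "contract_star - 1"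
    obtain t where t: "transport (deg n) * ?s = base_tensor t"
      using transport_range[OF homogeneous(2,1) True] by blast
    have k: "?s - (a * b) \<otimes> 1 \<in> mult_kerA"
      by (simp add: mult_ker_def clinear_diff[OF clinear_tensor_lift[OF cbilinear_mult]] tensor_lift_tensor[OF cbilinear_mult])
    \<comment> \<open>Two errors are combined: replacing \<open>?s\<close> by its product in the
      coefficient of \<open>?w\<close>, and expanding \<open>transport\<close> to first
      order.\<close>
    have "?n *\<^sub>C ((?s - (a * b) \<otimes> 1) * ?w) - ?s * (transport (deg n) - 1 + ?n *\<^sub>C ?w) \<in> mult_ker_sqA"
      by (intro mult_ker_sq_diff mult_ker_sq_scale mult_ker_sq_mult mult_ker_sq_base transport_mult_ker_sq
          k contract_star_mult_ker)
    moreover have "?n *\<^sub>C ((?s - (a * b) \<otimes> 1) * ?w) - ?s * (transport (deg n) - 1 + ?n *\<^sub>C ?w)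
        = ?s - base_tensor t - (?n *\<^sub>C ((a * b) \<otimes> 1)) * ?w"
      unfolding t[symmetric] left_diff_distrib[of ?s] cvs.scale_right_diff_distrib distrib_left
        right_diff_distrib[of ?s] scaleC_mult_left scaleC_mult_right
      by (simp add: algebra_simps)
    moreover have "ver_lift ?s = ?n *\<^sub>C (a * b)"
      by (simp only: ver_lift_def tensor_lift_tensor[OF cbilinear_ver] X_act_homogeneous[OF homogeneous(2)] scaleC_mult_right)
    ultimately have "degree_zero2 ?s - base_tensor t - (ver_lift (degree_zero2 ?s) \<otimes> 1) * ?w \<in> mult_ker_sqA"
      using True by (simp only: simp_thms degree_zero2_homogeneous[OF homogeneous] if_True tensor_scale_left)
    then show ?thesis by blast
  next
    case False
    then have "degree_zero2 (a \<otimes> b) - base_tensor 0 - (ver_lift (degree_zero2 (a \<otimes> b)) \<otimes> 1) * (contract_star - 1) = 0"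
      by (simp add: degree_zero2_homogeneous[OF homogeneous] clinear_0[OF clinear_base_tensor]
          clinear_0[OF clinear_ver_lift] tensor_zero_left)
    then show ?thesis using mult_ker_sq_zero by metis
  qed
next
  case (add s s')
  then obtain t t' where
    "degree_zero2 s - base_tensor t - (ver_lift (degree_zero2 s) \<otimes> 1) * (contract_star - 1) \<in> mult_ker_sqA"
    "degree_zero2 s' - base_tensor t' - (ver_lift (degree_zero2 s') \<otimes> 1) * (contract_star - 1) \<in> mult_ker_sqA"
    by blast
  from mult_ker_sq_add[OF this] show ?case
    by (intro exI[of _ "t + t'"])
      (simp add: clinear_add[OF clinear_degree_zero2] clinear_add[OF clinear_base_tensor] clinear_add[OF clinear_ver_lift]
        tensor_add_left distrib_right add_diff_add)
qed

section \<open>Vertical map and twist on the base and on the reference connection\<close>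

lemma X_act_base: "X_act (Rep_base b) = 0"
proof (induction b rule: base_homogeneous_induct)
  case (homogeneous k a)
  then show ?case by (simp add: X_act_homogeneous[OF homogeneous])
qed (simp add: clinear_add[OF clinear_X_act])

lemma ver_lift_base_tensor: "ver_lift (base_tensor s) = 0"
  by (induction s rule: tensor_induct)
    (simp_all add: base_tensor_tensor ver_lift_def tensor_lift_tensor[OF cbilinear_ver] X_act_base
      clinear_add[OF clinear_base_tensor] clinear_add[OF clinear_tensor_lift[OF cbilinear_ver]])

lemma X_act_generator: "X_act (generator g) = generator g"
  using X_act_homogeneous[OF homogeneous_generator[of g]] unfolding deg_weight by (simp add: scaleC_one)

lemma ver_lift_contract_star: "ver_lift (contract_star - 1) = 1"
  by (simp add: contract_star_def clinear_diff[OF clinear_ver_lift] clinear_add[OF clinear_ver_lift])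
    (simp add: ver_lift_def tensor_lift_tensor[OF cbilinear_ver] X_act_generator X_act_one one_tensor_def sphere_relation)

lemma degree_zero2_contract_star: "degree_zero2 (contract_star - 1) = contract_star - 1"
  using degree_zero2_homogeneous[OF homogeneous_one homogeneous_one]
    degree_zero2_homogeneous[OF homogeneous_star_generator homogeneous_generator]
  by (simp add: contract_star_def clinear_diff[OF clinear_degree_zero2] clinear_add[OF clinear_degree_zero2] one_tensor_def)

lemma twist_mult_star_generator: "twist_mult \<theta> (star (generator g)) (generator g) = star (generator g) * generator g"
  using twist_mult_homogeneous[OF homogeneous_star_generator homogeneous_generator, of \<theta> g g]
  by (simp add: weyl_def scaleC_one)

text \<open>A generator and its adjoint have opposite weights, on which the antisymmetric exponent
  of the phase vanishes.\<close>

lemma tensor_twist_contract_star: "tensor_twist \<theta> (contract_star - 1) = contract_star - 1"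
  using tensor_twist_homogeneous[OF homogeneous_star_generator homogeneous_generator, of \<theta>]
    tensor_twist_homogeneous[OF homogeneous_one homogeneous_one, of \<theta>]
  by (simp add: contract_star_def clinear_diff[OF clinear_tensor_twist] clinear_add[OF clinear_tensor_twist]
      one_tensor_def weyl_def scaleC_one)

text \<open>Weights of the base are multiples of \<open>(1, - 1)\<close>, so all phases are trivial;
  this makes the linear part of \<open>phi_bar\<close> the identity.\<close>

lemma tensor_twist_base_tensor: "tensor_twist \<theta> (base_tensor s) = base_tensor s"
proof (induction s rule: tensor_induct)
  case (tensor b b')
  show ?case unfolding base_tensor_tensor
  proof (induction b rule: base_homogeneous_induct)
    case b: (homogeneous k b)
    show ?case
      by (induction b' rule: base_homogeneous_induct)
        (simp_all add: tensor_twist_homogeneous[OF b] weyl_base scaleC_one tensor_add_right clinear_add[OF clinear_tensor_twist])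
  qed (simp add: tensor_add_left clinear_add[OF clinear_tensor_twist])
qed (simp add: clinear_add[OF clinear_tensor_twist] clinear_add[OF clinear_base_tensor])

section \<open>Connections as classes of tensors\<close>

lemma omega0_eq: "omega0 = form_class (*) (*) (contract_star - 1)"
proof -
  have "(star z1 * z1) \<otimes> (1::sphere) + (star z2 * z2) \<otimes> 1 = 1"
    unfolding tensor_add_left[symmetric] sphere_relation one_tensor_def ..
  then show ?thesis
    by (simp add: omega0_def comm.form_act_d comm.form_class_add contract_star_def flip: add_diff_add)
qed

lemma omega0_theta_eq: "omega0_theta \<theta> = form_class (twist_mult \<theta>) (braid_mult \<theta>) (contract_star - 1)"
proof -
  have "(star z1 * z1) \<otimes> (1::sphere) + (star z2 * z2) \<otimes> 1 = 1"
    unfolding tensor_add_left[symmetric] sphere_relation one_tensor_def ..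
  then show ?thesis
    by (simp add: omega0_theta_def theta.form_act_d theta.form_class_add contract_star_def twist_mult_star_generator
        flip: add_diff_add)
qed

lemma Con_class_iff:
  "s \<in> mult_kerA \<Longrightarrow> form_class (*) (*) s \<in> Con \<longleftrightarrow> s - degree_zero2 s \<in> mult_ker_sqA \<and> ver_lift s = 1"
  by (simp add: Con_def coinvariant_forms_class_comm ver_class)

text \<open>The twist commutes with the projection to degree zero and identifies the squared
  kernels, and \<open>ver_theta\<close> is the vertical map after the twist; so both conditions
  carry over.\<close>

lemma Con_theta_class_iff:
  assumes "s \<in> mult_ker (twist_mult \<theta>)"
  shows "form_class (twist_mult \<theta>) (braid_mult \<theta>) s \<in> Con_theta \<theta> \<longleftrightarrow> form_class (*) (*) (tensor_twist \<theta> s) \<in> Con"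
  using tensor_twist_mult_ker_sq_iff[of \<theta> "s - degree_zero2 s"]
  by (simp add: Con_class_iff[OF tensor_twist_mult_ker[OF assms]] Con_theta_def coinvariant_forms_class_theta[OF assms]
      ver_theta_class[OF assms] clinear_diff[OF clinear_tensor_twist] tensor_twist_degree_zero2)

section \<open>The bijections\<close>

lemma Con_cases:
  assumes "\<omega> \<in> Con"
  obtains s where "s \<in> mult_kerA" "\<omega> = form_class (*) (*) s"
  using assms by (auto simp: Con_def coinvariant_forms_def Omega_def Let_def)

lemma Con_theta_cases:
  assumes "\<omega> \<in> Con_theta \<theta>"
  obtains s where "s \<in> mult_ker (twist_mult \<theta>)" "\<omega> = form_class (twist_mult \<theta>) (braid_mult \<theta>) s"
  using assms by (auto simp: Con_theta_def coinvariant_forms_def Omega_def Let_def)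

text \<open>Injectivity is that of \<open>iota\<close>; surjectivity comes from
  \<open>degree_zero_decomposition\<close> with vertical part 1.\<close>

lemma bij_betw_iota: "bij_betw (\<lambda>\<alpha>. omega0 + iota \<alpha>) OmegaB Con"
proof -
  let ?cl = "form_class (*) (*) :: (sphere, sphere) tensor \<Rightarrow> _" and ?w = "contract_star - 1"
  have iota: "omega0 + iota (form_class (*) (*) t) = ?cl (?w + base_tensor t)" if "t \<in> mult_ker (*)" for t
    by (simp add: omega0_eq iota_class[OF that] comm.form_class_add)
  show ?thesis
  proof (rule bij_betw_imageI)
    show "inj_on (\<lambda>\<alpha>. omega0 + iota \<alpha>) OmegaB"
    proof (rule inj_onI)
      fix \<alpha> \<alpha>' assume "\<alpha> \<in> OmegaB" "\<alpha>' \<in> OmegaB" and eq: "omega0 + iota \<alpha> = omega0 + iota \<alpha>'"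
      then obtain t t' where t: "t \<in> mult_ker (*)" "t' \<in> mult_ker (*)" "\<alpha> = form_class (*) (*) t" "\<alpha>' = form_class (*) (*) t'"
        by (auto simp: Omega_def)
      have "base_tensor (t - t') \<in> mult_ker_sqA"
        using eq by (simp add: t(3,4) iota[OF t(1)] iota[OF t(2)] comm.form_class_eq_iff clinear_diff[OF clinear_base_tensor])
      then show "\<alpha> = \<alpha>'"
        by (simp add: base_tensor_mult_ker_sq_iff t(3,4) comm.form_class_eq_iff)
    qed
    show "(\<lambda>\<alpha>. omega0 + iota \<alpha>) ` OmegaB = Con"
    proof (intro equalityI subsetI)
      fix \<omega> assume "\<omega> \<in> (\<lambda>\<alpha>. omega0 + iota \<alpha>) ` OmegaB"
      then obtain t where t: "t \<in> mult_ker (*)" "\<omega> = omega0 + iota (form_class (*) (*) t)" by (auto simp: Omega_def)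
      have k: "?w + base_tensor t \<in> mult_kerA"
        by (intro comm.mult_ker_add contract_star_mult_ker base_tensor_mult_ker t)
      show "\<omega> \<in> Con"
        unfolding t(2) iota[OF t(1)] Con_class_iff[OF k]
        by (simp add: clinear_add[OF clinear_degree_zero2] clinear_add[OF clinear_ver_lift] degree_zero2_contract_star
            degree_zero2_base_tensor ver_lift_base_tensor ver_lift_contract_star mult_ker_sq_zero)
    next
      fix \<omega> assume \<omega>: "\<omega> \<in> Con"
      then obtain s where s: "s \<in> mult_kerA" "\<omega> = ?cl s" by (rule Con_cases)
      let ?z = "degree_zero2 s"
      from \<omega> have sz: "s - ?z \<in> mult_ker_sqA" "ver_lift s = 1" by (auto simp: s Con_class_iff)
      then have "ver_lift ?z = 1"
        using ver_lift_mult_ker_sq[OF sz(1)] by (simp add: clinear_diff[OF clinear_ver_lift])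
      then obtain t where "?z - base_tensor t - ?w \<in> mult_ker_sqA"
        using degree_zero_decomposition[of s] by (auto simp: one_tensor_def[symmetric])
      from mult_ker_sq_add[OF sz(1) this] have st: "s - (?w + base_tensor t) \<in> mult_ker_sqA"
        by (simp add: algebra_simps)
      \<comment> \<open>The decomposition does not say that \<open>t\<close> lies in the kernel;
        this follows since \<open>base_tensor t\<close> is a combination of elements of
        \<open>I\<close> and \<open>Rep_base\<close> is injective.\<close>
      have "base_tensor t = s - ?w - (s - (?w + base_tensor t))" by simp
      moreover have "tensor_lift (*) (s - ?w - (s - (?w + base_tensor t))) = 0"
        using s(1) contract_star_mult_ker(1) mult_ker_sq_subset[OF st]
        unfolding mult_ker_def by (simp only: mem_Collect_eq clinear_diff[OF clinear_tensor_lift[OF cbilinear_mult]]) simp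
      ultimately have "Rep_base (tensor_lift (*) t) = 0"
        unfolding tensor_lift_base_tensor(1)[symmetric] by (simp only:)
      then have t: "t \<in> mult_ker (*)"
        by (simp add: mult_ker_def Rep_base_inject flip: zero_base.rep_eq)
      have "\<omega> = omega0 + iota (form_class (*) (*) t)"
        unfolding iota[OF t] s(2) comm.form_class_eq_iff by (rule st)
      with t show "\<omega> \<in> (\<lambda>\<alpha>. omega0 + iota \<alpha>) ` OmegaB" by (auto simp: Omega_def)
    qed
  qed
qed

lemma bij_betw_phi_bar: "bij_betw (phi_bar \<theta>) (Con_theta \<theta>) Con"
proof (rule bij_betw_imageI)
  let ?cl = "form_class (twist_mult \<theta>) (braid_mult \<theta>)"
  show "inj_on (phi_bar \<theta>) (Con_theta \<theta>)"
  proof (rule inj_onI)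
    fix \<omega> \<omega>' assume "\<omega> \<in> Con_theta \<theta>" "\<omega>' \<in> Con_theta \<theta>" and eq: "phi_bar \<theta> \<omega> = phi_bar \<theta> \<omega>'"
    then obtain s s' where s: "s \<in> mult_ker (twist_mult \<theta>)" "\<omega> = ?cl s" "s' \<in> mult_ker (twist_mult \<theta>)" "\<omega>' = ?cl s'"
      by (metis Con_theta_cases)
    from eq show "\<omega> = \<omega>'"
      unfolding s(2,4) phi_bar_class[OF s(1)] phi_bar_class[OF s(3)] comm.form_class_eq_iff theta.form_class_eq_iff
        clinear_diff[OF clinear_tensor_twist, symmetric] tensor_twist_mult_ker_sq_iff .
  qed
  show "phi_bar \<theta> ` Con_theta \<theta> = Con"
  proof (intro equalityI subsetI)
    fix \<omega> assume "\<omega> \<in> phi_bar \<theta> ` Con_theta \<theta>"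
    then obtain \<omega>' where \<omega>': "\<omega>' \<in> Con_theta \<theta>" "\<omega> = phi_bar \<theta> \<omega>'" by blast
    then obtain s where s: "s \<in> mult_ker (twist_mult \<theta>)" "\<omega>' = ?cl s" by (metis Con_theta_cases)
    with \<omega>' show "\<omega> \<in> Con" by (simp add: phi_bar_class Con_theta_class_iff)
  next
    fix \<omega> assume \<omega>: "\<omega> \<in> Con"
    then obtain s where s: "s \<in> mult_kerA" "\<omega> = form_class (*) (*) s" by (rule Con_cases)
    \<comment> \<open>The preimage is found by twisting with \<open>- \<theta>\<close>.\<close>
    let ?t = "tensor_twist (- \<theta>) s"
    have t: "?t \<in> mult_ker (twist_mult \<theta>)" using s(1) by (simp add: tensor_twist_inverse flip: tensor_twist_mult_ker_iff)
    have "?cl ?t \<in> Con_theta \<theta>" "phi_bar \<theta> (?cl ?t) = \<omega>"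
      using \<omega> by (simp_all add: Con_theta_class_iff[OF t] phi_bar_class[OF t] tensor_twist_inverse s(2))
    then show "\<omega> \<in> phi_bar \<theta> ` Con_theta \<theta>" by blast
  qed
qed

text \<open>On representatives \<open>phi_bar\<close> is the linear map \<open>tensor_twist\<close>,
  which fixes tensors over the base.\<close>

lemma phi_bar_add_iota_theta:
  assumes "\<omega> \<in> Omega_theta \<theta>" "\<alpha> \<in> OmegaB"
  shows "phi_bar \<theta> (\<omega> + iota_theta \<theta> \<alpha>) = phi_bar \<theta> \<omega> + iota \<alpha>"
proof -
  from assms obtain s t where st: "s \<in> mult_ker (twist_mult \<theta>)" "\<omega> = form_class (twist_mult \<theta>) (braid_mult \<theta>) s"
    "t \<in> mult_ker (*)" "\<alpha> = form_class (*) (*) t"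
    by (auto simp: Omega_def)
  from base_tensor_mult_ker(2)[OF st(3)] have "base_tensor t \<in> mult_ker (twist_mult \<theta>)" .
  with st show ?thesis
    by (simp add: iota_class iota_theta_class theta.form_class_add phi_bar_class theta.mult_ker_add
        comm.form_class_add clinear_add[OF clinear_tensor_twist] tensor_twist_base_tensor)
qed

theorem proposition4p12:
  fixes \<theta> :: real
  shows
    "bij_betw (\<lambda>\<alpha>. omega0 + iota \<alpha>) OmegaB Con \<and>
     bij_betw (\<lambda>\<alpha>. omega0_theta \<theta> + iota_theta \<theta> \<alpha>) OmegaB (Con_theta \<theta>) \<and>
     bij_betw (phi_bar \<theta>) (Con_theta \<theta>) Con \<and>
     (\<forall>\<alpha>\<in>OmegaB. phi_bar \<theta> (omega0_theta \<theta> + iota_theta \<theta> \<alpha>) = omega0 + iota \<alpha>) \<and>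
     phi_bar \<theta> (omega0_theta \<theta>) = omega0 \<and>
     (\<forall>\<omega>\<in>Con_theta \<theta>. \<forall>\<alpha>\<in>OmegaB.
        phi_bar \<theta> (\<omega> + iota_theta \<theta> \<alpha>) = phi_bar \<theta> \<omega> + iota \<alpha>)"
proof -
  let ?f = "\<lambda>\<alpha>. omega0_theta \<theta> + iota_theta \<theta> \<alpha>"
  have w: "contract_star - 1 \<in> mult_ker (twist_mult \<theta>)"
    using contract_star_mult_ker(1) by (simp add: tensor_twist_contract_star flip: tensor_twist_mult_ker_iff)
  then have \<omega>: "omega0_theta \<theta> \<in> Omega_theta \<theta>" unfolding omega0_theta_eq Omega_def by blast
  have phi0: "phi_bar \<theta> (omega0_theta \<theta>) = omega0"
    by (simp add: omega0_theta_eq omega0_eq phi_bar_class[OF w] tensor_twist_contract_star)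
  have phi: "phi_bar \<theta> (?f \<alpha>) = omega0 + iota \<alpha>" if "\<alpha> \<in> OmegaB" for \<alpha>
    unfolding phi_bar_add_iota_theta[OF \<omega> that] phi0 ..
  have f: "?f \<alpha> \<in> Con_theta \<theta>" if "\<alpha> \<in> OmegaB" for \<alpha>
  proof -
    obtain t where t: "t \<in> mult_ker (*)" "\<alpha> = form_class (*) (*) t" using \<open>\<alpha> \<in> OmegaB\<close> by (auto simp: Omega_def)
    have k: "contract_star - 1 + base_tensor t \<in> mult_ker (twist_mult \<theta>)"
      by (intro theta.mult_ker_add w base_tensor_mult_ker t)
    have f: "?f \<alpha> = form_class (twist_mult \<theta>) (braid_mult \<theta>) (contract_star - 1 + base_tensor t)"
      by (simp add: t(2) omega0_theta_eq iota_theta_class[OF t(1)] theta.form_class_add)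
    have "omega0 + iota \<alpha> \<in> Con" using bij_betwE[OF bij_betw_iota] that by blast
    then show ?thesis
      using phi[OF that] unfolding f Con_theta_class_iff[OF k] phi_bar_class[OF k] by simp
  qed
  \<comment> \<open>Composed with the bijection \<open>phi_bar\<close>, the parametrisation
    \<open>?f\<close> becomes the known one for \<open>A\<close>, so \<open>?f\<close> is bijective
    too.\<close>
  have "bij_betw (phi_bar \<theta> \<circ> ?f) OmegaB Con"
    using bij_betw_iota by (rule bij_betw_cong[THEN iffD2, rotated]) (simp add: phi)
  then have "bij_betw ?f OmegaB (Con_theta \<theta>)"
    using f by (intro bij_betw_comp_iff2[OF bij_betw_phi_bar, THEN iffD2]) auto
  moreover have "Con_theta \<theta> \<subseteq> Omega_theta \<theta>" by (auto simp: Con_theta_def coinvariant_forms_def Let_def)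
  ultimately show ?thesis
    using bij_betw_iota bij_betw_phi_bar phi phi0 phi_bar_add_iota_theta by blast
qed

end
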